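(* Let $d\geqslant2$ and let $\mu$ be a Borel probability measure on $GL(d,\mathbb R)$ satisfying (A1) and (A2). Then for every $s\in I_\mu^+$ and every proper algebraic subset $Y$ of $\mathbb P^{d-1}$, either $\nu_s(Y)=0$ or $\nu_s(Y)=1$.
   Context: $\Gamma_\mu$ is the smallest closed subsemigroup of $GL(d,\mathbb R)$ containing $\operatorname{supp}\mu$. (A1): no finite union of proper linear subspaces of $\mathbb R^d$ is $\Gamma_\mu$-invariant. (A2): $\Gamma_\mu$ contains a matrix with an algebraically simple eigenvalue of modulus strictly larger than all its other eigenvalues. For $g\in GL(d,\mathbb R)$ and $x=\mathbb Rv\in\mathbb P^{d-1}$, $\sigma(g,x)=\log\frac{|gv|}{|v|}$ (Euclidean norm), and $gx=\mathbb R gv$. $I_\mu^+=\{s\geqslant0:\int\|g\|^s\mu(dg)<\infty\}$. For $s\in I_\mu^+$ the transfer operator on continuous functions on $\mathbb P^{d-1}$ is $P_s\varphi(x)=\int e^{s\sigma(g,x)}\varphi(gx)\mu(dg)$. It is known (Guivarc'h–Le Page) that under (A1),(A2), for $s\in I_\mu^+$ there is a number $\kappa(s)>0$ and a unique probability measure $\nu_s$ on $\mathbb P^{d-1}$ with $\int P_s\varphi\,d\nu_s=\kappa(s)\int\varphi\,d\nu_s$ for all continuous $\varphi$. A subset of $\mathbb P^{d-1}$ is algebraic if it is the projective image of a subset of $\mathbb R^d$ that is the common zero set of finitely many polynomials and is invariant under scalar multiplication. *)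

theory Defs
  imports "HOL-Probability.Probability" "HOL-Computational_Algebra.Polynomial"
begin

definition GL :: "(real^'n^'n) set" where
  "GL = {g. invertible g}"

definition pline :: "real^'n \<Rightarrow> (real^'n) set" where
  "pline v = {c *\<^sub>R v | c. True}"

definition Proj :: "((real^'n) set) set" where
  "Proj = {pline v | v. v \<noteq> 0}"

definition proj_borel :: "((real^'n) set) measure" where
  "proj_borel = sigma Proj
     {A. A \<subseteq> Proj \<and> {v. v \<noteq> 0 \<and> pline v \<in> A} \<in> sets borel}"

definition proj_continuous :: "((real^'n) set \<Rightarrow> real) \<Rightarrow> bool" where
  "proj_continuous \<phi> \<longleftrightarrow> continuous_on (UNIV - {0}) (\<lambda>v. \<phi> (pline v))"

definition rep :: "(real^'n) set \<Rightarrow> real^'n" where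
  "rep x = (SOME v. v \<in> x \<and> v \<noteq> 0)"

definition pact :: "real^'n^'n \<Rightarrow> (real^'n) set \<Rightarrow> (real^'n) set" where
  "pact g x = pline (g *v rep x)"

definition cocycle :: "real^'n^'n \<Rightarrow> (real^'n) set \<Rightarrow> real" where
  "cocycle g x = ln (norm (g *v rep x) / norm (rep x))"

definition transfer_op ::
  "(real^'n^'n) measure \<Rightarrow> real \<Rightarrow> ((real^'n) set \<Rightarrow> real) \<Rightarrow> (real^'n) set \<Rightarrow> real" where
  "transfer_op \<mu> s \<phi> x = (\<integral>g. exp (s * cocycle g x) * \<phi> (pact g x) \<partial>\<mu>)"

definition I_plus :: "(real^'n^'n) measure \<Rightarrow> real set" where
  "I_plus \<mu> = {s. 0 \<le> s \<and> (\<integral>\<^sup>+ g. ennreal (norm g powr s) \<partial>\<mu>) < \<infinity>}"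

definition supp_GL :: "(real^'n^'n) measure \<Rightarrow> (real^'n^'n) set" where
  "supp_GL \<mu> = {g \<in> GL. \<forall>e>0. emeasure \<mu> (ball g e) > 0}"

definition Gamma :: "(real^'n^'n) measure \<Rightarrow> (real^'n^'n) set" where
  "Gamma \<mu> = \<Inter>{S. supp_GL \<mu> \<subseteq> S \<and> S \<subseteq> GL \<and> closedin (top_of_set GL) S
                  \<and> (\<forall>a\<in>S. \<forall>b\<in>S. a ** b \<in> S)}"

text \<open>(A1): strong irreducibility. Subspaces are required nonzero (projectively nonempty).\<close>
definition cond_A1 :: "(real^'n^'n) set \<Rightarrow> bool" where
  "cond_A1 \<Gamma> \<longleftrightarrow> \<not> (\<exists>\<V>. finite \<V> \<and> \<V> \<noteq> {} \<and>
      (\<forall>V\<in>\<V>. subspace V \<and> V \<noteq> UNIV \<and> V \<noteq> {0}) \<and>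
      (\<forall>g\<in>\<Gamma>. (\<lambda>v. g *v v) ` (\<Union>\<V>) \<subseteq> \<Union>\<V>))"

definition charpoly_c :: "real^'n^'n \<Rightarrow> complex poly" where
  "charpoly_c g = det (\<chi> i j. (if i = j then [:0, 1:] else 0) - [:complex_of_real (g $ i $ j):])"

definition proximal :: "real^'n^'n \<Rightarrow> bool" where
  "proximal g \<longleftrightarrow> (\<exists>l. order l (charpoly_c g) = 1 \<and>
      (\<forall>z. poly (charpoly_c g) z = 0 \<and> z \<noteq> l \<longrightarrow> cmod z < cmod l))"

definition cond_A2 :: "(real^'n^'n) set \<Rightarrow> bool" where
  "cond_A2 \<Gamma> \<longleftrightarrow> (\<exists>g\<in>\<Gamma>. proximal g)"

definition poly_fun :: "(real^'n \<Rightarrow> real) \<Rightarrow> bool" where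
  "poly_fun p \<longleftrightarrow> (\<exists>F c. finite (F :: ('n \<Rightarrow> nat) set) \<and>
      p = (\<lambda>v. \<Sum>\<alpha>\<in>F. c \<alpha> * (\<Prod>i\<in>UNIV. (v $ i) ^ (\<alpha> i))))"

definition proj_algebraic :: "((real^'n) set) set \<Rightarrow> bool" where
  "proj_algebraic Y \<longleftrightarrow> (\<exists>P Z. finite P \<and> (\<forall>p\<in>P. poly_fun p) \<and>
      Z = {v. \<forall>p\<in>P. p v = 0} \<and> (\<forall>c v. v \<in> Z \<longrightarrow> c *\<^sub>R v \<in> Z) \<and>
      Y = {pline v | v. v \<in> Z \<and> v \<noteq> 0})"

end

theory Submission
  imports Defs "HOL-Library.Function_Algebras" "HOL-Computational_Algebra.Fundamental_Theorem_Algebra"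
begin

text \<open>
  Write \<open>h \<cdot> \<nu>\<close> for the image of \<open>exp (s \<sigma>(h, x)) \<nu>(dx)\<close> under \<open>h\<close>. The eigenmeasure equation says
  that \<open>\<kappa>\<close> times \<open>h \<cdot> \<nu>\<close> is the \<open>\<mu>\<close>-mean of \<open>(h g) \<cdot> \<nu>\<close>, so the normalized measures \<open>h \<cdot> \<nu>\<close> form
  a martingale along the products \<open>g\<^sub>1 \<dots> g\<^sub>n\<close> whose law is reweighted by the total masses. Let \<open>O(x)\<close> be
  the orthogonal projection onto the line \<open>x\<close>. The energy of \<open>h\<close>, the squared norm of the mean of \<open>O\<close>
  under \<open>h \<cdot> \<nu>\<close> divided by its total mass, increases in mean along this martingale. At a limit point
  \<open>A\<close> of the normalized products it no longer increases, so the mean of \<open>O\<close> under the normalized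
  \<open>(A \<gamma>) \<cdot> \<nu>\<close> is the same for all \<open>\<gamma>\<close> in \<open>\<Gamma>\<^sub>\<mu>\<close>; powers of a proximal matrix make \<open>A \<gamma>\<close> converge to
  rank one, hence this mean is a single projection and \<open>A \<cdot> \<nu>\<close> is a Dirac mass.

  Therefore, if \<open>\<nu>(Y) > 0\<close>, there are invertible \<open>h\<^sub>n\<close> such that the normalized \<open>h\<^sub>n \<cdot> \<nu>\<close> give \<open>Y\<close> mass
  tending to one. If \<open>h\<^sub>n\<close> tends to \<open>A\<close> after rescaling, almost every \<open>x\<close> outside the kernel of \<open>A\<close> lies
  in infinitely many of the sets \<open>h\<^sub>n\<inverse> Y\<close>. For a hyperplane \<open>Y\<close> this would cover \<open>\<nu>\<close> by two proper
  subspaces, against strong irreducibility; so hyperplanes are null and the kernel of \<open>A\<close> can be ignored.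
  For an algebraic \<open>Y\<close>, the polynomials vanishing on \<open>h\<^sub>n\<inverse> Y\<close> form spaces of constant dimension
  with a limit consisting of polynomials that vanish almost everywhere; counting dimensions shows that \<open>Y\<close>
  is the zero set of the polynomials that vanish almost everywhere, up to a null set.
\<close>

section \<open>Powers of proximal matrices\<close>

text \<open>Singular limit matrices dictate the order of the proof. The weight
  \<open>norm (h *v u) powr s\<close> has to be continuous as \<open>h\<close> tends to a nonzero
  matrix with a kernel. For s > 0 this is automatic, since the weight tends to 0 on the kernel. For
  s = 0 it requires null kernels, and before any concentration is available; hence a separate
  maximum principle for s = 0, while null kernels for all s only come out of the concentration
  argument. No random walk and no product space is built. The transition operator acts on functions
  with values in \<open>ennreal\<close>, where iteration needs no integrability, and the increasing
  limit of the averaged energies serves as the least harmonic majorant of the energy. Its lower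
  semicontinuity, which Fatou provides, is the direction needed at limit points. The existence of
  matrices with prescribed properties is proved by contradiction: failure at every \<open>h\<close>
  is one linear inequality between harmonic functions and energies, which is then averaged from the
  identity. Terms are moved across so that both sides stay nonnegative.\<close>

lemma det_pCons:
  fixes A :: "complex^'n^'n"
  shows "det (\<chi> i j. [:A $ i $ j:]) = [:det A:]"
proof -
  have prod: "(\<Prod>i\<in>I. [:f i:]) = [:\<Prod>i\<in>I. f i:]" if "finite I" for I and f :: "'n \<Rightarrow> complex"
    using that by (induction I) (auto simp: one_pCons)
  have sum: "(\<Sum>i\<in>I. [:f i:]) = [:\<Sum>i\<in>I. f i:]" if "finite I" for I and f :: "('n \<Rightarrow> 'n) \<Rightarrow> complex"
    using that by (induction I) auto
  have *: "of_int (sign p) * (\<Prod>i\<in>UNIV. [:A $ i $ p i:]) = [:of_int (sign p) * (\<Prod>i\<in>UNIV. A $ i $ p i):]" for p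
    by (simp add: prod of_int_poly)
  show ?thesis
    unfolding det_def by (simp add: * sum finite_permutations)
qed

lemma poly_charpoly_c:
  "poly (charpoly_c g) z = det (\<chi> i j. (if i = j then z else 0) - complex_of_real (g $ i $ j))"
  unfolding charpoly_c_def det_def
  by (simp add: poly_sum poly_prod if_distrib[of "\<lambda>p. poly p z"] cong: if_cong)

definition complexify :: "real^'n^'n \<Rightarrow> complex^'n^'n" where
  "complexify g = (\<chi> i j. complex_of_real (g $ i $ j))"

definition op_minus :: "real^'n^'n \<Rightarrow> complex \<Rightarrow> complex^'n \<Rightarrow> complex^'n" where
  "op_minus g z v = complexify g *v v - z *s v"

lemma op_minus_smult: "op_minus g z (c *s v) = c *s op_minus g z v"
  by (simp add: op_minus_def algebra_simps vector_scalar_commute vec.scale_right_diff_distrib)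

lemma op_minus_0 [simp]: "op_minus g z 0 = 0"
  by (simp add: op_minus_def)

lemma op_minus_commute: "op_minus g z (op_minus g y v) = op_minus g y (op_minus g z v)"
  by (simp add: op_minus_def algebra_simps vector_scalar_commute vec.scale_right_diff_distrib)

lemma charpoly_root_iff: "poly (charpoly_c g) z = 0 \<longleftrightarrow> (\<exists>v. v \<noteq> 0 \<and> op_minus g z v = 0)"
proof -
  let ?M = "\<chi> i j. (if i = j then z else 0) - complex_of_real (g $ i $ j)"
  have M: "?M *v v = - op_minus g z v" for v
    by (simp add: vec_eq_iff op_minus_def complexify_def matrix_vector_mult_def left_diff_distrib
        sum_subtractf if_distrib[of "\<lambda>x. x * _"] cong: if_cong)
  have "poly (charpoly_c g) z = 0 \<longleftrightarrow> \<not> invertible ?M"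
    by (simp add: poly_charpoly_c invertible_det_nz)
  also have "\<dots> \<longleftrightarrow> (\<exists>v. v \<noteq> 0 \<and> ?M *v v = 0)"
    unfolding invertible_left_inverse matrix_left_invertible_ker by auto
  finally show ?thesis by (simp add: M)
qed

text \<open>Expanding the determinant in a basis that starts with the two vectors exhibits the double root.\<close>
lemma charpoly_double_root:
  fixes g :: "real^'n^'n"
  assumes u1: "u1 \<noteq> 0" and u2: "\<And>a. u2 \<noteq> a *s u1"
    and e1: "op_minus g l u1 = 0" and e2: "op_minus g l u2 = c *s u1"
  shows "[:-l, 1:]^2 dvd charpoly_c g"
proof -
  have "vec.independent {u2, u1}"
    using u1 u2 by (auto simp: vec.independent_insert vec.span_singleton)
  then obtain B where B: "{u2, u1} \<subseteq> B" "vec.independent B" "UNIV \<subseteq> vec.span B"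
    using vec.maximal_independent_subset_extend[of "{u2, u1}" UNIV] by auto
  have cB: "card B = CARD('n)"
    using vec.basis_card_eq_dim[of B UNIV] B vec.dim_UNIV by (auto simp: card_cart_basis)
  have "finite B" using B(2) by (simp add: vec.finiteI_independent)
  then obtain f where f: "bij_betw f (UNIV :: 'n set) B"
    using cB finite_same_card_bij[of "UNIV::'n set" B] by auto
  obtain k1 k2 where k: "f k1 = u1" "f k2 = u2"
    using f B(1) by (metis bij_betw_imp_surj_on imageE insert_subset)
  have k12: "k1 \<noteq> k2" using k u2[of 1] by auto
  define S :: "complex^'n^'n" where "S = (\<chi> i. f i)"
  have "det S \<noteq> 0"
  proof -
    have "\<exists>B'. S ** B' = mat 1"
      unfolding matrix_right_invertible_independent_rows
    proof (intro allI impI)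
      fix a i
      assume "(\<Sum>i\<in>UNIV. a i *s row i S) = 0"
      then have "(\<Sum>i\<in>UNIV. a i *s f i) = 0" by (simp add: S_def row_def vec_lambda_eta)
      moreover have "(\<Sum>i\<in>UNIV. a i *s f i) = (\<Sum>b\<in>B. a (inv_into UNIV f b) *s b)"
        using f by (subst sum.reindex_bij_betw[OF f, symmetric])
          (auto intro!: sum.cong simp: bij_betw_def inv_into_f_f)
      ultimately have "a (inv_into UNIV f (f i)) = 0"
        using B(2) \<open>finite B\<close> f vec.independentD[of B B "\<lambda>b. a (inv_into UNIV f b)" "f i"]
        by (auto simp: bij_betw_def)
      then show "a i = 0" using f by (simp add: bij_betw_def inv_into_f_f)
    qed
    then show ?thesis by (simp add: invertible_det_nz[symmetric] invertible_right_inverse)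
  qed
  define pc :: "complex^'n \<Rightarrow> complex poly^'n" where "pc u = (\<chi> j. [:u $ j:])" for u
  define S' :: "complex poly^'n^'n" where "S' = (\<chi> i. pc (f i))"
  define M :: "complex poly^'n^'n" where
    "M = (\<chi> i j. (if i = j then [:0, 1:] else 0) - [:complex_of_real (g $ i $ j):])"
  \<comment> \<open>Row \<open>i\<close> of \<open>N\<close> is X - g applied to the basis vector
    \<open>f i\<close>, so factors X - l can be pulled out row by row.\<close>
  define N where "N = S' ** transpose M"
  let ?x = "[:-l, 1:]"
  have detS': "det S' = [:det S:]"
    using det_pCons[of S] by (simp add: S'_def S_def pc_def)
  have detN: "det N = smult (det S) (charpoly_c g)"
    by (simp add: N_def det_mul detS' M_def charpoly_c_def)
  have rowN: "N $ i = ?x *s pc (f i) - pc (op_minus g l (f i))" for i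
  proof -
    have sum: "(\<Sum>i\<in>I. [:h i:]) = [:\<Sum>i\<in>I. h i:]" if "finite I" for I and h :: "'n \<Rightarrow> complex"
      using that by (induction I) auto
    have "N $ i $ j = ?x * [:f i $ j:] - [:op_minus g l (f i) $ j:]" for j
      unfolding N_def matrix_matrix_mult_def transpose_def
      by (simp add: S'_def pc_def M_def right_diff_distrib sum_subtractf smult_diff_right
        if_distrib[of "\<lambda>x. _ * x"] if_distrib[of "smult _"] op_minus_def complexify_def matrix_vector_mult_def sum
         mult.commute cong: if_cong)
    then show ?thesis by (simp add: vec_eq_iff pc_def)
  qed
  have N1: "N $ k1 = ?x *s pc u1"
    unfolding rowN k e1 by (simp add: vec_eq_iff pc_def)
  have N2: "N $ k2 = ?x *s pc u2 - [:c:] *s pc u1"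
    unfolding rowN k e2 by (simp add: vec_eq_iff pc_def)
  define P where "P = (\<chi> i. if i = k1 then pc u1 else N $ i)"
  define Q where "Q = (\<chi> i. if i = k2 then pc u2 else P $ i)"
  have "N = (\<chi> i. if i = k1 then ?x *s pc u1 else N $ i)"
    using N1 by (simp add: vec_eq_iff)
  then have "det N = ?x * det P"
    unfolding P_def by (metis det_row_mul[of k1 ?x "\<lambda>_. pc u1" "\<lambda>i. N $ i"])
  \<comment> \<open>Row \<open>k2\<close> of \<open>P\<close> is (X - l) u2 - c u1. The first
    extraction has left u1 itself in row \<open>k1\<close>, so \<open>c\<close> times that row
    cancels the defect. This covers a second eigenvector (c = 0) and a Jordan chain (c = 1)
    alike.\<close>
  moreover have "det P = det (\<chi> k. if k = k2 then row k2 P + [:c:] *s row k1 P else row k P)"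
    using k12 by (simp add: det_row_operation)
  moreover have "(\<chi> k. if k = k2 then row k2 P + [:c:] *s row k1 P else row k P)
      = (\<chi> k. if k = k2 then ?x *s pc u2 else P $ k)"
    using k12 N2 by (simp add: vec_eq_iff row_def P_def)
  moreover have "det (\<chi> k. if k = k2 then ?x *s pc u2 else P $ k) = ?x * det Q"
    unfolding Q_def using det_row_mul[of k2 ?x "\<lambda>_. pc u2" "\<lambda>i. P $ i"] by simp
  ultimately have "smult (det S) (charpoly_c g) = ?x^2 * det Q"
    by (simp only: detN power2_eq_square mult.assoc)
  then have "?x^2 dvd smult (det S) (charpoly_c g)" by simp
  then show ?thesis using \<open>det S \<noteq> 0\<close> dvd_smult_cancel by blast
qed


section \<open>Annihilating lists of eigenvalues and the growth of powers\<close>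

definition eigenvalue_c :: "real^'n^'n \<Rightarrow> complex \<Rightarrow> bool" where
  "eigenvalue_c g z \<longleftrightarrow> (\<exists>v. v \<noteq> 0 \<and> op_minus g z v = 0)"

primrec ops :: "real^'n^'n \<Rightarrow> complex list \<Rightarrow> complex^'n \<Rightarrow> complex^'n" where
  "ops g [] v = v"
| "ops g (z # zs) v = ops g zs (op_minus g z v)"

lemma ops_commute: "ops g zs (op_minus g z v) = op_minus g z (ops g zs v)"
proof (induction zs arbitrary: v)
  case (Cons a zs)
  have "ops g (a # zs) (op_minus g z v) = ops g zs (op_minus g z (op_minus g a v))"
    by (simp add: op_minus_commute[of g a z])
  then show ?case by (simp add: Cons)
qed simp

definition poly_op :: "real^'n^'n \<Rightarrow> complex poly \<Rightarrow> complex^'n \<Rightarrow> complex^'n" where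
  "poly_op g p v = (\<Sum>i\<le>degree p. coeff p i *s (((*v) (complexify g)) ^^ i) v)"

lemma poly_op_bound:
  assumes "degree p \<le> n"
  shows "poly_op g p v = (\<Sum>i\<le>n. coeff p i *s (((*v) (complexify g)) ^^ i) v)"
  unfolding poly_op_def using assms
  by (intro sum.mono_neutral_left) (auto simp: coeff_eq_0)

lemma poly_op_linear_factor: "poly_op g ([:-z, 1:] * q) v = poly_op g q (op_minus g z v)"
proof -
  let ?G = "((*v) (complexify g))"
  let ?n = "degree q"
  have lin: "(?G ^^ i) (op_minus g z v) = (?G ^^ Suc i) v - z *s (?G ^^ i) v" for i
    by (induction i) (simp_all add: op_minus_def matrix_vector_mult_diff_distrib vector_scalar_commute)
  have c: "coeff ([:-z, 1:] * q) i = (if i = 0 then 0 else coeff q (i - 1)) - z * coeff q i" for i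
    by (simp add: coeff_pCons split: nat.splits)
  have "degree ([:-z, 1:] * q) \<le> Suc ?n"
    by (rule order_trans[OF degree_mult_le]) simp
  then have "poly_op g ([:-z, 1:] * q) v =
      (\<Sum>i\<le>Suc ?n. (if i = 0 then 0 else coeff q (i - 1)) *s (?G ^^ i) v) - (\<Sum>i\<le>Suc ?n. (z * coeff q i) *s (?G ^^ i) v)"
    by (simp only: poly_op_bound c vec.scale_left_diff_distrib sum_subtractf)
  also have "(\<Sum>i\<le>Suc ?n. (if i = 0 then 0 else coeff q (i - 1)) *s (?G ^^ i) v) = (\<Sum>i\<le>?n. coeff q i *s (?G ^^ Suc i) v)"
    by (subst sum.atMost_Suc_shift) simp
  also have "(\<Sum>i\<le>Suc ?n. (z * coeff q i) *s (?G ^^ i) v) = (\<Sum>i\<le>?n. coeff q i *s (z *s (?G ^^ i) v))"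
    by (simp add: coeff_eq_0 mult.commute)
  finally show ?thesis
    by (simp only: poly_op_def lin vec.scale_right_diff_distrib sum_subtractf)
qed

text \<open>The polynomial splits over the complex numbers. A factor g - z with z not an eigenvalue
  is injective and commutes with the others, so it can be cancelled.\<close>

lemma annihilating_list_of_poly:
  assumes "p \<noteq> 0" "poly_op g p v = 0"
  shows "\<exists>zs. (\<forall>z\<in>set zs. eigenvalue_c g z) \<and> ops g zs v = 0"
  using assms
proof (induction "degree p" arbitrary: p v)
  case 0
  then have "v = 0" by (auto simp: poly_op_def elim: degree_eq_zeroE)
  then show ?case by (intro exI[of _ "[]"]) simp
next
  case (Suc n)
  then obtain z where "poly p z = 0"
    using fundamental_theorem_of_algebra[of p] constant_degree[of p] by auto
  then obtain q where q: "p = [:-z, 1:] * q" by (auto simp: poly_eq_0_iff_dvd elim: dvdE)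
  have "q \<noteq> 0" using Suc.prems(1) q by auto
  have "degree p = Suc (degree q)"
    unfolding q using \<open>q \<noteq> 0\<close> by (subst degree_mult_eq) auto
  then have "n = degree q" using Suc.hyps(2) by simp
  moreover have "poly_op g q (op_minus g z v) = 0"
    using Suc.prems(2) unfolding q poly_op_linear_factor .
  ultimately obtain zs where zs: "\<forall>z\<in>set zs. eigenvalue_c g z" "ops g zs (op_minus g z v) = 0"
    using Suc.hyps(1) \<open>q \<noteq> 0\<close> by blast
  show ?case
  proof (cases "eigenvalue_c g z")
    case True
    with zs show ?thesis by (intro exI[of _ "z # zs"]) auto
  next
    case False
    with zs(2) have "ops g zs v = 0" by (auto simp: ops_commute eigenvalue_c_def)
    with zs(1) show ?thesis by blast
  qed
qed

text \<open>The vectors v, g v, ..., g^n v, with n the dimension, are dependent, which yields a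
  polynomial that kills \<open>v\<close>. It may depend on \<open>v\<close>: powers are only studied
  on one vector at a time.\<close>

lemma annihilating_list_exists:
  fixes g :: "real^'n^'n"
  shows "\<exists>zs. (\<forall>z\<in>set zs. eigenvalue_c g z) \<and> ops g zs v = 0"
proof -
  define f where "f i = (((*v) (complexify g)) ^^ i) v" for i
  have "\<exists>p. p \<noteq> 0 \<and> poly_op g p v = 0"
  \<comment> \<open>Dependence is a property of the set of iterates, so a repetition is treated
    apart; it gives X^i - X^j.\<close>
  proof (cases "inj_on f {..CARD('n)}")
    case False
    then obtain i j where ij: "i < j" "f i = f j"
      by (auto simp: inj_on_def) (metis linorder_neqE_nat)
    let ?p = "monom 1 i - monom (1::complex) j"
    have "poly_op g ?p v = (\<Sum>k\<le>j. (coeff (monom 1 i) k) *s f k) - (\<Sum>k\<le>j. coeff (monom (1::complex) j) k *s f k)"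
      using ij by (subst poly_op_bound[of _ j])
        (auto simp: f_def sum_subtractf vec.scale_left_diff_distrib degree_monom_eq intro!: degree_diff_le)
    also have "\<dots> = f i - f j"
      using ij by (simp add: if_distrib[of "\<lambda>x. x *s _"] cong: if_cong)
    finally have "poly_op g ?p v = 0" using ij by simp
    moreover have "coeff ?p i \<noteq> 0" using ij by simp
    then have "?p \<noteq> 0" by (metis coeff_0)
    ultimately show ?thesis by blast
  next
    case True
    let ?F = "f ` {..CARD('n)}"
    have "card ?F > vec.dim ?F"
      using True vec.dim_subset_UNIV[of ?F]
      by (simp add: card_image vec.dimension_def card_cart_basis less_Suc_eq_le)
    then have "vec.dependent ?F"
      using vec.dim_eq_card_independent[of ?F] by auto
    then obtain a where a: "(\<Sum>x\<in>?F. a x *s x) = 0" "\<exists>x\<in>?F. a x \<noteq> 0"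
      by (auto simp: vec.dependent_finite)
    let ?p = "\<Sum>i\<le>CARD('n). monom (a (f i)) i"
    have c: "coeff ?p k = (if k \<le> CARD('n) then a (f k) else 0)" for k
      by (simp add: coeff_sum)
    then have "degree ?p \<le> CARD('n)" by (intro degree_le) auto
    then have "poly_op g ?p v = (\<Sum>i\<le>CARD('n). a (f i) *s f i)"
      by (subst poly_op_bound[of _ "CARD('n)"]) (auto simp only: c f_def[symmetric] atMost_iff if_True intro!: sum.cong)
    also have "\<dots> = 0" using a(1) True by (simp add: sum.reindex)
    finally have "poly_op g ?p v = 0" .
    moreover have "?p \<noteq> 0" using a(2) c by (metis (no_types, lifting) atMost_iff coeff_0 imageE)
    ultimately show ?thesis by blast
  qed
  then show ?thesis using annihilating_list_of_poly by blast
qed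

lemma contraction_tendsto_0:
  fixes x y :: "nat \<Rightarrow> 'a::real_normed_vector"
  assumes q: "0 \<le> q" "q < 1" and le: "\<And>n. norm (x (Suc n)) \<le> q * norm (x n) + norm (y n)"
    and y: "y \<longlonglongrightarrow> 0"
  shows "x \<longlonglongrightarrow> 0"
proof (rule LIMSEQ_I)
  fix e :: real assume e: "0 < e"
  then have "0 < (1 - q) * (e / 2)" using q by simp
  from LIMSEQ_D[OF y this] obtain N where N: "\<And>n. N \<le> n \<Longrightarrow> norm (y n) < (1 - q) * (e / 2)" by auto
  have step: "norm (x (N + k)) \<le> q ^ k * norm (x N) + e / 2" for k
  proof (induction k)
    case 0 then show ?case using e by simp
  next
    case (Suc k)
    have "norm (x (N + Suc k)) \<le> q * norm (x (N + k)) + (1 - q) * (e / 2)"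
      using le[of "N + k"] N[of "N + k"] by simp
    also have "\<dots> \<le> q * (q ^ k * norm (x N) + e / 2) + (1 - q) * (e / 2)"
      using Suc q by (intro add_right_mono mult_left_mono) auto
    also have "\<dots> = q ^ Suc k * norm (x N) + e / 2"
      by (simp add: field_simps)
    finally show ?case .
  qed
  have "(\<lambda>k. q ^ k * norm (x N)) \<longlonglongrightarrow> 0 * norm (x N)"
    using q by (intro tendsto_mult LIMSEQ_realpow_zero tendsto_const) auto
  then obtain K where K: "\<And>k. K \<le> k \<Longrightarrow> norm (q ^ k * norm (x N)) < e / 2"
    using e LIMSEQ_D[of _ "0::real" "e/2"] by fastforce
  show "\<exists>no. \<forall>n\<ge>no. norm (x n - 0) < e"
  proof (intro exI[of _ "N + K"] allI impI)
    fix n assume "N + K \<le> n"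
    then obtain k where "n = N + k" "K \<le> k" by (metis add.assoc le_Suc_ex le_add1)
    then show "norm (x n - 0) < e" using step[of k] K[of k] by simp
  qed
qed

lemma norm_smult_complex: "norm (c *s (v :: complex^'n)) = cmod c * norm v"
  by (simp add: norm_vec_def norm_mult L2_set_right_distrib)

text \<open>Induction on the factors: the rescaled iterates satisfy x(n+1) = (z / \<rho>) x(n) +
  y(n), where y(n) is, up to a constant, the rescaled iterate of (g - z) v and tends to 0 by
  induction.\<close>

lemma power_decay:
  fixes g :: "real^'n^'n"
  assumes "\<And>z. z \<in> set zs \<Longrightarrow> cmod z < \<rho>" "0 < \<rho>" "ops g zs v = 0"
  shows "(\<lambda>n. (1 / complex_of_real \<rho>) ^ n *s (((*v) (complexify g)) ^^ n) v) \<longlonglongrightarrow> 0"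
  using assms
proof (induction zs arbitrary: v)
  case Nil
  have "(((*v) (complexify g)) ^^ n) 0 = 0" for n
    by (induction n) auto
  then show ?case using Nil by simp
next
  case (Cons z zs)
  let ?G = "((*v) (complexify g))"
  let ?r = "complex_of_real \<rho>"
  have lin: "(?G ^^ Suc i) v = z *s (?G ^^ i) v + (?G ^^ i) (op_minus g z v)" for i
    by (induction i) (simp_all add: op_minus_def matrix_vector_right_distrib vector_scalar_commute)
  let ?x = "\<lambda>n. (1 / ?r) ^ n *s (?G ^^ n) v"
  let ?y = "\<lambda>n. (1 / ?r) *s ((1 / ?r) ^ n *s (?G ^^ n) (op_minus g z v))"
  have r: "?r \<noteq> 0" using Cons.prems by auto
  show ?case
  proof (rule contraction_tendsto_0[where q = "cmod z / \<rho>" and y = ?y])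
    show "cmod z / \<rho> < 1" "0 \<le> cmod z / \<rho>" using Cons.prems by auto
    show "?y \<longlonglongrightarrow> 0"
    proof -
      have "(\<lambda>n. (1 / ?r) ^ n *s (?G ^^ n) (op_minus g z v)) \<longlonglongrightarrow> 0"
        using Cons by auto
      then have "(\<lambda>n. norm ((1 / ?r) ^ n *s (?G ^^ n) (op_minus g z v))) \<longlonglongrightarrow> 0"
        by (rule tendsto_norm_zero)
      then have "(\<lambda>n. cmod (1 / ?r) * norm ((1 / ?r) ^ n *s (?G ^^ n) (op_minus g z v))) \<longlonglongrightarrow> cmod (1 / ?r) * 0"
        by (intro tendsto_mult tendsto_const)
      then show ?thesis
        by (subst tendsto_norm_zero_iff[symmetric]) (simp only: norm_smult_complex mult_zero_right)
    qed
    fix n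
    have "?x (Suc n) = ((1 / ?r) ^ Suc n * z) *s (?G ^^ n) v + (1 / ?r) ^ Suc n *s (?G ^^ n) (op_minus g z v)"
      by (simp only: lin vec.scale_right_distrib vec.scale_scale)
    also have "(1 / ?r) ^ Suc n * z = (z / ?r) * (1 / ?r) ^ n" by simp
    finally have "?x (Suc n) = (z / ?r) *s ?x n + ?y n"
      by (simp only: vec.scale_scale power_Suc)
    then have "norm (?x (Suc n)) \<le> norm ((z / ?r) *s ?x n) + norm (?y n)"
      by (metis norm_triangle_ineq)
    also have "norm ((z / ?r) *s ?x n) = cmod z / \<rho> * norm (?x n)"
      using Cons.prems(2) by (simp only: norm_smult_complex norm_divide norm_of_real abs_of_pos)
    finally show "norm (?x (Suc n)) \<le> cmod z / \<rho> * norm (?x n) + norm (?y n)" .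
  qed
qed

text \<open>Consecutive rescaled iterates differ by rescaled iterates of (g - l) v, which only see
  eigenvalues of smaller modulus; so the differences are summable. The limit inherits g y = l y from
  the recursion.\<close>

lemma powers_converge_of_annihilated:
  fixes g :: "real^'n^'n"
  assumes l: "l \<noteq> 0" and zs: "\<And>z. z \<in> set zs \<Longrightarrow> cmod z < cmod l" and 0: "ops g zs (op_minus g l v) = 0"
  shows "\<exists>y. op_minus g l y = 0 \<and> (\<lambda>n. (1 / l) ^ n *s (((*v) (complexify g)) ^^ n) v) \<longlonglongrightarrow> y"
proof -
  let ?G = "((*v) (complexify g))"
  define w where "w = op_minus g l v"
  define x where "x n = (1 / l) ^ n *s (?G ^^ n) v" for n
  define d where "d = Max (insert 0 (cmod ` set zs))"
  have d: "0 \<le> d" "d < cmod l" "\<And>z. z \<in> set zs \<Longrightarrow> cmod z \<le> d"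
    using l zs by (auto simp: d_def)
  \<comment> \<open>A rate strictly between the remaining moduli and \<open>cmod l\<close>:
    boundedness at rate \<rho> becomes geometric decay with ratio \<rho> / |l|. The 0 inserted into
    \<open>d\<close> covers the empty list.\<close>
  define \<rho> where "\<rho> = (d + cmod l) / 2"
  have \<rho>: "0 < \<rho>" "\<rho> < cmod l" "\<And>z. z \<in> set zs \<Longrightarrow> cmod z < \<rho>"
    using d l by (auto simp: \<rho>_def) (smt (verit) d(3) field_sum_of_halves)
  have "Bseq (\<lambda>n. (1 / complex_of_real \<rho>) ^ n *s (?G ^^ n) w)"
    using power_decay[of zs \<rho> g w] \<rho> 0 by (intro convergent_imp_Bseq) (auto simp: w_def convergent_def)
  then obtain K where K: "\<And>n. norm ((1 / complex_of_real \<rho>) ^ n *s (?G ^^ n) w) \<le> K"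
    by (auto simp: Bseq_def)
  have lin: "(?G ^^ Suc i) v = l *s (?G ^^ i) v + (?G ^^ i) w" for i
    by (induction i) (simp_all add: w_def op_minus_def matrix_vector_right_distrib vector_scalar_commute)
  have diff: "x (Suc n) - x n = (1 / l) *s ((1 / l) ^ n *s (?G ^^ n) w)" for n
  proof -
    have "x (Suc n) = ((1 / l) ^ Suc n * l) *s (?G ^^ n) v + (1 / l) ^ Suc n *s (?G ^^ n) w"
      by (simp only: x_def lin vec.scale_right_distrib vec.scale_scale)
    also have "(1 / l) ^ Suc n * l = (1 / l) ^ n" using l by simp
    finally show ?thesis by (simp add: x_def)
  qed
  have "summable (\<lambda>n. x (Suc n) - x n)"
  proof (rule summable_comparison_test')
    show "summable (\<lambda>n. (1 / cmod l * K) * (\<rho> / cmod l) ^ n)"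
      using \<rho>(1,2) by (intro summable_mult summable_geometric) (simp add: divide_less_eq)
    fix n
    have "(1 / l) ^ n *s (?G ^^ n) w = (\<rho> / l) ^ n *s ((1 / complex_of_real \<rho>) ^ n *s (?G ^^ n) w)"
      using \<rho>(1) by (simp add: power_divide)
    then have "norm (x (Suc n) - x n) = 1 / cmod l * ((\<rho> / cmod l) ^ n * norm ((1 / complex_of_real \<rho>) ^ n *s (?G ^^ n) w))"
      unfolding diff using \<rho>(1)
      by (simp only: norm_smult_complex norm_power norm_divide norm_of_real norm_one abs_of_pos)
    also have "\<dots> \<le> 1 / cmod l * ((\<rho> / cmod l) ^ n * K)"
      using K[of n] \<rho> by (intro mult_left_mono) auto
    finally show "norm (x (Suc n) - x n) \<le> (1 / cmod l * K) * (\<rho> / cmod l) ^ n"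
      by (simp add: mult_ac)
  qed
  then have "(\<lambda>n. \<Sum>k<n. x (Suc k) - x k) \<longlonglongrightarrow> (\<Sum>n. x (Suc n) - x n)"
    by (rule summable_LIMSEQ)
  then have "(\<lambda>n. x n - x 0) \<longlonglongrightarrow> (\<Sum>n. x (Suc n) - x n)"
    by (simp only: sum_lessThan_telescope)
  from tendsto_add[OF this tendsto_const[of "x 0"]] obtain y where y: "x \<longlonglongrightarrow> y" by auto
  have "bounded_linear ?G"
    by (simp add: linear_conv_bounded_linear[symmetric])
  then have 1: "(\<lambda>n. ?G (x n)) \<longlonglongrightarrow> ?G y" using y by (rule bounded_linear.tendsto)
  have bl: "bounded_linear (\<lambda>u :: complex^'n. l *s u)"
    unfolding linear_conv_bounded_linear[symmetric]
    by (rule linearI) (simp_all add: vec_eq_iff algebra_simps)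
  have "(\<lambda>n. l *s x (Suc n)) \<longlonglongrightarrow> l *s y"
    using LIMSEQ_Suc[OF y] by (rule bounded_linear.tendsto[OF bl])
  moreover have "l *s x (Suc n) = ?G (x n)" for n
    using l by (simp add: x_def vector_scalar_commute)
  ultimately have "?G y = l *s y" using 1 LIMSEQ_unique by auto
  then show ?thesis using y by (intro exI[of _ y]) (simp add: op_minus_def x_def[abs_def])
qed

text \<open>The limit \<open>B\<close> is the spectral projection onto the dominant eigenline, which
  is real because the dominant eigenvalue is.\<close>

lemma proximal_powers_tendsto:
  fixes g :: "real^'n^'n"
  assumes "proximal g" "invertible g"
  obtains l b B where "l \<noteq> 0" "b \<noteq> 0" "B *v b = b" "\<And>v. \<exists>c. B *v v = c *\<^sub>R b"
    "(\<lambda>n. (1 / l) ^ n *\<^sub>R (((**) g) ^^ n) (mat 1)) \<longlonglongrightarrow> B"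
proof -
  from \<open>proximal g\<close> obtain l where ord: "order l (charpoly_c g) = 1"
    and dom0: "\<And>z. poly (charpoly_c g) z = 0 \<Longrightarrow> z \<noteq> l \<Longrightarrow> cmod z < cmod l"
    by (auto simp: proximal_def)
  \<comment> \<open>Were the polynomial zero, every complex number would be a root, including one of
    larger modulus than \<open>l\<close>.\<close>
  have nz: "charpoly_c g \<noteq> 0"
  proof
    assume "charpoly_c g = 0"
    then have "cmod (of_real (cmod l + 1)) < cmod l"
      by (intro dom0) (auto dest: arg_cong[of _ _ cmod])
    then show False unfolding norm_of_real by simp
  qed
  have simple: "\<not> [:-l, 1:]^2 dvd charpoly_c g"
    using order_2[OF nz, of l] ord by (simp add: numeral_2_eq_2)
  have eig: "eigenvalue_c g l"
    using ord nz by (simp add: eigenvalue_c_def charpoly_root_iff[symmetric] order_root)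
  have dom: "cmod z < cmod l" if "eigenvalue_c g z" "z \<noteq> l" for z
    using that dom0 by (simp add: eigenvalue_c_def charpoly_root_iff[symmetric])
  have line: "\<exists>a. w = a *s u" if "op_minus g l u = 0" "op_minus g l w = 0" "u \<noteq> 0" for u w
    using charpoly_double_root[of u w g l 0] that simple by auto
  have no_jordan: "op_minus g l w = 0" if "op_minus g l (op_minus g l w) = 0" for w
  proof (rule ccontr)
    assume n: "op_minus g l w \<noteq> 0"
    then have "w \<noteq> a *s op_minus g l w" for a
      using that op_minus_smult[of g l a "op_minus g l w"] by force
    with charpoly_double_root[of "op_minus g l w" w g l 1] n that simple show False by auto
  qed
  obtain u where u: "u \<noteq> 0" "op_minus g l u = 0" using eig by (auto simp: eigenvalue_c_def)
  \<comment> \<open>The matrix is real, so the conjugate of \<open>l\<close> is an eigenvalue of the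
    same modulus, and strict domination identifies the two.\<close>
  have "cnj l = l"
  proof (rule ccontr)
    assume ne: "cnj l \<noteq> l"
    let ?u = "(\<chi> i. cnj (u $ i)) :: complex^'n"
    have "op_minus g (cnj l) ?u $ i = cnj (op_minus g l u $ i)" for i
      by (simp add: op_minus_def complexify_def matrix_vector_mult_def)
    then have "op_minus g (cnj l) ?u = 0" using u by (simp add: vec_eq_iff)
    moreover have "?u \<noteq> 0" using u(1) by (auto simp: vec_eq_iff)
    ultimately have "eigenvalue_c g (cnj l)" by (auto simp: eigenvalue_c_def)
    from dom[OF this ne] show False by simp
  qed
  then obtain r where r: "l = complex_of_real r" by (metis Reals_cases Reals_cnj_iff)
  define cv :: "real^'n \<Rightarrow> complex^'n" where "cv v = (\<chi> i. complex_of_real (v $ i))" for v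
  have cvG: "complexify g *v cv v = cv (g *v v)" for v
    by (simp add: vec_eq_iff cv_def complexify_def matrix_vector_mult_def)
  have "\<exists>b. b \<noteq> 0 \<and> g *v b = r *\<^sub>R b"
  proof -
    let ?re = "(\<chi> i. Re (u $ i)) :: real^'n" and ?im = "(\<chi> i. Im (u $ i)) :: real^'n"
    have "(g *v ?re) $ i - r * ?re $ i = Re (op_minus g l u $ i)"
      "(g *v ?im) $ i - r * ?im $ i = Im (op_minus g l u $ i)" for i
      by (simp_all add: op_minus_def complexify_def matrix_vector_mult_def r)
    then have "g *v ?re = r *\<^sub>R ?re" "g *v ?im = r *\<^sub>R ?im"
      using u by (auto simp: vec_eq_iff)
    moreover have "?re \<noteq> 0 \<or> ?im \<noteq> 0"
      using u(1) by (auto simp: vec_eq_iff complex_eq_iff)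
    ultimately show ?thesis by blast
  qed
  then obtain b where b: "b \<noteq> 0" "g *v b = r *\<^sub>R b" by blast
  have "r \<noteq> 0"
    using b \<open>invertible g\<close> by (auto simp: invertible_left_inverse matrix_left_invertible_ker)
  then have l0: "l \<noteq> 0" using r by simp
  have cb: "op_minus g l (cv b) = 0" "cv b \<noteq> 0"
    using b by (auto simp: op_minus_def cvG) (auto simp: cv_def vec_eq_iff r)
  \<comment> \<open>As g - l and its square have the same kernel, all factors g - l of an
    annihilating list merge into a single one; the others belong to eigenvalues of smaller
    modulus.\<close>
  have reduce: "op_minus g l (ops g (filter (\<lambda>z. z \<noteq> l) zs) v) = 0" if "ops g zs v = 0" for zs v
    using that
  proof (induction zs arbitrary: v)
    case (Cons z zs)
    then have "op_minus g l (ops g (filter (\<lambda>z. z \<noteq> l) zs) (op_minus g z v)) = 0" by simp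
    then show ?case using no_jordan by (auto simp: ops_commute)
  qed simp
  define M where "M n = (1 / r) ^ n *\<^sub>R (((**) g) ^^ n) (mat 1)" for n
  have pow: "(((**) g) ^^ n) (mat 1) *v v = (((*v) g) ^^ n) v" for n v
    by (induction n) (simp_all add: matrix_vector_mul_assoc[symmetric])
  have Mv: "M n *v v = (1 / r) ^ n *\<^sub>R (((*v) g) ^^ n) v" for n v
    by (simp add: M_def scaleR_matrix_vector_assoc[symmetric] pow)
  have conv: "\<exists>c. (\<lambda>n. M n *v v) \<longlonglongrightarrow> c *\<^sub>R b" for v
  proof -
    obtain zs where zs: "\<forall>z\<in>set zs. eigenvalue_c g z" "ops g zs (cv v) = 0"
      using annihilating_list_exists by blast
    from reduce[OF zs(2)] have "ops g (filter (\<lambda>z. z \<noteq> l) zs) (op_minus g l (cv v)) = 0"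
      by (simp add: ops_commute)
    from powers_converge_of_annihilated[OF l0 _ this] zs(1) dom obtain y where
      y: "op_minus g l y = 0" "(\<lambda>n. (1 / l) ^ n *s (((*v) (complexify g)) ^^ n) (cv v)) \<longlonglongrightarrow> y"
      by auto
    from line[OF cb(1) y(1) cb(2)] obtain a where a: "y = a *s cv b" by blast
    have Gn: "(((*v) (complexify g)) ^^ n) (cv v) = cv ((((*v) g) ^^ n) v)" for n
      by (induction n) (simp_all add: cvG)
    have "(\<lambda>n. (M n *v v) $ i) \<longlonglongrightarrow> (Re a *\<^sub>R b) $ i" for i
    proof -
      have "(\<lambda>n. Re (((1 / l) ^ n *s (((*v) (complexify g)) ^^ n) (cv v)) $ i)) \<longlonglongrightarrow> Re (y $ i)"
        by (intro tendsto_Re tendsto_vec_nth y)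
      moreover have "Re (((1 / l) ^ n *s (((*v) (complexify g)) ^^ n) (cv v)) $ i) = (M n *v v) $ i" for n
      proof -
        have "(1 / l) ^ n = complex_of_real ((1 / r) ^ n)" by (simp add: r)
        then show ?thesis unfolding Gn Mv by (simp add: cv_def del: of_real_power of_real_divide)
      qed
      moreover have "Re (y $ i) = (Re a *\<^sub>R b) $ i" by (simp add: a cv_def)
      ultimately show ?thesis by simp
    qed
    then show ?thesis by (blast intro: vec_tendstoI)
  qed
  define B where "B = (\<chi> i j. lim (\<lambda>n. M n $ i $ j))"
  have "M \<longlonglongrightarrow> B"
  proof (intro vec_tendstoI)
    fix i j
    obtain c where "(\<lambda>n. M n *v axis j 1) \<longlonglongrightarrow> c *\<^sub>R b" using conv by blast
    then have "(\<lambda>n. (M n *v axis j 1) $ i) \<longlonglongrightarrow> (c *\<^sub>R b) $ i" by (rule tendsto_vec_nth)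
    then have "convergent (\<lambda>n. M n $ i $ j)"
      by (auto simp: matrix_vector_mult_basis column_def convergent_def)
    then show "(\<lambda>n. M n $ i $ j) \<longlonglongrightarrow> B $ i $ j"
      by (simp add: B_def convergent_LIMSEQ_iff)
  qed
  then have MB: "(\<lambda>n. M n *v v) \<longlonglongrightarrow> B *v v" for v
    unfolding matrix_vector_mult_def
    by (intro vec_tendstoI) (simp, intro tendsto_sum tendsto_mult tendsto_vec_nth tendsto_const)
  have "B *v b = b"
  proof -
    have "(((*v) g) ^^ n) b = r ^ n *\<^sub>R b" for n
      by (induction n) (simp_all add: matrix_vector_mult_scaleR b(2) mult.commute)
    then have "M n *v b = b" for n using \<open>r \<noteq> 0\<close> by (simp add: Mv power_divide)
    with MB[of b] show ?thesis by (simp add: LIMSEQ_const_iff)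
  qed
  moreover have "\<exists>c. B *v v = c *\<^sub>R b" for v
    using conv[of v] MB[of v] LIMSEQ_unique by blast
  ultimately show ?thesis
    using that[of r b B] \<open>r \<noteq> 0\<close> b(1) \<open>M \<longlonglongrightarrow> B\<close> by (auto simp: M_def[abs_def])
qed

section \<open>Projective space and its unit sections\<close>

lemma norm_matrix_vector_le: "norm (g *v v) \<le> norm g * norm (v :: real^'n)" for g :: "real^'n^'m"
proof -
  have "norm (g *v v) = L2_set (\<lambda>i. norm (g $ i \<bullet> v)) UNIV"
    by (simp add: norm_vec_def matrix_vector_mul_component)
  also have "\<dots> \<le> L2_set (\<lambda>i. norm (g $ i) * norm v) UNIV"
    by (intro L2_set_mono) (auto simp: Cauchy_Schwarz_ineq2)
  also have "\<dots> = norm g * norm v"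
    by (simp add: norm_vec_def[of g] L2_set_left_distrib)
  finally show ?thesis .
qed

lemma continuous_on_matrix_vector [continuous_intros]:
  fixes f :: "'a::topological_space \<Rightarrow> real^'n^'m"
  assumes "continuous_on S f" "continuous_on S g"
  shows "continuous_on S (\<lambda>x. f x *v g x)"
  unfolding matrix_vector_mult_def using assms by (intro continuous_intros) auto

lemma continuous_on_matrix_matrix [continuous_intros]:
  fixes f :: "'a::topological_space \<Rightarrow> real^'n^'m" and g :: "'a \<Rightarrow> real^'k^'n"
  assumes "continuous_on S f" "continuous_on S g"
  shows "continuous_on S (\<lambda>x. f x ** g x)"
  unfolding matrix_matrix_mult_def using assms by (intro continuous_intros) auto

lemma tendsto_matrix_vector [tendsto_intros]:
  fixes f :: "'a \<Rightarrow> real^'n^'m"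
  assumes "(f \<longlongrightarrow> a) F" "(g \<longlongrightarrow> b) F"
  shows "((\<lambda>x. f x *v g x) \<longlongrightarrow> a *v b) F"
  using continuous_on_tendsto_compose[OF continuous_on_matrix_vector[OF continuous_on_fst[OF continuous_on_id] continuous_on_snd[OF continuous_on_id], of UNIV] tendsto_Pair[OF assms]]
  by simp

lemma tendsto_matrix_matrix [tendsto_intros]:
  fixes f :: "'a \<Rightarrow> real^'n^'m" and g :: "'a \<Rightarrow> real^'k^'n"
  assumes "(f \<longlongrightarrow> a) F" "(g \<longlongrightarrow> b) F"
  shows "((\<lambda>x. f x ** g x) \<longlongrightarrow> a ** b) F"
  using continuous_on_tendsto_compose[OF continuous_on_matrix_matrix[OF continuous_on_fst[OF continuous_on_id] continuous_on_snd[OF continuous_on_id], of UNIV] tendsto_Pair[OF assms]]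
  by simp

lemma borel_measurable_matrix_vector [measurable (raw)]:
  fixes f :: "'a \<Rightarrow> real^'n^'m"
  assumes "f \<in> borel_measurable M" "g \<in> borel_measurable M"
  shows "(\<lambda>x. f x *v g x) \<in> borel_measurable M"
  by (rule borel_measurable_continuous_Pair[OF assms]) (intro continuous_intros)

lemma borel_measurable_matrix_matrix [measurable (raw)]:
  fixes f :: "'a \<Rightarrow> real^'n^'m" and g :: "'a \<Rightarrow> real^'k^'n"
  assumes "f \<in> borel_measurable M" "g \<in> borel_measurable M"
  shows "(\<lambda>x. f x ** g x) \<in> borel_measurable M"
  by (rule borel_measurable_continuous_Pair[OF assms]) (intro continuous_intros)

lemma borel_measurable_vec_component [measurable (raw)]:
  fixes f :: "'a \<Rightarrow> 'b::real_normed_vector^'n"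
  assumes "f \<in> borel_measurable M"
  shows "(\<lambda>x. f x $ i) \<in> borel_measurable M"
  by (rule measurable_compose[OF assms borel_measurable_continuous_onI]) (intro continuous_intros)

text \<open>For \<open>v \<noteq> 0\<close> the orthogonal projection onto the line of
  \<open>v\<close>, of Hilbert-Schmidt norm one. It embeds projective space into a Euclidean space,
  where means make sense. Division by zero gives \<open>outer 0 = 0\<close>.\<close>

definition outer :: "real^'n \<Rightarrow> real^'n^'n" where
  "outer v = (\<chi> i j. v $ i * v $ j / (norm v)\<^sup>2)"

lemma outer_0 [simp]: "outer 0 = 0"
  by (simp add: outer_def vec_eq_iff)

lemma outer_row: "outer v $ i = (v $ i / (norm v)\<^sup>2) *\<^sub>R v"
  by (simp add: outer_def vec_eq_iff)

lemma outer_scale [simp]: "c \<noteq> 0 \<Longrightarrow> outer (c *\<^sub>R v) = outer v"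
  by (auto simp: outer_def vec_eq_iff power_mult_distrib power2_eq_square[of c] mult.assoc mult.left_commute)

lemma norm_outer: "v \<noteq> 0 \<Longrightarrow> norm (outer v) = 1"
proof -
  assume v: "v \<noteq> 0"
  have "norm (outer v) = L2_set (\<lambda>i. \<bar>v $ i\<bar> * (1 / norm v)) UNIV"
    using v by (simp add: norm_vec_def[of "outer v"] outer_row power2_eq_square)
  also have "\<dots> = L2_set (\<lambda>i. norm (v $ i)) UNIV * (1 / norm v)"
    by (subst L2_set_left_distrib) auto
  also have "L2_set (\<lambda>i. norm (v $ i)) UNIV = norm v" by (simp only: norm_vec_def)
  also have "norm v * (1 / norm v) = 1" using v by simp
  finally show ?thesis .
qed

lemma norm_outer_le: "norm (outer v) \<le> 1"
  by (cases "v = 0") (auto simp: norm_outer)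

lemma continuous_on_outer: "continuous_on (- {0}) outer"
  unfolding outer_def by (intro continuous_intros) auto

lemma borel_measurable_outer [measurable]: "outer \<in> borel_measurable borel"
  by (rule borel_measurable_continuous_countable_exceptions[of "{0}"]) (auto intro: continuous_on_outer)

text \<open>The index type carries no order; any injective numbering lets one speak of a first
  nonzero row.\<close>

definition vec_index :: "'n::finite \<Rightarrow> nat" where
  "vec_index = (SOME f. inj f)"

lemma inj_vec_index: "inj (vec_index :: 'a::finite \<Rightarrow> nat)"
  unfolding vec_index_def
proof (rule someI_ex[of inj])
  obtain f :: "'a \<Rightarrow> nat" and n where "f ` UNIV = {i. i < n}" "inj f"
    using finite_imp_inj_to_nat_seg[OF finite[of "UNIV :: 'a set"]] by (elim exE conjE)
  then show "\<exists>f :: 'a \<Rightarrow> nat. inj f" by (intro exI)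
qed

text \<open>At most one summand is nonzero, namely the first nonzero row. For \<open>outer v\<close>
  it is a nonzero multiple of \<open>v\<close>, as is every nonzero row.\<close>

definition first_row :: "real^'n^'n \<Rightarrow> real^'n" where
  "first_row M = (\<Sum>i\<in>UNIV. if M $ i \<noteq> 0 \<and> (\<forall>j. vec_index j < vec_index i \<longrightarrow> M $ j = 0) then M $ i else 0)"

text \<open>A Borel choice of a unit vector on a line, read off from the projection onto the line; the
  selector \<^const>\<open>rep\<close> itself need not be measurable.\<close>
definition unit_section :: "real^'n^'n \<Rightarrow> real^'n" where
  "unit_section M = (1 / norm (first_row M)) *\<^sub>R first_row M"

lemma borel_measurable_unit_section [measurable]: "(unit_section :: real^'n^'n \<Rightarrow> _) \<in> borel_measurable borel"
proof -
  have [measurable]: "Measurable.pred borel (\<lambda>M :: real^'n^'n. \<forall>j. vec_index j < vec_index i \<longrightarrow> M $ j = 0)" for i :: 'n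
    unfolding pred_def space_borel
    by (intro borel_closed) (simp, intro closed_Collect_all closed_Collect_imp open_Collect_const closed_Collect_eq continuous_intros)
  have [measurable]: "first_row \<in> borel_measurable (borel :: (real^'n^'n) measure)"
    unfolding first_row_def
    by (intro borel_measurable_sum measurable_If borel_measurable_const pred_intros_logic) measurable
  show ?thesis unfolding unit_section_def by measurable
qed

lemma first_row_outer: "v \<noteq> 0 \<Longrightarrow> \<exists>c. c \<noteq> 0 \<and> first_row (outer v) = c *\<^sub>R v"
proof -
  assume v: "v \<noteq> 0"
  have nz: "outer v $ i = 0 \<longleftrightarrow> v $ i = 0" for i
    using v by (simp add: outer_row)
  have "\<exists>i. v $ i \<noteq> 0" using v by (simp add: vec_eq_iff)
  then obtain k where k: "v $ k \<noteq> 0" "\<And>j. v $ j \<noteq> 0 \<Longrightarrow> vec_index k \<le> vec_index j"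
    using arg_min_nat_lemma[of "\<lambda>i. v $ i \<noteq> 0" _ vec_index] by (metis (no_types))
  have *: "v $ i \<noteq> 0 \<and> (\<forall>j. vec_index j < vec_index i \<longrightarrow> v $ j = 0) \<longleftrightarrow> i = k" for i
    using k inj_vec_index by (metis injD leD linorder_neqE_nat)
  have "first_row (outer v) = (\<Sum>i\<in>UNIV. if i = k then outer v $ i else 0)"
    unfolding first_row_def nz * ..
  then have "first_row (outer v) = (v $ k / (norm v)\<^sup>2) *\<^sub>R v"
    by (simp add: outer_row)
  then show ?thesis using k v by (intro exI[of _ "v $ k / (norm v)\<^sup>2"]) simp
qed

lemma unit_section_outer:
  assumes "v \<noteq> 0"
  shows "\<exists>c. c \<noteq> 0 \<and> unit_section (outer v) = c *\<^sub>R v" "norm (unit_section (outer v)) = 1"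
proof -
  from first_row_outer[OF assms] obtain c where c: "c \<noteq> 0" "first_row (outer v) = c *\<^sub>R v" by blast
  show "\<exists>c. c \<noteq> 0 \<and> unit_section (outer v) = c *\<^sub>R v"
    using c assms by (intro exI[of _ "c / norm (c *\<^sub>R v)"]) (simp add: unit_section_def)
  show "norm (unit_section (outer v)) = 1"
    using c assms by (simp add: unit_section_def)
qed

lemma rep_pline:
  assumes "v \<noteq> 0"
  shows "\<exists>c. c \<noteq> 0 \<and> rep (pline v) = c *\<^sub>R v"
proof -
  have "v \<in> pline v" unfolding pline_def by (auto intro: exI[of _ 1])
  then have "rep (pline v) \<in> pline v \<and> rep (pline v) \<noteq> 0"
    unfolding rep_def using assms by (intro someI[of "\<lambda>w. w \<in> pline v \<and> w \<noteq> 0" v]) auto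
  then show ?thesis by (auto simp: pline_def)
qed

lemma rep_Proj:
  assumes "x \<in> Proj"
  shows "rep x \<noteq> 0" "pline (rep x) = x"
proof -
  obtain v where v: "x = pline v" "v \<noteq> 0" using assms by (auto simp: Proj_def)
  then obtain c where c: "c \<noteq> 0" "rep x = c *\<^sub>R v" using rep_pline by blast
  then show "rep x \<noteq> 0" using v by simp
  have "pline (c *\<^sub>R v) = pline v"
  proof
    show "pline (c *\<^sub>R v) \<subseteq> pline v" by (auto simp: pline_def)
    show "pline v \<subseteq> pline (c *\<^sub>R v)"
    proof
      fix w assume "w \<in> pline v"
      then obtain a where "w = a *\<^sub>R v" by (auto simp: pline_def)
      then have "w = (a / c) *\<^sub>R (c *\<^sub>R v)" using c(1) by simp
      then show "w \<in> pline (c *\<^sub>R v)" unfolding pline_def by blast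
    qed
  qed
  then show "pline (rep x) = x" by (simp only: c(2) v(1)[symmetric])
qed

lemma outer_rep_pline: "v \<noteq> 0 \<Longrightarrow> outer (rep (pline v)) = outer v"
  using rep_pline[of v] by auto

lemma space_proj_borel: "space proj_borel = Proj"
  by (simp add: proj_borel_def space_measure_of_conv)

lemma sets_proj_borelI:
  assumes "A \<subseteq> Proj" "{v. v \<noteq> 0 \<and> pline v \<in> A} \<in> sets borel"
  shows "A \<in> sets proj_borel"
  unfolding proj_borel_def using assms by (subst sets_measure_of) auto

definition section_of :: "(real^'n) set \<Rightarrow> real^'n" where
  "section_of x = unit_section (outer (rep x))"

lemma section_of_pline: "v \<noteq> 0 \<Longrightarrow> section_of (pline v) = unit_section (outer v)"
  by (simp add: section_of_def outer_rep_pline)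

lemma section_of_rep:
  assumes "x \<in> Proj"
  shows "\<exists>c. \<bar>c\<bar> = 1 / norm (rep x) \<and> section_of x = c *\<^sub>R rep x" "norm (section_of x) = 1"
proof -
  note r = rep_Proj[OF assms]
  from unit_section_outer(1)[OF r(1)] obtain c where c: "section_of x = c *\<^sub>R rep x"
    by (auto simp: section_of_def)
  show n: "norm (section_of x) = 1" using unit_section_outer(2)[OF r(1)] by (simp add: section_of_def)
  show "\<exists>c. \<bar>c\<bar> = 1 / norm (rep x) \<and> section_of x = c *\<^sub>R rep x"
    using n r(1) by (intro exI[of _ c] conjI c) (simp add: c eq_divide_eq)
qed

lemma measurable_section_of [measurable]: "section_of \<in> borel_measurable proj_borel"
proof (rule measurableI)
  fix A :: "(real^'n) set" assume [measurable]: "A \<in> sets borel"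
  have "{v. v \<noteq> 0 \<and> pline v \<in> section_of -` A \<inter> Proj} = (- {0}) \<inter> (\<lambda>v. unit_section (outer v)) -` A"
  proof (rule set_eqI)
    fix v :: "real^'n"
    have "v \<noteq> 0 \<Longrightarrow> pline v \<in> Proj" by (auto simp: Proj_def)
    then show "v \<in> {v. v \<noteq> 0 \<and> pline v \<in> section_of -` A \<inter> Proj} \<longleftrightarrow> v \<in> (- {0}) \<inter> (\<lambda>v. unit_section (outer v)) -` A"
      using section_of_pline[of v] by (cases "v = 0") simp_all
  qed
  also have "\<dots> \<in> sets borel"
  proof (rule sets.Int)
    show "(\<lambda>v. unit_section (outer v)) -` A \<in> sets borel"
      using measurable_sets[OF measurable_compose[OF borel_measurable_outer borel_measurable_unit_section] \<open>A \<in> sets borel\<close>]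
      by (simp only: space_borel Int_UNIV_right)
    show "- {0 :: real^'n} \<in> sets borel" by (intro borel_open open_Compl closed_singleton)
  qed
  finally show "section_of -` A \<inter> space proj_borel \<in> sets proj_borel"
    unfolding space_proj_borel by (rule sets_proj_borelI[rotated]) (rule Int_lower2)
qed (simp only: space_borel UNIV_I)

lemma outer_section_of: "x \<in> Proj \<Longrightarrow> outer (section_of x) = outer (rep x)"
proof -
  assume x: "x \<in> Proj"
  obtain c where c: "\<bar>c\<bar> = 1 / norm (rep x)" "section_of x = c *\<^sub>R rep x"
    using section_of_rep(1)[OF x] by blast
  then have "c \<noteq> 0" using rep_Proj(1)[OF x] by auto
  then show ?thesis unfolding c(2) by (rule outer_scale)
qed

lemma invertible_mult_nonzero: "invertible g \<Longrightarrow> v \<noteq> 0 \<Longrightarrow> g *v v \<noteq> (0 :: real^'n)" for g :: "real^'n^'n"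
  by (auto simp: invertible_left_inverse matrix_left_invertible_ker)

text \<open>Both sides depend on the line only, so the arbitrary representative can be exchanged for
  the Borel unit vector.\<close>

lemma transfer_integrand:
  assumes "invertible g" "x \<in> Proj"
  shows "exp (s * cocycle g x) * f (outer (rep (pact g x)))
    = norm (g *v section_of x) powr s * f (outer (g *v section_of x))"
proof -
  note r = rep_Proj(1)[OF assms(2)]
  obtain c where c: "\<bar>c\<bar> = 1 / norm (rep x)" "section_of x = c *\<^sub>R rep x"
    using section_of_rep(1)[OF assms(2)] by blast
  have c0: "c \<noteq> 0" using c(1) r by auto
  have gr: "g *v rep x \<noteq> 0" using invertible_mult_nonzero assms r by blast
  have "outer (rep (pact g x)) = outer (g *v section_of x)"
    using c0 by (simp add: pact_def outer_rep_pline[OF gr] c(2) matrix_vector_mult_scaleR)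
  moreover have "norm (g *v section_of x) = norm (g *v rep x) / norm (rep x)"
    by (simp add: c(2) matrix_vector_mult_scaleR c(1))
  then have "exp (s * cocycle g x) = norm (g *v section_of x) powr s"
    using gr r by (simp add: cocycle_def powr_def)
  ultimately show ?thesis by simp
qed

section \<open>The eigenmeasure equation for Borel functions on vectors\<close>

lemma measure_eqI_open:
  fixes M N :: "'a::metric_space measure"
  assumes sets: "sets M = sets borel" "sets N = sets borel" and fin: "emeasure M UNIV \<noteq> \<infinity>"
    and eq: "\<And>\<psi>. continuous_on UNIV \<psi> \<Longrightarrow> (\<And>x. 0 \<le> \<psi> x \<and> \<psi> x \<le> 1) \<Longrightarrow>
      (\<integral>\<^sup>+x. ennreal (\<psi> x) \<partial>M) = (\<integral>\<^sup>+x. ennreal (\<psi> x) \<partial>N)"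
  shows "M = N"
proof (rule measure_eqI_generator_eq[where E = "Collect open" and \<Omega> = UNIV and A = "\<lambda>_. UNIV"])
  show "Int_stable (Collect open :: 'a set set)" by (auto simp: Int_stable_def)
  show "sets M = sigma_sets UNIV (Collect open)" "sets N = sigma_sets UNIV (Collect open)"
    using sets by (auto simp: borel_def)
  show "emeasure M UNIV \<noteq> \<infinity>" for i :: nat by (rule fin)
  fix U :: "'a set" assume "U \<in> Collect open"
  then have U: "open U" by simp
  \<comment> \<open>These increase to the indicator of \<open>U\<close>. The case
    \<open>UNIV\<close> is apart because \<open>infdist\<close> to the empty set is 0.\<close>
  define \<psi> where "\<psi> k x = (if U = UNIV then 1 else min 1 (real k * infdist x (- U)))" for k :: nat and x
  have cont: "continuous_on UNIV (\<psi> k)" for k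
    unfolding \<psi>_def by (cases "U = UNIV") (auto intro!: continuous_intros)
  have bnd: "0 \<le> \<psi> k x \<and> \<psi> k x \<le> 1" for k x
    by (auto simp: \<psi>_def infdist_nonneg)
  have sup: "(SUP k. ennreal (\<psi> k x)) = indicator U x" for x
  proof (cases "x \<in> U")
    case True
    have "\<exists>k. \<psi> k x = 1"
    proof (cases "U = UNIV")
      case False
      have "infdist x (- U) > 0"
        using U True False by (subst infdist_pos_not_in_closed) auto
      then obtain k :: nat where "1 / infdist x (- U) < real k" using reals_Archimedean2 by blast
      with \<open>infdist x (- U) > 0\<close> have "1 \<le> real k * infdist x (- U)" by (simp add: field_simps)
      then show ?thesis using False by (intro exI[of _ k]) (simp add: \<psi>_def)
    qed (auto simp: \<psi>_def)
    then obtain k where "\<psi> k x = 1" by blast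
    show ?thesis
    proof (rule antisym)
      show "(SUP k. ennreal (\<psi> k x)) \<le> indicator U x"
        using bnd True by (intro SUP_least) simp
      show "indicator U x \<le> (SUP k. ennreal (\<psi> k x))"
        using True \<open>\<psi> k x = 1\<close> by (intro SUP_upper2[of k]) auto
    qed
  next
    case False
    then have "\<psi> k x = 0" for k by (auto simp: \<psi>_def)
    with False show ?thesis by simp
  qed
  have mono: "incseq (\<lambda>k x. ennreal (\<psi> k x))"
    by (auto simp: incseq_def le_fun_def \<psi>_def intro!: ennreal_leI min.mono mult_right_mono infdist_nonneg)
  have [measurable]: "\<psi> k \<in> borel_measurable borel" for k
    by (rule borel_measurable_continuous_onI[OF cont])
  have *: "emeasure L U = (SUP k. \<integral>\<^sup>+x. ennreal (\<psi> k x) \<partial>L)" if L: "sets L = sets borel" for L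
  proof -
    note [measurable_cong] = L
    have "U \<in> sets L" using L U by auto
    then have "emeasure L U = (\<integral>\<^sup>+x. (SUP k. ennreal (\<psi> k x)) \<partial>L)" by (simp add: sup)
    also have "\<dots> = (SUP k. \<integral>\<^sup>+x. ennreal (\<psi> k x) \<partial>L)"
      by (rule nn_integral_monotone_convergence_SUP[OF mono]) measurable
    finally show ?thesis .
  qed
  show "emeasure M U = emeasure N U"
    unfolding *[OF sets(1)] *[OF sets(2)] by (intro SUP_cong eq cont bnd refl)
qed auto

text \<open>The hypothesis tests continuous functions only, while indicators will be needed later.
  Both sides become finite measures on matrices through the embedding \<open>outer\<close>, and
  there continuous functions determine a measure.\<close>

lemma eigenmeasure_on_vectors:
  fixes \<mu> :: "(real^'n^'n) measure" and \<nu> :: "((real^'n) set) measure"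
  assumes mu_borel: "sets \<mu> = sets borel"
    and mu_prob: "prob_space \<mu>"
    and mu_GL: "AE g in \<mu>. g \<in> GL"
    and s: "s \<in> I_plus \<mu>"
    and nu_sets: "sets \<nu> = sets proj_borel"
    and nu_prob: "prob_space \<nu>"
    and kappa: "\<kappa> > 0"
    and eigen: "\<And>\<phi>. proj_continuous \<phi> \<Longrightarrow>
        (\<integral>x. transfer_op \<mu> s \<phi> x \<partial>\<nu>) = \<kappa> * (\<integral>x. \<phi> x \<partial>\<nu>)"
    and F: "F \<in> borel_measurable borel" and F_scale: "\<And>c v. c \<noteq> 0 \<Longrightarrow> F (c *\<^sub>R v) = F v"
  defines "N \<equiv> distr \<nu> borel section_of"
  shows "(\<integral>\<^sup>+g. \<integral>\<^sup>+u. ennreal (norm (g *v u) powr s) * F (g *v u) \<partial>N \<partial>\<mu>) = ennreal \<kappa> * (\<integral>\<^sup>+u. F u \<partial>N)"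
proof -
  interpret \<mu>: prob_space \<mu> by fact
  interpret \<nu>: prob_space \<nu> by fact
  note [measurable_cong] = mu_borel nu_sets
  note [measurable] = F
  have sp: "space \<nu> = Proj" using sets_eq_imp_space_eq[OF nu_sets] by (simp add: space_proj_borel)
  interpret N: prob_space N
    unfolding N_def by (rule \<nu>.prob_space_distr) measurable
  have [measurable_cong]: "sets N = sets borel" by (simp add: N_def)
  interpret P: pair_sigma_finite \<mu> N ..
  have N1: "AE u in N. norm u = 1"
    unfolding N_def by (subst AE_distr_iff) (auto simp: sp section_of_rep(2))
  have GL: "AE g in \<mu>. invertible g" using mu_GL by (simp add: GL_def)
  have s0: "0 \<le> s" and mom: "(\<integral>\<^sup>+ g. ennreal (norm g powr s) \<partial>\<mu>) < \<infinity>"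
    using s by (auto simp: I_plus_def)
  have intm: "integrable \<mu> (\<lambda>g. norm g powr s)"
    using mom by (intro integrableI_nonneg) auto
  have le: "norm (g *v u) powr s \<le> norm g powr s" if "norm u = 1" for g :: "real^'n^'n" and u :: "real^'n"
    using norm_matrix_vector_le[of g u] that s0 by (intro powr_mono2) auto

  define M2 where "M2 = distr (density (\<mu> \<Otimes>\<^sub>M N) (\<lambda>(g, u). ennreal (norm (g *v u) powr s))) borel (\<lambda>(g, u). outer (g *v u))"
  define M1 where "M1 = distr (density N (\<lambda>_. ennreal \<kappa>)) borel outer"
  have int_M2: "(\<integral>\<^sup>+x. f x \<partial>M2) = (\<integral>\<^sup>+g. \<integral>\<^sup>+u. ennreal (norm (g *v u) powr s) * f (outer (g *v u)) \<partial>N \<partial>\<mu>)"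
    if [measurable]: "f \<in> borel_measurable borel" for f
    unfolding M2_def
    by (simp add: nn_integral_distr nn_integral_density split_beta' N.nn_integral_fst[symmetric])
  have int_M1: "(\<integral>\<^sup>+x. f x \<partial>M1) = ennreal \<kappa> * (\<integral>\<^sup>+u. f (outer u) \<partial>N)"
    if [measurable]: "f \<in> borel_measurable borel" for f
    unfolding M1_def
    by (simp add: nn_integral_distr nn_integral_density nn_integral_cmult)
  have "M1 = M2"
  proof (rule measure_eqI_open)
    show "sets M1 = sets borel" "sets M2 = sets borel" by (simp_all add: M1_def M2_def)
    have "emeasure M1 UNIV = (\<integral>\<^sup>+x. 1 \<partial>M1)" by (simp add: M1_def)
    also have "\<dots> = ennreal \<kappa>" by (subst int_M1) (auto simp: N.emeasure_space_1)
    finally show "emeasure M1 UNIV \<noteq> \<infinity>" by simp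
    fix \<psi> :: "real^'n^'n \<Rightarrow> real"
    assume c: "continuous_on UNIV \<psi>" and b: "\<And>x. 0 \<le> \<psi> x \<and> \<psi> x \<le> 1"
    have [measurable]: "\<psi> \<in> borel_measurable borel" by (rule borel_measurable_continuous_onI[OF c])
    define G where "G u = (\<integral>g. norm (g *v u) powr s * \<psi> (outer (g *v u)) \<partial>\<mu>)" for u
    have [measurable]: "G \<in> borel_measurable borel"
      unfolding G_def by (rule \<mu>.borel_measurable_lebesgue_integral) measurable
    define \<phi> where "\<phi> x = \<psi> (outer (rep x))" for x
    have "proj_continuous \<phi>"
      unfolding proj_continuous_def
    proof (rule continuous_on_eq)
      show "continuous_on (UNIV - {0}) (\<lambda>v. \<psi> (outer v))"
        using continuous_on_outer
        by (intro continuous_on_compose2[OF c]) (auto simp: Compl_eq_Diff_UNIV)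
      show "\<psi> (outer v) = \<phi> (pline v)" if "v \<in> UNIV - {0}" for v
        using that by (simp add: \<phi>_def outer_rep_pline)
    qed
    note ev = eigen[OF this]
    \<comment> \<open>Here the moment condition enters: \<open>norm g powr s\<close> dominates the
      integrand for all unit vectors and thereby bounds \<open>G\<close>.\<close>
    have pt: "norm (g *v u) powr s * \<psi> (outer (g *v u)) \<le> norm g powr s" if "norm u = 1" for g and u :: "real^'n"
      using mult_mono[OF le[OF that, of g], of "\<psi> (outer (g *v u))" 1] b by auto
    have intg: "integrable \<mu> (\<lambda>g. norm (g *v u) powr s * \<psi> (outer (g *v u)))" if "norm u = 1" for u
      using intm by (rule Bochner_Integration.integrable_bound) (use pt[OF that] b in auto)
    have Gle: "0 \<le> G u" "norm u = 1 \<Longrightarrow> G u \<le> (\<integral>g. norm g powr s \<partial>\<mu>)" for u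
      unfolding G_def using b intg intm pt by (auto intro!: integral_mono integral_nonneg_AE)
    have intG: "integrable N G"
      by (rule N.integrable_const_bound[of _ "\<integral>g. norm g powr s \<partial>\<mu>"])
        (use N1 in \<open>auto simp: Gle elim!: eventually_mono\<close>)
    have "transfer_op \<mu> s \<phi> x = G (section_of x)" if "x \<in> space \<nu>" for x
      unfolding transfer_op_def G_def
    proof (rule integral_cong_AE)
      show ae: "AE g in \<mu>. exp (s * cocycle g x) * \<phi> (pact g x) = norm (g *v section_of x) powr s * \<psi> (outer (g *v section_of x))"
        using GL by eventually_elim (use that sp in \<open>auto simp: \<phi>_def intro: transfer_integrand\<close>)
      show "(\<lambda>g. norm (g *v section_of x) powr s * \<psi> (outer (g *v section_of x))) \<in> borel_measurable \<mu>"
        by measurable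
      have "(\<lambda>g. exp (s * ln (norm (g *v rep x) / norm (rep x))) * \<psi> (outer (g *v rep x))) \<in> borel_measurable \<mu>"
        by measurable
      have "(\<lambda>g. \<phi> (pact g x)) = (\<lambda>g. if g *v rep x = 0 then \<psi> (outer (rep (pline 0))) else \<psi> (outer (g *v rep x)))"
        by (auto simp: \<phi>_def pact_def outer_rep_pline)
      also have "\<dots> \<in> borel_measurable \<mu>" by measurable
      finally have [measurable]: "(\<lambda>g. \<phi> (pact g x)) \<in> borel_measurable \<mu>" .
      show "(\<lambda>g. exp (s * cocycle g x) * \<phi> (pact g x)) \<in> borel_measurable \<mu>"
        unfolding cocycle_def by measurable
    qed
    then have "(\<integral>x. transfer_op \<mu> s \<phi> x \<partial>\<nu>) = (\<integral>x. G (section_of x) \<partial>\<nu>)"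
      by (intro Bochner_Integration.integral_cong) auto
    also have "\<dots> = (\<integral>u. G u \<partial>N)" unfolding N_def by (simp add: integral_distr)
    finally have GN0: "(\<integral>x. transfer_op \<mu> s \<phi> x \<partial>\<nu>) = (\<integral>u. G u \<partial>N)" .
    have "(\<integral>x. \<phi> x \<partial>\<nu>) = (\<integral>x. \<psi> (outer (section_of x)) \<partial>\<nu>)"
      by (intro Bochner_Integration.integral_cong) (auto simp: \<phi>_def sp outer_section_of)
    also have "\<dots> = (\<integral>u. \<psi> (outer u) \<partial>N)" unfolding N_def by (simp add: integral_distr)
    finally have GN: "(\<integral>u. G u \<partial>N) = \<kappa> * (\<integral>u. \<psi> (outer u) \<partial>N)" using ev GN0 by simp
    have "(\<integral>\<^sup>+x. ennreal (\<psi> x) \<partial>M2) = (\<integral>\<^sup>+g. \<integral>\<^sup>+u. ennreal (norm (g *v u) powr s * \<psi> (outer (g *v u))) \<partial>N \<partial>\<mu>)"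
      by (subst int_M2) (auto simp: ennreal_mult b)
    also have "\<dots> = (\<integral>\<^sup>+u. \<integral>\<^sup>+g. ennreal (norm (g *v u) powr s * \<psi> (outer (g *v u))) \<partial>\<mu> \<partial>N)"
      by (rule P.Fubini'[symmetric]) measurable
    also have "\<dots> = (\<integral>\<^sup>+u. ennreal (G u) \<partial>N)"
      by (rule nn_integral_cong_AE, use N1 in eventually_elim)
        (auto simp: G_def b intg intro!: nn_integral_eq_integral)
    also have "\<dots> = ennreal (\<integral>u. G u \<partial>N)"
      using intG Gle(1) by (intro nn_integral_eq_integral) auto
    also have "\<dots> = ennreal \<kappa> * ennreal (\<integral>u. \<psi> (outer u) \<partial>N)"
      using kappa b by (simp add: GN ennreal_mult integral_nonneg_AE)
    also have "ennreal (\<integral>u. \<psi> (outer u) \<partial>N) = (\<integral>\<^sup>+u. ennreal (\<psi> (outer u)) \<partial>N)"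
      using b by (intro nn_integral_eq_integral[symmetric] N.integrable_const_bound[of _ 1]) auto
    finally show "(\<integral>\<^sup>+x. ennreal (\<psi> x) \<partial>M1) = (\<integral>\<^sup>+x. ennreal (\<psi> x) \<partial>M2)"
      by (subst int_M1) auto
  qed
  \<comment> \<open>A function of the line is read off from the projection by
    \<open>unit_section\<close>; the vector is recovered up to a scalar, to which \<open>F\<close>
    is blind.\<close>
  define f where "f = F \<circ> unit_section"
  have [measurable]: "f \<in> borel_measurable borel" unfolding f_def by measurable
  have f: "f (outer v) = F v" if "v \<noteq> 0" for v
    using unit_section_outer(1)[OF that] F_scale by (auto simp: f_def)
  have "(\<integral>\<^sup>+g. \<integral>\<^sup>+u. ennreal (norm (g *v u) powr s) * F (g *v u) \<partial>N \<partial>\<mu>) = (\<integral>\<^sup>+x. f x \<partial>M2)"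
    unfolding int_M2[OF \<open>f \<in> borel_measurable borel\<close>]
  proof (intro nn_integral_cong)
    fix g u
    \<comment> \<open>When \<open>g *v u = 0\<close> the weight \<open>0 powr s\<close> is 0, also
      for s = 0, and both sides vanish.\<close>
    show "ennreal (norm (g *v u) powr s) * F (g *v u) = ennreal (norm (g *v u) powr s) * f (outer (g *v u))"
      by (cases "g *v u = 0") (auto simp: f)
  qed
  also have "\<dots> = ennreal \<kappa> * (\<integral>\<^sup>+u. f (outer u) \<partial>N)"
    unfolding \<open>M1 = M2\<close>[symmetric] by (subst int_M1) auto
  also have "(\<integral>\<^sup>+u. f (outer u) \<partial>N) = (\<integral>\<^sup>+u. F u \<partial>N)"
    by (rule nn_integral_cong_AE, use N1 in eventually_elim) (auto intro!: f)
  finally show ?thesis .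
qed

section \<open>Polynomials of bounded degree\<close>

text \<open>Polynomials are treated as functions with pointwise operations: vanishing on a set and
  substitution of a matrix are then immediate, and dimensions are counted inside spans of finitely
  many monomials.\<close>

interpretation fs: vector_space "\<lambda>(c :: real) (f :: 'a \<Rightarrow> real) x. c * f x"
  by unfold_locales (simp_all add: fun_eq_iff algebra_simps)

lemma fun_sum_apply: "(\<Sum>i\<in>I. f i) x = (\<Sum>i\<in>I. f i x :: real)" for f :: "'b \<Rightarrow> 'a \<Rightarrow> real"
  by (induction I rule: infinite_finite_induct) auto

text \<open>Steinitz exchange for an indexed family, in which a repetition counts as a relation.
  Polynomials composed with a matrix will be listed together with fixed ones, and the two lists may
  overlap.\<close>

lemma dependent_family:
  fixes f :: "'b \<Rightarrow> 'a \<Rightarrow> real"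
  assumes fin: "finite I" "finite F" and card: "card F < card I" and span: "\<And>i. i \<in> I \<Longrightarrow> f i \<in> fs.span F"
  shows "\<exists>x. (\<exists>i\<in>I. x i \<noteq> 0) \<and> (\<forall>v. (\<Sum>i\<in>I. x i * f i v) = 0)"
proof (cases "inj_on f I")
  case False
  then obtain i j where ij: "i \<in> I" "j \<in> I" "i \<noteq> j" "f i = f j" by (auto simp: inj_on_def)
  define x where "x k = (if k = i then 1 else if k = j then -1 else (0 :: real))" for k
  have "(\<Sum>k\<in>I. x k * f k v) = 0" for v
  proof -
    have "(\<Sum>k\<in>I. x k * f k v) = (\<Sum>k\<in>{i, j}. x k * f k v)"
      using ij fin by (intro sum.mono_neutral_right) (auto simp: x_def)
    also have "\<dots> = 0" using ij by (simp add: x_def)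
    finally show ?thesis .
  qed
  moreover have "x i \<noteq> 0" by (simp add: x_def)
  ultimately show ?thesis using ij(1) by (intro exI[of _ x]) blast
next
  case True
  have "fs.dependent (f ` I)"
  proof (rule ccontr)
    assume "fs.independent (f ` I)"
    moreover have "f ` I \<subseteq> fs.span F" using span by blast
    ultimately have "card (f ` I) \<le> card F" using fs.independent_span_bound[OF fin(2)] by blast
    with card True show False by (simp add: card_image)
  qed
  then obtain a where a: "\<exists>g\<in>f ` I. a g \<noteq> 0" "(\<Sum>g\<in>f ` I. (\<lambda>v. a g * g v)) = 0"
    using fin(1) by (auto simp: fs.dependent_finite)
  have "(\<Sum>i\<in>I. a (f i) * f i v) = 0" for v
    using fun_cong[OF a(2), of v] True by (simp add: sum.reindex fun_sum_apply)
  with a(1) show ?thesis by (intro exI[of _ "\<lambda>i. a (f i)"]) blast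
qed

definition monomial :: "('n \<Rightarrow> nat) \<Rightarrow> real^'n \<Rightarrow> real" where
  "monomial \<alpha> v = (\<Prod>i\<in>UNIV. v $ i ^ \<alpha> i)"

text \<open>Degree at most \<open>k\<close>, without homogeneity. The bound keeps the space
  finite-dimensional, and it is stable under substituting a linear map.\<close>

definition polys :: "nat \<Rightarrow> (real^'n \<Rightarrow> real) set" where
  "polys k = fs.span (monomial ` {\<alpha>. sum \<alpha> UNIV \<le> k})"

lemma finite_exponents: "finite {\<alpha> :: 'n::finite \<Rightarrow> nat. sum \<alpha> UNIV \<le> k}"
proof (rule finite_subset)
  show "{\<alpha> :: 'n \<Rightarrow> nat. sum \<alpha> UNIV \<le> k} \<subseteq> PiE UNIV (\<lambda>_. {..k})"
  proof
    fix \<alpha> :: "'n \<Rightarrow> nat" assume "\<alpha> \<in> {\<alpha>. sum \<alpha> UNIV \<le> k}"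
    then have "\<alpha> i \<le> k" for i using member_le_sum[of i UNIV \<alpha>] by simp
    then show "\<alpha> \<in> PiE UNIV (\<lambda>_. {..k})" by (simp add: PiE_iff)
  qed
  show "finite (PiE (UNIV :: 'n set) (\<lambda>_. {..k}))" by (intro finite_PiE) auto
qed

lemma polys_mono: "a \<le> b \<Longrightarrow> polys a \<subseteq> polys b"
  unfolding polys_def by (intro fs.span_mono image_mono) auto

lemma monomial_in_polys: "sum \<alpha> UNIV \<le> k \<Longrightarrow> monomial \<alpha> \<in> polys k"
  unfolding polys_def by (intro fs.span_base imageI) simp

lemma polys_add: "p \<in> polys k \<Longrightarrow> q \<in> polys k \<Longrightarrow> (\<lambda>v. p v + q v) \<in> polys k"
  unfolding polys_def using fs.span_add[of p _ q] by (simp add: plus_fun_def)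

lemma polys_scale: "p \<in> polys k \<Longrightarrow> (\<lambda>v. c * p v) \<in> polys k"
  unfolding polys_def by (rule fs.span_scale)

lemma polys_0: "(\<lambda>v. 0) \<in> polys k"
  unfolding polys_def using fs.span_zero by (simp add: zero_fun_def)

lemma polys_sum: "finite I \<Longrightarrow> (\<And>i. i \<in> I \<Longrightarrow> f i \<in> polys k) \<Longrightarrow> (\<lambda>v. \<Sum>i\<in>I. f i v) \<in> polys k"
  by (induction I rule: finite_induct) (auto intro: polys_add polys_0)

lemma polys_induct [consumes 1, case_names zero step]:
  assumes "p \<in> polys k" and "Q (\<lambda>v. 0)"
    and "\<And>c \<alpha> q. sum \<alpha> UNIV \<le> k \<Longrightarrow> Q q \<Longrightarrow> q \<in> polys k \<Longrightarrow> Q (\<lambda>v. c * monomial \<alpha> v + q v)"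
  shows "Q p"
proof -
  have "p \<in> polys k \<and> Q p"
    using assms(1) unfolding polys_def
  proof (induction rule: fs.span_induct_alt)
    case base
    then show ?case using assms(2) fs.span_zero by (simp add: zero_fun_def)
  next
    case (step c x y)
    then obtain \<alpha> where \<alpha>: "x = monomial \<alpha>" "sum \<alpha> UNIV \<le> k" by blast
    have y: "y \<in> polys k" "Q y" using step by (simp_all add: polys_def)
    have "(\<lambda>v. c * monomial \<alpha> v + y v) \<in> polys k"
      by (intro polys_add polys_scale monomial_in_polys \<alpha> y)
    moreover have "Q (\<lambda>v. c * monomial \<alpha> v + y v)" using assms(3)[OF \<alpha>(2) y(2,1)] .
    ultimately show ?case by (simp add: polys_def \<alpha>(1) plus_fun_def)
  qed
  then show ?thesis by blast
qed

lemma monomial_mult: "monomial \<alpha> v * monomial \<beta> v = monomial (\<lambda>i. \<alpha> i + \<beta> i) v"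
  by (simp add: monomial_def power_add prod.distrib)

lemma polys_mult:
  assumes "p \<in> polys a" "q \<in> polys b"
  shows "(\<lambda>v. p v * q v) \<in> polys (a + b)"
  using assms(1)
proof (induction rule: polys_induct)
  case zero
  then show ?case by (simp add: polys_0)
next
  case (step c \<alpha> p)
  have "(\<lambda>v. monomial \<alpha> v * q v) \<in> polys (a + b)"
    using assms(2)
  proof (induction rule: polys_induct)
    case zero
    then show ?case by (simp add: polys_0)
  next
    case (step d \<beta> q)
    have "(\<lambda>v. d * monomial (\<lambda>i. \<alpha> i + \<beta> i) v + monomial \<alpha> v * q v) \<in> polys (a + b)"
      using step \<open>sum \<alpha> UNIV \<le> a\<close>
      by (intro polys_add polys_scale monomial_in_polys) (simp_all add: sum.distrib add_mono)
    then show ?case by (simp add: distrib_left mult.left_commute monomial_mult)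
  qed
  from polys_add[OF polys_scale[OF this, of c] step(3)] show ?case
    by (simp add: distrib_right mult.assoc)
qed

lemma polys_1: "(\<lambda>v :: real^'n. 1) \<in> polys k"
proof -
  have "monomial (\<lambda>_. 0) = (\<lambda>v :: real^'n. 1)" by (simp add: monomial_def fun_eq_iff)
  then show ?thesis using monomial_in_polys[of "\<lambda>_ :: 'n. 0" k] by simp
qed

lemma polys_coordinate: "(\<lambda>v :: real^'n. v $ j) \<in> polys 1"
proof -
  have "v $ i ^ (if i = j then 1 else 0) = (if i = j then v $ i else 1)" for i and v :: "real^'n" by simp
  then have "monomial (\<lambda>i. if i = j then 1 else 0) = (\<lambda>v :: real^'n. v $ j)"
    by (simp only: monomial_def fun_eq_iff) (simp add: prod.delta)
  then show ?thesis using monomial_in_polys[of "\<lambda>i. if i = j then 1 else 0" 1] by simp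
qed

lemma polys_linear_form: "(\<lambda>v. (h *v v) $ i) \<in> polys 1" for h :: "real^'n^'n"
  unfolding matrix_vector_mult_def vec_lambda_beta
  by (intro polys_sum polys_scale polys_coordinate) simp

lemma polys_power: "p \<in> polys 1 \<Longrightarrow> (\<lambda>v. p v ^ m) \<in> polys m"
proof (induction m)
  case (Suc m)
  then show ?case using polys_mult[of p 1 "\<lambda>v. p v ^ m" m] by simp
qed (simp add: polys_1)

lemma polys_prod:
  assumes "finite I" "\<And>i. i \<in> I \<Longrightarrow> p i \<in> polys (d i)"
  shows "(\<lambda>v. \<Prod>i\<in>I. p i v) \<in> polys (sum d I)"
  using assms
proof (induction I rule: finite_induct)
  case (insert i I)
  then show ?case using polys_mult[of "p i" "d i" "\<lambda>v. \<Prod>i\<in>I. p i v" "sum d I"] by simp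
qed (simp add: polys_1)

lemma polys_compose:
  fixes h :: "real^'n^'n"
  assumes "p \<in> polys k"
  shows "(\<lambda>v. p (h *v v)) \<in> polys k"
  using assms
proof (induction rule: polys_induct)
  case zero
  then show ?case by (rule polys_0)
next
  case (step c \<alpha> q)
  have "(\<lambda>v. \<Prod>i\<in>UNIV. (h *v v) $ i ^ \<alpha> i) \<in> polys (sum \<alpha> UNIV)"
    by (intro polys_prod polys_power polys_linear_form) simp
  then have "(\<lambda>v. monomial \<alpha> (h *v v)) \<in> polys k"
    using polys_mono[OF step(1)] by (auto simp: monomial_def)
  then show ?case by (intro polys_add polys_scale step(3))
qed

lemma continuous_on_polys: "p \<in> polys k \<Longrightarrow> continuous_on UNIV p"
proof (induction rule: polys_induct)
  case (step c \<alpha> q)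
  then show ?case unfolding monomial_def by (intro continuous_intros)
qed (rule continuous_on_const)

lemma poly_fun_in_polys: "poly_fun p \<Longrightarrow> \<exists>k. p \<in> polys k"
proof -
  assume "poly_fun p"
  then obtain F c where F: "finite F" "p = (\<lambda>v. \<Sum>\<alpha>\<in>F. c \<alpha> * monomial \<alpha> v)"
    unfolding poly_fun_def monomial_def by blast
  have "sum \<alpha> UNIV \<le> (\<Sum>\<beta>\<in>F. sum \<beta> UNIV)" if "\<alpha> \<in> F" for \<alpha>
    using F(1) that by (intro member_le_sum) auto
  then have "p \<in> polys (\<Sum>\<beta>\<in>F. sum \<beta> UNIV)"
    unfolding F(2) by (intro polys_sum polys_scale monomial_in_polys F(1))
  then show ?thesis by blast
qed

lemma finite_poly_funs_in_polys:
  assumes "finite P" "\<And>p. p \<in> P \<Longrightarrow> poly_fun p"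
  shows "\<exists>k. P \<subseteq> polys k"
  using assms
proof (induction P rule: finite_induct)
  case (insert p P)
  then obtain k where "P \<subseteq> polys k" by blast
  moreover obtain j where "p \<in> polys j" using poly_fun_in_polys insert.prems by blast
  ultimately have "insert p P \<subseteq> polys (max j k)" using polys_mono[of j "max j k"] polys_mono[of k "max j k"] by auto
  then show ?case by blast
qed auto

section \<open>Compactness of coefficients and Lipschitz approximation\<close>

lemma bounded_family_subsequence:
  fixes a :: "nat \<Rightarrow> 'b \<Rightarrow> real"
  assumes "finite B" "\<And>n b. b \<in> B \<Longrightarrow> \<bar>a n b\<bar> \<le> 1"
  shows "\<exists>r l. strict_mono (r :: nat \<Rightarrow> nat) \<and> (\<forall>b\<in>B. (\<lambda>n. a (r n) b) \<longlonglongrightarrow> l b)"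
  using assms
proof (induction B rule: finite_induct)
  case empty
  show ?case by (intro exI[of _ id]) (simp add: strict_mono_id)
next
  case (insert b B)
  have "\<exists>r l. strict_mono (r :: nat \<Rightarrow> nat) \<and> (\<forall>b\<in>B. (\<lambda>n. a (r n) b) \<longlonglongrightarrow> l b)"
    by (rule insert.IH) (rule insert.prems, simp)
  then obtain r l where r: "strict_mono (r :: nat \<Rightarrow> nat)" "\<forall>b\<in>B. (\<lambda>n. a (r n) b) \<longlonglongrightarrow> l b"
    by (elim exE conjE)
  have "\<forall>n. a (r n) b \<in> cball 0 1" using insert.prems[of b] by simp
  with compact_imp_seq_compact[OF compact_cball] obtain x q where
    q: "strict_mono q" "((\<lambda>n. a (r n) b) \<circ> q) \<longlonglongrightarrow> x" by (rule seq_compactE)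
  have "(\<lambda>n. a ((r \<circ> q) n) b') \<longlonglongrightarrow> (l(b := x)) b'" if "b' \<in> insert b B" for b'
  proof (cases "b' = b")
    case True
    then show ?thesis using q(2) by (simp add: o_def)
  next
    case False
    then show ?thesis using LIMSEQ_subseq_LIMSEQ[OF _ q(1), of "\<lambda>n. a (r n) b'" "l b'"] r(2) that by (simp add: o_def)
  qed
  moreover have "strict_mono (r \<circ> q)" using r(1) q(1) by (rule strict_mono_o)
  ultimately show ?case by (intro exI[of _ "r \<circ> q"] exI[of _ "l(b := x)"] conjI ballI)
qed

text \<open>Inner regularity gives a compact \<open>K\<close> inside \<open>B\<close> of nearly the
  same mass, and the functions max(0, 1 - k dist(x, K)) decrease to its indicator. The Lipschitz
  constant is recorded because it will multiply a variance that tends to zero.\<close>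

lemma lipschitz_approximation:
  fixes M :: "'b::{second_countable_topology, complete_space} measure"
  assumes sets [measurable_cong]: "sets M = sets borel" and fin: "finite_measure M"
    and B [measurable]: "B \<in> sets borel" and pos: "measure M B > 0" and e: "e > 0"
  shows "\<exists>k \<psi>. 0 \<le> k \<and> continuous_on UNIV \<psi> \<and> (\<forall>x. 0 \<le> \<psi> x \<and> \<psi> x \<le> 1) \<and> (\<forall>x y. \<bar>\<psi> x - \<psi> y\<bar> \<le> k * dist x y) \<and>
    (\<integral>x. \<bar>indicator B x - \<psi> x\<bar> \<partial>M) \<le> e"
proof -
  interpret finite_measure M by fact
  have sp: "space M = UNIV" using sets_eq_imp_space_eq[OF sets] by simp
  \<comment> \<open>The second entry keeps \<open>measure M B - d\<close> nonnegative, which makes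
    the comparison in \<open>ennreal\<close> faithful and forces \<open>K\<close> to be
    nonempty.\<close>
  define d where "d = min (e / 2) (measure M B)"
  have d: "d > 0" "d \<le> e / 2" "d \<le> measure M B" using e pos by (auto simp: d_def)
  have "\<exists>K. K \<subseteq> B \<and> compact K \<and> measure M K > measure M B - d"
  proof -
    have "emeasure M B = (SUP K\<in>{K. K \<subseteq> B \<and> compact K}. emeasure M K)"
      by (rule inner_regular[OF sets _ B]) (simp add: emeasure_eq_measure)
    moreover have "ennreal (measure M B - d) < emeasure M B"
      using d by (simp add: emeasure_eq_measure ennreal_less_iff)
    ultimately have "\<exists>K\<in>{K. K \<subseteq> B \<and> compact K}. ennreal (measure M B - d) < emeasure M K"
      by (simp only: less_SUP_iff)
    then obtain K where K: "K \<subseteq> B" "compact K" "ennreal (measure M B - d) < emeasure M K" by blast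
    then show ?thesis using d by (intro exI[of _ K]) (simp add: emeasure_eq_measure ennreal_less_iff)
  qed
  then obtain K where K: "K \<subseteq> B" "compact K" "measure M K > measure M B - d" by blast
  have "closed K" using K by (simp add: compact_imp_closed)
  then have [measurable]: "K \<in> sets borel" by (rule borel_closed)
  have Kne: "K \<noteq> {}" using K(3) d by auto
  define \<psi> where "\<psi> k x = max 0 (1 - real k * infdist x K)" for k :: nat and x
  have cont: "continuous_on UNIV (\<psi> k)" for k unfolding \<psi>_def by (intro continuous_intros)
  have [measurable]: "\<psi> k \<in> borel_measurable borel" for k by (rule borel_measurable_continuous_onI[OF cont])
  have bnd: "0 \<le> \<psi> k x" "\<psi> k x \<le> 1" for k x by (auto simp: \<psi>_def infdist_nonneg)
  have lip: "\<bar>\<psi> k x - \<psi> k y\<bar> \<le> real k * dist x y" for k x y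
  proof -
    have "\<bar>\<psi> k x - \<psi> k y\<bar> \<le> \<bar>real k * infdist x K - real k * infdist y K\<bar>" unfolding \<psi>_def by linarith
    also have "\<dots> = real k * \<bar>infdist x K - infdist y K\<bar>" by (simp add: abs_mult flip: right_diff_distrib)
    also have "\<dots> \<le> real k * dist x y" by (intro mult_left_mono infdist_triangle_abs) simp
    finally show ?thesis .
  qed
  have "(\<lambda>k. \<integral>x. \<psi> k x \<partial>M) \<longlonglongrightarrow> (\<integral>x. indicator K x \<partial>M)"
  proof (rule integral_dominated_convergence[where w = "\<lambda>_. 1"])
    show "AE x in M. (\<lambda>k. \<psi> k x) \<longlonglongrightarrow> indicator K x"
    proof (intro AE_I2)
      fix x
      show "(\<lambda>k. \<psi> k x) \<longlonglongrightarrow> indicator K x"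
      proof (cases "x \<in> K")
        case True
        then show ?thesis by (simp add: \<psi>_def)
      next
        case False
        then have i: "infdist x K > 0" using \<open>closed K\<close> Kne by (simp add: infdist_pos_not_in_closed)
        obtain k0 :: nat where k0: "1 / infdist x K < real k0" using reals_Archimedean2 by blast
        have "\<psi> k x = 0" if "k0 \<le> k" for k
        proof -
          have "1 / infdist x K < real k" using k0 that by simp
          then have "1 < real k * infdist x K" using i by (simp add: divide_less_eq)
          then show ?thesis by (simp add: \<psi>_def)
        qed
        then have "eventually (\<lambda>k. \<psi> k x = 0) sequentially" unfolding eventually_sequentially by (intro exI allI impI)
        then show ?thesis using False by (simp add: tendsto_eventually)
      qed
    qed
    show "AE x in M. norm (\<psi> k x) \<le> 1" for k using bnd[of k] by (intro AE_I2) simp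
  qed (simp_all, measurable)
  then have "(\<lambda>k. \<integral>x. \<psi> k x \<partial>M) \<longlonglongrightarrow> measure M K" by (simp add: sp)
  then obtain k where k: "\<bar>(\<integral>x. \<psi> k x \<partial>M) - measure M K\<bar> < e / 2"
    using e LIMSEQ_D[of _ "measure M K" "e / 2"] by force
  have int: "integrable M (\<psi> k)" using bnd[of k] by (intro integrable_const_bound[of _ 1]) auto
  have intK: "integrable M (indicat_real K)" "integrable M (indicat_real B)"
    by (intro integrable_const_bound[of _ 1]; simp add: indicator_def)+
  have "(\<integral>x. \<bar>indicator B x - \<psi> k x\<bar> \<partial>M) \<le> (\<integral>x. (indicator B x - indicator K x) + (\<psi> k x - indicator K x) \<partial>M)"
  proof (rule integral_mono)
    show "integrable M (\<lambda>x. \<bar>indicator B x - \<psi> k x\<bar>)" using int intK by (intro integrable_abs Bochner_Integration.integrable_diff)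
    show "integrable M (\<lambda>x. (indicator B x - indicator K x) + (\<psi> k x - indicator K x))"
      using int intK by (intro Bochner_Integration.integrable_add Bochner_Integration.integrable_diff)
    fix x
    have "x \<in> K \<Longrightarrow> \<psi> k x = 1" by (simp add: \<psi>_def)
    then show "\<bar>indicator B x - \<psi> k x\<bar> \<le> (indicator B x - indicator K x) + (\<psi> k x - indicator K x)"
      using K(1) bnd[of k x] by (auto simp: indicator_def)
  qed
  also have "\<dots> = (measure M B - measure M K) + ((\<integral>x. \<psi> k x \<partial>M) - measure M K)"
    using int intK by (simp add: sp)
  also have "\<dots> \<le> e" using k K(3) d by linarith
  finally show ?thesis
    using cont bnd lip by (intro exI[of _ "real k"] exI[of _ "\<psi> k"]) simp
qed

section \<open>Eigenmeasures on unit vectors\<close>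

text \<open>\<open>N\<close> stands for the measure on lines, transported to one unit vector per
  line. It need not be symmetric under u \<mapsto> -u, so the equation tests only functions constant
  on punctured lines. Values in \<open>ennreal\<close> free it from integrability
  conditions.\<close>

locale eigenmeasure =
  fixes \<mu> :: "(real^'n^'n) measure" and N :: "(real^'n) measure" and s \<kappa> :: real
  assumes mu_sets [measurable_cong]: "sets \<mu> = sets borel"
    and mu_prob: "prob_space \<mu>"
    and mu_invertible: "AE g in \<mu>. invertible g"
    and A1: "cond_A1 (Gamma \<mu>)"
    and N_sets [measurable_cong]: "sets N = sets borel"
    and N_prob: "prob_space N"
    and N_unit: "AE u in N. norm u = 1"
    and s_nonneg: "0 \<le> s"
    and kappa_pos: "0 < \<kappa>"
    and eigen: "F \<in> borel_measurable borel \<Longrightarrow> (\<And>c v. c \<noteq> 0 \<Longrightarrow> F (c *\<^sub>R v) = F v) \<Longrightarrow>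
      (\<integral>\<^sup>+g. \<integral>\<^sup>+u. ennreal (norm (g *v u) powr s) * F (g *v u) \<partial>N \<partial>\<mu>) = ennreal \<kappa> * (\<integral>\<^sup>+u. F u \<partial>N)"
begin

sublocale \<mu>: prob_space \<mu> by (rule mu_prob)
sublocale N: prob_space N by (rule N_prob)
sublocale P: pair_sigma_finite \<mu> N ..

lemma space_mu [simp]: "space \<mu> = UNIV"
  using sets_eq_imp_space_eq[OF mu_sets] by simp

lemma space_N [simp]: "space N = UNIV"
  using sets_eq_imp_space_eq[OF N_sets] by simp

lemma AE_nonzero: "AE u in N. u \<noteq> 0"
  using N_unit by eventually_elim auto

section \<open>Finite unions of proper subspaces cannot carry the measure\<close>

lemma Gamma_subsetI:
  assumes C: "C \<subseteq> GL" "closedin (top_of_set GL) C" "\<And>a b. a \<in> C \<Longrightarrow> b \<in> C \<Longrightarrow> a ** b \<in> C"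
    and ae: "AE g in \<mu>. g \<in> C"
  shows "Gamma \<mu> \<subseteq> C"
proof -
  have "supp_GL \<mu> \<subseteq> C"
  proof
    fix g assume g: "g \<in> supp_GL \<mu>"
    show "g \<in> C"
    proof (rule ccontr)
      assume "g \<notin> C"
      obtain T where T: "closed T" "C = GL \<inter> T" using C(2) by (auto simp: closedin_closed)
      have gGL: "g \<in> GL" using g by (simp add: supp_GL_def)
      then have "g \<in> - T" using \<open>g \<notin> C\<close> T by auto
      then obtain e where e: "e > 0" "ball g e \<subseteq> - T"
        using T(1) by (meson open_Compl open_contains_ball)
      have "AE h in \<mu>. h \<notin> ball g e" using ae by eventually_elim (use T e in auto)
      then have "emeasure \<mu> (ball g e) = 0"
        by (subst (asm) AE_iff_measurable[of "ball g e"]) (auto simp: mu_sets)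
      moreover have "emeasure \<mu> (ball g e) > 0" using g e by (simp add: supp_GL_def)
      ultimately show False by simp
    qed
  qed
  then show ?thesis unfolding Gamma_def using C by blast
qed

text \<open>For the indicator of the complement the right-hand side of the eigenmeasure equation is
  zero, while the weights on the left are positive at invertible matrices.\<close>

lemma AE_stable:
  assumes [measurable]: "A \<in> sets borel" and inv: "\<And>c v. c \<noteq> 0 \<Longrightarrow> c *\<^sub>R v \<in> A \<longleftrightarrow> v \<in> A"
    and ae: "AE u in N. u \<in> A"
  shows "AE g in \<mu>. AE u in N. g *v u \<in> A"
proof -
  define F :: "real^'n \<Rightarrow> ennreal" where "F = indicator (- A)"
  have [measurable]: "F \<in> borel_measurable borel" unfolding F_def by measurable
  have "(\<integral>\<^sup>+u. F u \<partial>N) = 0"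
    by (subst nn_integral_0_iff_AE) (use ae in \<open>auto simp: F_def indicator_def\<close>)
  moreover have "(\<integral>\<^sup>+g. \<integral>\<^sup>+u. ennreal (norm (g *v u) powr s) * F (g *v u) \<partial>N \<partial>\<mu>) = ennreal \<kappa> * (\<integral>\<^sup>+u. F u \<partial>N)"
    by (rule eigen) (auto simp: F_def indicator_def inv)
  ultimately have "(\<integral>\<^sup>+g. \<integral>\<^sup>+u. ennreal (norm (g *v u) powr s) * F (g *v u) \<partial>N \<partial>\<mu>) = 0"
    by simp
  then have "AE g in \<mu>. (\<integral>\<^sup>+u. ennreal (norm (g *v u) powr s) * F (g *v u) \<partial>N) = 0"
    by (subst (asm) nn_integral_0_iff_AE) measurable
  then show ?thesis
    using mu_invertible
  proof eventually_elim
    case (elim g)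
    then have "AE u in N. ennreal (norm (g *v u) powr s) * F (g *v u) = 0"
      by (subst (asm) nn_integral_0_iff_AE) measurable
    with AE_nonzero show ?case
    proof eventually_elim
      case (elim u)
      have "g *v u \<noteq> 0" using invertible_mult_nonzero \<open>invertible g\<close> elim(1) by blast
      then have "F (g *v u) = 0" using elim(2) by auto
      then show ?case by (auto simp: F_def indicator_def split: if_splits)
    qed
  qed
qed

definition reduced :: "(real^'n) set \<Rightarrow> bool" where
  "reduced V \<longleftrightarrow> subspace V \<and>
    \<not> (\<exists>\<W>. finite \<W> \<and> (\<forall>W\<in>\<W>. subspace W \<and> W \<subset> V) \<and> (AE u in N. u \<in> V \<longrightarrow> u \<in> \<Union>\<W>))"

lemma reduced_cover:
  assumes "subspace V"
  shows "\<exists>\<V>. finite \<V> \<and> (\<forall>W\<in>\<V>. reduced W \<and> W \<subseteq> V) \<and> (AE u in N. u \<in> V \<longrightarrow> u \<in> \<Union>\<V>)"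
  using assms
proof (induction "dim V" arbitrary: V rule: less_induct)
  case less
  show ?case
  proof (cases "reduced V")
    case True
    then show ?thesis by (intro exI[of _ "{V}"]) auto
  next
    case False
    then obtain \<W> where W: "finite \<W>" "\<And>W. W \<in> \<W> \<Longrightarrow> subspace W \<and> W \<subset> V" "AE u in N. u \<in> V \<longrightarrow> u \<in> \<Union>\<W>"
      using less.prems by (auto simp: reduced_def)
    have "\<exists>\<V>. finite \<V> \<and> (\<forall>W'\<in>\<V>. reduced W' \<and> W' \<subseteq> W) \<and> (AE u in N. u \<in> W \<longrightarrow> u \<in> \<Union>\<V>)" if "W \<in> \<W>" for W
      using W(2)[OF that] less.prems
      by (intro less.hyps dim_psubset) (auto simp: span_eq_iff[THEN iffD2])
    then obtain f where f: "\<And>W. W \<in> \<W> \<Longrightarrow> finite (f W) \<and> (\<forall>W'\<in>f W. reduced W' \<and> W' \<subseteq> W) \<and> (AE u in N. u \<in> W \<longrightarrow> u \<in> \<Union>(f W))"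
      by metis
    have "AE u in N. \<forall>W\<in>\<W>. u \<in> W \<longrightarrow> u \<in> \<Union>(f W)"
      using W(1) f by (intro AE_finite_allI) auto
    with W(3) have "AE u in N. u \<in> V \<longrightarrow> u \<in> \<Union>(\<Union>(f ` \<W>))"
      by eventually_elim blast
    moreover have "\<forall>W\<in>\<Union>(f ` \<W>). reduced W \<and> W \<subseteq> V"
      using f W(2) by blast
    moreover have "finite (\<Union>(f ` \<W>))" using W(1) f by auto
    ultimately show ?thesis by blast
  qed
qed

lemma subspace_scale_iff: "subspace V \<Longrightarrow> c \<noteq> 0 \<Longrightarrow> c *\<^sub>R v \<in> V \<longleftrightarrow> v \<in> V"
  by (metis subspace_scale divideR_right scaleR_one vector_fraction_eq_iff)

lemma closed_Union_subspaces:
  "finite \<V> \<Longrightarrow> (\<And>V. V \<in> \<V> \<Longrightarrow> subspace V) \<Longrightarrow> closed (\<Union>\<V> :: (real^'n) set)"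
  by (intro closed_Union) (auto intro: closed_subspace)

lemma irreducible_family:
  assumes fin: "finite \<V>" and ne: "\<V> \<noteq> {}"
    and sub: "\<And>V. V \<in> \<V> \<Longrightarrow> subspace V \<and> V \<noteq> UNIV \<and> V \<noteq> {0}"
    and ae: "AE g in \<mu>. (*v) g ` (\<Union>\<V>) \<subseteq> \<Union>\<V>"
  shows False
proof -
  let ?U = "\<Union>\<V>"
  have cl: "closed ?U" using closed_Union_subspaces fin sub by blast
  let ?C = "{g \<in> GL. (*v) g ` ?U \<subseteq> ?U}"
  have "Gamma \<mu> \<subseteq> ?C"
  proof (rule Gamma_subsetI)
    have "closed {g :: real^'n^'n. \<forall>u\<in>?U. g *v u \<in> ?U}"
    proof -
      have "closed ((\<lambda>g :: real^'n^'n. g *v u) -` ?U)" for u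
        using cl by (rule closed_vimage) (intro continuous_intros)
      then have "closed (\<Inter>u\<in>?U. (\<lambda>g :: real^'n^'n. g *v u) -` ?U)" by blast
      moreover have "(\<Inter>u\<in>?U. (\<lambda>g :: real^'n^'n. g *v u) -` ?U) = {g. \<forall>u\<in>?U. g *v u \<in> ?U}" by auto
      ultimately show ?thesis by simp
    qed
    moreover have "?C = GL \<inter> {g. \<forall>u\<in>?U. g *v u \<in> ?U}" by (auto simp: image_subset_iff)
    ultimately show "closedin (top_of_set GL) ?C" by (auto simp: closedin_closed)
    show "a ** b \<in> ?C" if "a \<in> ?C" "b \<in> ?C" for a b
    proof -
      have "a *v (b *v u) \<in> ?U" if u: "u \<in> ?U" for u
      proof -
        have "b *v u \<in> ?U" using u \<open>b \<in> ?C\<close> by blast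
        then show ?thesis using \<open>a \<in> ?C\<close> by blast
      qed
      then show ?thesis
        using that by (auto simp: GL_def invertible_mult image_subset_iff matrix_vector_mul_assoc[symmetric] simp del: Union_iff)
    qed
    show "AE g in \<mu>. g \<in> ?C"
      using ae mu_invertible by eventually_elim (simp add: GL_def)
  qed auto
  then have "\<forall>g\<in>Gamma \<mu>. (*v) g ` ?U \<subseteq> ?U" by blast
  with A1 fin ne sub show False unfolding cond_A1_def by blast
qed

text \<open>A cover can be refined to reduced subspaces. Almost every \<open>g\<close> sends each of
  these into a member of the family, so their union is invariant, against (A1).\<close>

lemma no_finite_cover:
  assumes fin: "finite \<V>" and sub: "\<And>V. V \<in> \<V> \<Longrightarrow> subspace V \<and> V \<noteq> UNIV" and cov: "AE u in N. u \<in> \<Union>\<V>"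
  shows False
proof -
  obtain f where f: "\<And>W. W \<in> \<V> \<Longrightarrow> finite (f W) \<and> (\<forall>W'\<in>f W. reduced W' \<and> W' \<subseteq> W) \<and> (AE u in N. u \<in> W \<longrightarrow> u \<in> \<Union>(f W))"
    using reduced_cover sub by metis
  define \<U> where "\<U> = \<Union>(f ` \<V>)"
  have "AE u in N. \<forall>W\<in>\<V>. u \<in> W \<longrightarrow> u \<in> \<Union>(f W)"
    using fin f by (intro AE_finite_allI) auto
  with cov have cU: "AE u in N. u \<in> \<Union>\<U>"
    by eventually_elim (use \<U>_def in blast)
  have finU: "finite \<U>" using fin f by (auto simp: \<U>_def)
  have redU: "reduced V" if "V \<in> \<U>" for V using that f by (auto simp: \<U>_def)
  then have subU: "subspace V" if "V \<in> \<U>" for V using that by (auto simp: reduced_def)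
  have propU: "V \<noteq> UNIV" if "V \<in> \<U>" for V
    using that f sub by (auto simp: \<U>_def) blast
  have "V \<noteq> {0}" if "V \<in> \<U>" for V
  proof
    assume "V = {0}"
    have "AE u in N. u \<in> V \<longrightarrow> u \<in> \<Union>{}"
      using AE_nonzero by eventually_elim (simp add: \<open>V = {0}\<close>)
    then have "\<not> reduced V" unfolding reduced_def by (metis empty_iff finite.emptyI)
    with redU that show False by blast
  qed
  moreover have "\<U> \<noteq> {}" using cU by auto
  moreover have "AE g in \<mu>. (*v) g ` \<Union>\<U> \<subseteq> \<Union>\<U>"
  proof -
    have "closed (\<Union>\<U>)" using closed_Union_subspaces finU subU by blast
    then have "AE g in \<mu>. AE u in N. g *v u \<in> \<Union>\<U>"
      using cU subU by (intro AE_stable) (auto simp: subspace_scale_iff)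
    then show ?thesis
    proof eventually_elim
      case (elim g)
      have "(*v) g ` V \<subseteq> \<Union>\<U>" if V: "V \<in> \<U>" for V
      proof -
        \<comment> \<open>The preimages cut \<open>V\<close> into finitely many subspaces that cover
          it up to a null set; as \<open>V\<close> is reduced, one of them is all of
          \<open>V\<close>.\<close>
        let ?W = "(\<lambda>W. V \<inter> (*v) g -` W) ` \<U>"
        have "AE u in N. u \<in> V \<longrightarrow> u \<in> \<Union>?W"
          using elim by eventually_elim auto
        moreover have "finite ?W" using finU by simp
        moreover have "\<forall>W\<in>?W. subspace W"
        proof (rule ballI, elim imageE)
          fix W W' assume "W' \<in> \<U>" "W = V \<inter> (*v) g -` W'"
          then show "subspace W"
            using subspace_inter[OF subU[OF V] linear_subspace_vimage[OF matrix_vector_mul_linear subU[of W'], of g]] by simp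
        qed
        moreover have "\<not> (\<exists>\<W>. finite \<W> \<and> (\<forall>W\<in>\<W>. subspace W \<and> W \<subset> V) \<and> (AE u in N. u \<in> V \<longrightarrow> u \<in> \<Union>\<W>))"
          using redU[OF V] by (simp add: reduced_def)
        ultimately have "\<not> (\<forall>W\<in>?W. W \<subset> V)" by meson
        then obtain W where "W \<in> \<U>" "\<not> V \<inter> (*v) g -` W \<subset> V" by blast
        then show ?thesis by blast
      qed
      then show ?case by blast
    qed
  qed
  ultimately show False
    using irreducible_family[OF finU] subU propU by blast
qed

lemma kernel_not_full:
  assumes "A \<noteq> (0 :: real^'n^'n)"
  shows "\<not> (AE u in N. A *v u = 0)"
proof
  assume ae: "AE u in N. A *v u = 0"
  have "{u. A *v u = 0} \<noteq> UNIV"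
    using assms by (auto simp: set_eq_iff) (metis matrix_eq matrix_vector_mult_0)
  moreover have "subspace {u. A *v u = 0}"
    by (auto simp: subspace_def algebra_simps)
  ultimately show False
    using no_finite_cover[of "{{u. A *v u = 0}}"] ae by auto
qed

text \<open>Since \<open>0 powr s = 0\<close> also for \<open>s = 0\<close>, vectors in the kernel of \<open>h\<close> never contribute.\<close>
definition part :: "(real^'n \<Rightarrow> real) \<Rightarrow> real^'n^'n \<Rightarrow> real" where
  "part f h = (\<integral>u. norm (h *v u) powr s * f (h *v u) \<partial>N)"

section \<open>Mass, moment and energy of the images, and their averages\<close>

definition mass :: "real^'n^'n \<Rightarrow> real" where
  "mass h = (\<integral>u. norm (h *v u) powr s \<partial>N)"

definition moment :: "real^'n^'n \<Rightarrow> real^'n^'n" where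
  "moment h = (\<integral>u. (norm (h *v u) powr s) *\<^sub>R outer (h *v u) \<partial>N)"

text \<open>Division by the mass, and not by its square, gives the same degree of homogeneity as
  \<open>mass\<close>. The quotient is convex in the pair of moment and mass, which is why its
  averages grow.\<close>

definition energy :: "real^'n^'n \<Rightarrow> real" where
  "energy h = (norm (moment h))\<^sup>2 / mass h"

definition barycenter :: "real^'n^'n \<Rightarrow> real^'n^'n" where
  "barycenter h = (1 / mass h) *\<^sub>R moment h"

lemma weight_le:
  fixes h :: "real^'n^'n"
  shows "norm u = 1 \<Longrightarrow> norm (h *v u) powr s \<le> norm h powr s"
  using norm_matrix_vector_le[of h u] s_nonneg by (intro powr_mono2) auto

lemma integrable_weight:
  fixes f :: "real^'n \<Rightarrow> 'b::{banach, second_countable_topology}" and h :: "real^'n^'n"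
  assumes [measurable]: "f \<in> borel_measurable borel" and B: "\<And>v. norm (f v) \<le> B"
  shows "integrable N (\<lambda>u. (norm (h *v u) powr s) *\<^sub>R f (h *v u))"
proof (rule N.integrable_const_bound[of _ "norm h powr s * B"])
  show "AE u in N. norm ((norm (h *v u) powr s) *\<^sub>R f (h *v u)) \<le> norm h powr s * B"
    using N_unit
  proof eventually_elim
    case (elim u)
    then show ?case using mult_mono[OF weight_le[OF elim, of h] B[of "h *v u"]] by simp
  qed
qed measurable

lemma integrable_part:
  fixes h :: "real^'n^'n"
  assumes "f \<in> borel_measurable borel" "\<And>v. \<bar>f v\<bar> \<le> B"
  shows "integrable N (\<lambda>u. norm (h *v u) powr s * f (h *v u))"
  using integrable_weight[of f B h] assms by simp

lemma integrable_mass: "integrable N (\<lambda>u. norm (h *v u) powr s)" for h :: "real^'n^'n"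
  using integrable_part[of "\<lambda>_. 1" 1 h] by simp

lemma integrable_moment: "integrable N (\<lambda>u. (norm (h *v u) powr s) *\<^sub>R outer (h *v u))" for h :: "real^'n^'n"
  by (rule integrable_weight[where B = 1]) (auto simp: norm_outer_le)

lemma borel_measurable_part [measurable]:
  assumes [measurable]: "f \<in> borel_measurable borel"
  shows "part f \<in> borel_measurable borel"
  unfolding part_def by (rule N.borel_measurable_lebesgue_integral) measurable

lemma borel_measurable_mass [measurable]: "mass \<in> borel_measurable borel"
  unfolding mass_def by (rule N.borel_measurable_lebesgue_integral) measurable

lemma borel_measurable_moment [measurable]: "moment \<in> borel_measurable borel"
  unfolding moment_def by (rule N.borel_measurable_lebesgue_integral) measurable

lemma borel_measurable_energy [measurable]: "energy \<in> borel_measurable borel"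
  unfolding energy_def by measurable

lemma part_1: "part (\<lambda>_. 1) = mass"
  by (simp add: part_def mass_def fun_eq_iff)

lemma mass_nonneg: "0 \<le> mass h"
  unfolding mass_def by simp

lemma mass_one: "mass (mat 1) = 1"
proof -
  have "mass (mat 1) = (\<integral>u. 1 \<partial>N)"
    unfolding mass_def using N_unit by (intro integral_cong_AE) auto
  then show ?thesis using N.prob_space by simp
qed

lemma norm_moment_le: "norm (moment h) \<le> mass h"
proof -
  have "norm (moment h) \<le> (\<integral>u. norm ((norm (h *v u) powr s) *\<^sub>R outer (h *v u)) \<partial>N)"
    unfolding moment_def by (rule integral_norm_bound)
  also have "\<dots> \<le> mass h"
    unfolding mass_def
    by (intro integral_mono integrable_norm integrable_moment integrable_mass) (simp add: mult_left_le norm_outer_le)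
  finally show ?thesis .
qed

lemma energy_nonneg: "0 \<le> energy h"
  by (simp add: energy_def mass_nonneg)

lemma energy_le_mass: "energy h \<le> mass h"
proof (cases "mass h = 0")
  case False
  then have "mass h > 0" using mass_nonneg[of h] by simp
  moreover have "(norm (moment h))\<^sup>2 \<le> (mass h)\<^sup>2"
    using norm_moment_le by (intro power_mono) auto
  ultimately show ?thesis by (simp add: energy_def divide_le_eq power2_eq_square)
qed (simp add: energy_def)

lemma part_inner: "part (\<lambda>v. outer v \<bullet> t) h = moment h \<bullet> t"
proof -
  have "part (\<lambda>v. outer v \<bullet> t) h = (\<integral>u. ((norm (h *v u) powr s) *\<^sub>R outer (h *v u)) \<bullet> t \<partial>N)"
    unfolding part_def by simp
  also have "\<dots> = moment h \<bullet> t"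
    unfolding moment_def by (rule integral_inner_left[OF integrable_moment])
  finally show ?thesis .
qed

lemma part_add:
  assumes "f \<in> borel_measurable borel" "\<And>v. \<bar>f v\<bar> \<le> B"
  shows "part (\<lambda>v. f v + b) h = part f h + b * mass h"
proof -
  have "part (\<lambda>v. f v + b) h = (\<integral>u. norm (h *v u) powr s * f (h *v u) + b * norm (h *v u) powr s \<partial>N)"
    by (simp add: part_def algebra_simps)
  also have "\<dots> = part f h + b * mass h"
    unfolding part_def mass_def
    by (subst Bochner_Integration.integral_add) (auto intro: integrable_part[OF assms] integrable_mass)
  finally show ?thesis .
qed

text \<open>Insert F(v) = (|h v| / |v|)^s f(h v), which is constant on punctured lines; the factor
  |g u|^s turns F(g u) into the integrand belonging to \<open>h ** g\<close>.\<close>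

lemma part_martingale_nn:
  assumes [measurable]: "f \<in> borel_measurable borel" and B: "\<And>v. 0 \<le> f v" "\<And>v. f v \<le> B" 
    and inv: "\<And>c v. c \<noteq> 0 \<Longrightarrow> f (c *\<^sub>R v) = f v"
  shows "(\<integral>\<^sup>+g. ennreal (part f (h ** g)) \<partial>\<mu>) = ennreal \<kappa> * ennreal (part f h)"
proof -
  define F where "F v = ennreal ((norm (h *v v) / norm v) powr s * f (h *v v))" for v
  have [measurable]: "F \<in> borel_measurable borel" unfolding F_def by measurable
  have Fc: "F (c *\<^sub>R v) = F v" if "c \<noteq> 0" for c v
    using that by (simp add: F_def matrix_vector_mult_scaleR inv)
  have B': "\<bar>f v\<bar> \<le> B" for v using B by simp
  have pt: "ennreal (part f k) = (\<integral>\<^sup>+u. ennreal (norm (k *v u) powr s * f (k *v u)) \<partial>N)" for k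
    unfolding part_def using B by (intro nn_integral_eq_integral[symmetric] integrable_part[of f B]) auto
  have eq: "ennreal (norm (g *v u) powr s) * F (g *v u) = ennreal (norm ((h ** g) *v u) powr s * f ((h ** g) *v u))" for g u
    using B by (simp add: F_def ennreal_mult[symmetric] matrix_vector_mul_assoc[symmetric] powr_divide)
  have "(\<integral>\<^sup>+g. ennreal (part f (h ** g)) \<partial>\<mu>) = ennreal \<kappa> * (\<integral>\<^sup>+u. F u \<partial>N)"
    unfolding pt eq[symmetric] by (rule eigen) (simp_all add: Fc)
  also have "(\<integral>\<^sup>+u. F u \<partial>N) = ennreal (part f h)"
    unfolding pt by (rule nn_integral_cong_AE, use N_unit in eventually_elim) (simp add: F_def)
  finally show ?thesis .
qed

lemma part_martingale:
  assumes f [measurable]: "f \<in> borel_measurable borel" and B: "\<And>v. \<bar>f v\<bar> \<le> B"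
    and inv: "\<And>c v. c \<noteq> 0 \<Longrightarrow> f (c *\<^sub>R v) = f v"
  shows "integrable \<mu> (\<lambda>g. part f (h ** g))" "(\<integral>g. part f (h ** g) \<partial>\<mu>) = \<kappa> * part f h"
proof -
  have main: "integrable \<mu> (\<lambda>g. part k (h ** g)) \<and> (\<integral>g. part k (h ** g) \<partial>\<mu>) = \<kappa> * part k h"
    if [measurable]: "k \<in> borel_measurable borel" and k: "\<And>v. 0 \<le> k v" "\<And>v. k v \<le> C" "\<And>c v. c \<noteq> 0 \<Longrightarrow> k (c *\<^sub>R v) = k v"
    for k :: "real^'n \<Rightarrow> real" and C :: real
  proof -
    have nn: "0 \<le> part k g" for g unfolding part_def using k by simp
    note e = part_martingale_nn[of k C h] k
    have int: "integrable \<mu> (\<lambda>g. part k (h ** g))"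
      by (rule integrableI_nonneg) (use e nn in \<open>auto simp: ennreal_mult_less_top\<close>)
    then have "ennreal (\<integral>g. part k (h ** g) \<partial>\<mu>) = (\<integral>\<^sup>+g. ennreal (part k (h ** g)) \<partial>\<mu>)"
      using nn by (intro nn_integral_eq_integral[symmetric]) auto
    also have "\<dots> = ennreal (\<kappa> * part k h)"
      using e kappa_pos nn by (simp add: ennreal_mult)
    finally show ?thesis using int kappa_pos nn by (simp add: integral_nonneg_AE)
  qed
  \<comment> \<open>Adding the bound \<open>B\<close> makes the function nonnegative; what is added
    is a multiple of the mass, which satisfies the same identity.\<close>
  have *: "part f = (\<lambda>g. part (\<lambda>v. f v + B) g - B * mass g)"
    using part_add[OF f B] by auto
  have 1: "integrable \<mu> (\<lambda>g. part (\<lambda>v. f v + B) (h ** g)) \<and> (\<integral>g. part (\<lambda>v. f v + B) (h ** g) \<partial>\<mu>) = \<kappa> * part (\<lambda>v. f v + B) h"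
  proof (rule main)
    show "0 \<le> f v + B" "f v + B \<le> 2 * B" for v using B[of v] by auto
    show "f (c *\<^sub>R v) + B = f v + B" if "c \<noteq> 0" for c v using inv[OF that] by simp
  qed measurable
  have 2: "integrable \<mu> (\<lambda>g. mass (h ** g)) \<and> (\<integral>g. mass (h ** g) \<partial>\<mu>) = \<kappa> * mass h"
    using main[of "\<lambda>_. 1" 1] by (simp add: part_1)
  show "integrable \<mu> (\<lambda>g. part f (h ** g))" unfolding * using 1 2 by auto
  show "(\<integral>g. part f (h ** g) \<partial>\<mu>) = \<kappa> * part f h" unfolding * using 1 2 by (simp add: algebra_simps)
qed

lemma mass_martingale: "integrable \<mu> (\<lambda>g. mass (h ** g))" "(\<integral>g. mass (h ** g) \<partial>\<mu>) = \<kappa> * mass h"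
  using part_martingale[of "\<lambda>_. 1" 1 h] by (simp_all add: part_1)

lemma moment_martingale:
  "integrable \<mu> (\<lambda>g. moment (h ** g) \<bullet> t)" "(\<integral>g. moment (h ** g) \<bullet> t \<partial>\<mu>) = \<kappa> * (moment h \<bullet> t)"
proof -
  have "\<bar>outer v \<bullet> t\<bar> \<le> norm t" for v
    using Cauchy_Schwarz_ineq2[of "outer v" t] norm_outer_le[of v]
    by (meson mult_left_le_one_le norm_ge_zero order_trans)
  note part_martingale[where f = "\<lambda>v. outer v \<bullet> t" and B = "norm t", of h, unfolded part_inner, OF _ this]
  then show "integrable \<mu> (\<lambda>g. moment (h ** g) \<bullet> t)" "(\<integral>g. moment (h ** g) \<bullet> t \<partial>\<mu>) = \<kappa> * (moment h \<bullet> t)"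
    by auto
qed

lemma integrable_energy: "integrable \<mu> (\<lambda>g. energy (h ** g))"
  by (rule Bochner_Integration.integrable_bound[OF mass_martingale(1)[of h]])
    (auto simp: energy_nonneg mass_nonneg energy_le_mass)

lemma energy_defect_pointwise:
  "mass k * (norm (barycenter k - t))\<^sup>2 = energy k - 2 * (moment k \<bullet> t) + (norm t)\<^sup>2 * mass k"
proof (cases "mass k = 0")
  case True
  then have "moment k = 0" using norm_moment_le[of k] by simp
  then show ?thesis using True by (simp add: energy_def)
next
  case False
  have "mass k * (norm (barycenter k - t))\<^sup>2 = mass k * ((barycenter k - t) \<bullet> (barycenter k - t))"
    by (simp add: power2_norm_eq_inner)
  also have "\<dots> = mass k * (barycenter k \<bullet> barycenter k) - 2 * (mass k * (barycenter k \<bullet> t)) + mass k * (t \<bullet> t)"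
    by (simp add: inner_diff_left inner_diff_right inner_commute algebra_simps)
  also have "mass k * (barycenter k \<bullet> t) = moment k \<bullet> t"
    using False by (simp add: barycenter_def)
  also have "mass k * (barycenter k \<bullet> barycenter k) = energy k"
    using False by (simp add: barycenter_def energy_def power2_norm_eq_inner)
  finally show ?thesis by (simp add: power2_norm_eq_inner mult.commute)
qed

text \<open>Average the expanded square with t the barycenter of \<open>h\<close>. Mass and moment
  are martingales, so the growth of the energy is exactly a weighted variance of barycenters;
  without growth the barycenter is frozen.\<close>

lemma energy_defect:
  "integrable \<mu> (\<lambda>g. mass (h ** g) * (norm (barycenter (h ** g) - barycenter h))\<^sup>2)"
  "(\<integral>g. mass (h ** g) * (norm (barycenter (h ** g) - barycenter h))\<^sup>2 \<partial>\<mu>)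
    = (\<integral>g. energy (h ** g) \<partial>\<mu>) - \<kappa> * energy h"
proof -
  let ?t = "barycenter h"
  note [simp] = mass_martingale moment_martingale integrable_energy
  show "integrable \<mu> (\<lambda>g. mass (h ** g) * (norm (barycenter (h ** g) - ?t))\<^sup>2)"
    unfolding energy_defect_pointwise by simp
  have "(\<integral>g. mass (h ** g) * (norm (barycenter (h ** g) - ?t))\<^sup>2 \<partial>\<mu>)
      = (\<integral>g. energy (h ** g) \<partial>\<mu>) - 2 * (\<kappa> * (moment h \<bullet> ?t)) + (norm ?t)\<^sup>2 * (\<kappa> * mass h)"
    unfolding energy_defect_pointwise by simp
  also have "moment h \<bullet> ?t = energy h"
    by (simp add: barycenter_def energy_def power2_norm_eq_inner)
  also have "(norm ?t)\<^sup>2 * (\<kappa> * mass h) = \<kappa> * energy h"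
    using norm_moment_le[of h]
    by (cases "mass h = 0") (auto simp: barycenter_def energy_def power_mult_distrib power_divide power2_eq_square)
  finally show "(\<integral>g. mass (h ** g) * (norm (barycenter (h ** g) - ?t))\<^sup>2 \<partial>\<mu>)
    = (\<integral>g. energy (h ** g) \<partial>\<mu>) - \<kappa> * energy h" by simp
qed

lemma mass_pos: "h \<noteq> 0 \<Longrightarrow> mass h > 0"
proof -
  assume "h \<noteq> 0"
  have "mass h \<noteq> 0"
  proof
    assume "mass h = 0"
    then have "AE u in N. norm (h *v u) powr s = 0"
      unfolding mass_def by (subst (asm) integral_nonneg_eq_0_iff_AE[OF integrable_mass]) auto
    then have "AE u in N. h *v u = 0" by eventually_elim simp
    with kernel_not_full \<open>h \<noteq> 0\<close> show False by blast
  qed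
  then show ?thesis using mass_nonneg[of h] by simp
qed

section \<open>The case s = 0: subspaces of positive mass\<close>

lemma subspace_sets [simp]: "subspace V \<Longrightarrow> V \<in> sets borel" for V :: "(real^'n) set"
  by (intro borel_closed closed_subspace)

lemma invertible_mat_1 [simp]: "invertible (mat 1 :: real^'n^'n)"
  unfolding invertible_def by (rule exI[of _ "mat 1"]) simp

lemma dim_psubspace: "subspace V \<Longrightarrow> subspace W \<Longrightarrow> V \<subset> W \<Longrightarrow> dim V < dim W" for V W :: "(real^'n) set"
  by (metis dim_psubset span_eq_iff)

text \<open>Distinct members meet in null sets, so their masses add up, and the total is at most
  1.\<close>

lemma finite_charged_subspaces:
  assumes null: "\<And>V W. subspace V \<Longrightarrow> subspace W \<Longrightarrow> dim V = r \<Longrightarrow> dim W = r \<Longrightarrow> V \<noteq> W \<Longrightarrow> measure N (V \<inter> W) = 0"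
    and e: "e > 0"
  shows "finite {V. subspace V \<and> dim V = r \<and> e \<le> measure N V}" (is "finite ?S")
proof (rule ccontr)
  assume "infinite ?S"
  obtain n :: nat where n: "1 / e < real n" using reals_Archimedean2 by blast
  obtain \<W> where W: "\<W> \<subseteq> ?S" "finite \<W>" "card \<W> = n"
    using infinite_arbitrarily_large[OF \<open>infinite ?S\<close>, of n] by blast
  have "measure N (\<Union>V\<in>\<W>. V) = (\<Sum>V\<in>\<W>. measure N V)"
  proof (rule measure_UNION_AE[OF W(2)])
    show "V \<in> fmeasurable N" if "V \<in> \<W>" for V
      using that W(1) by (auto simp: N.fmeasurable_eq_sets N_sets)
    show "pairwise (\<lambda>V W. AE x in N. x \<notin> V \<or> x \<notin> W) \<W>"
    proof (rule pairwiseI)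
      fix V W assume VW: "V \<in> \<W>" "W \<in> \<W>" "V \<noteq> W"
      then have sub: "subspace V" "subspace W" "dim V = r" "dim W = r" using W(1) by blast+
      then have "measure N (V \<inter> W) = 0" using null VW(3) by blast
      moreover have "V \<inter> W \<in> sets N" unfolding N_sets by (intro sets.Int subspace_sets sub)
      ultimately have "V \<inter> W \<in> null_sets N" by (intro null_setsI) (simp_all add: N.emeasure_eq_measure)
      then show "AE x in N. x \<notin> V \<or> x \<notin> W" using AE_not_in[of "V \<inter> W" N] by auto
    qed
  qed
  moreover have "real n * e \<le> (\<Sum>V\<in>\<W>. measure N V)"
    using sum_mono[of \<W> "\<lambda>_. e" "measure N"] W by auto
  moreover have "measure N (\<Union>V\<in>\<W>. V) \<le> 1" by (rule N.prob_le_1)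
  ultimately show False using n e by (simp add: field_simps)
qed

text \<open>Maximum principle: for \<open>s = 0\<close> the charged subspaces of least dimension and largest mass are
  finitely many and permuted by almost every matrix.\<close>
lemma kernel_null_zero:
  assumes s: "s = 0" and A: "A \<noteq> (0 :: real^'n^'n)"
  shows "AE u in N. A *v u \<noteq> 0"
proof (rule ccontr)
  assume nae: "\<not> (AE u in N. A *v u \<noteq> 0)"
  let ?K = "{u. A *v u = 0}"
  have subK: "subspace ?K" by (auto simp: subspace_def algebra_simps)
  have "measure N ?K \<noteq> 0"
  proof
    assume "measure N ?K = 0"
    then have "?K \<in> null_sets N" using subK by (intro null_setsI) (simp_all add: N.emeasure_eq_measure N_sets)
    from AE_not_in[OF this] nae show False by simp
  qed
  then have posK: "measure N ?K > 0" using measure_nonneg[of N ?K] by linarith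
  have properK: "?K \<noteq> UNIV"
  proof
    assume K: "?K = UNIV"
    have "x \<in> ?K" for x unfolding K by (rule UNIV_I)
    then have "\<forall>x. A *v x = 0 *v x" unfolding mem_Collect_eq matrix_vector_mult_0 by (rule allI)
    with A show False using matrix_eq[of A 0] by blast
  qed
  define P where "P d \<longleftrightarrow> (\<exists>V. subspace V \<and> dim V = d \<and> measure N V > 0)" for d
  \<comment> \<open>Minimality of the dimension makes the intersection of two distinct subspaces of
    dimension \<open>r\<close> null.\<close>
  define r where "r = (LEAST d. P d)"
  have "P (dim ?K)" unfolding P_def using subK posK by blast
  then have "P r" and r_le: "r \<le> dim ?K" unfolding r_def by (rule LeastI, rule Least_le)
  have min: "measure N V = 0" if "subspace V" "dim V < r" for V
  proof -
    have "\<not> P (dim V)" using that(2) unfolding r_def by (rule not_less_Least)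
    then have "\<not> measure N V > 0" using that(1) unfolding P_def by blast
    then show ?thesis using measure_nonneg[of N V] by linarith
  qed
  have "dim ?K < dim (UNIV :: (real^'n) set)"
    using properK by (intro dim_psubspace[OF subK subspace_UNIV]) blast
  then have r_less: "r < dim (UNIV :: (real^'n) set)" using r_le by simp
  have null: "measure N (V \<inter> W) = 0"
    if "subspace V" "subspace W" "dim V = r" "dim W = r" "V \<noteq> W" for V W
  proof (rule min)
    show sub: "subspace (V \<inter> W)" using that by (intro subspace_inter)
    have "V \<inter> W \<noteq> V"
    proof
      assume "V \<inter> W = V"
      then have "V = W" using that by (intro subspace_dim_equal) auto
      with that show False by blast
    qed
    then have "dim (V \<inter> W) < dim V"
      by (intro dim_psubspace[OF sub that(1)]) blast
    then show "dim (V \<inter> W) < r" using that by simp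
  qed
  obtain V0 where V0: "subspace V0" "dim V0 = r" "measure N V0 > 0" using \<open>P r\<close> unfolding P_def by blast
  \<comment> \<open>The lower bound by one positive mass makes the set finite, so the largest mass
    in dimension \<open>r\<close> is attained.\<close>
  define S where "S = {V. subspace V \<and> dim V = r \<and> measure N V0 \<le> measure N V}"
  have finS: "finite S" unfolding S_def by (rule finite_charged_subspaces[OF null V0(3)])
  have "V0 \<in> S" using V0 by (simp add: S_def)
  define m where "m = Max (measure N ` S)"
  have m_ge: "measure N V \<le> m" if "subspace V" "dim V = r" for V
  proof (cases "V \<in> S")
    case True then show ?thesis using finS by (simp add: m_def)
  next
    case False
    then have "measure N V \<le> measure N V0" using that by (auto simp: S_def)
    also have "\<dots> \<le> m" using finS \<open>V0 \<in> S\<close> by (simp add: m_def)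
    finally show ?thesis .
  qed
  define \<V> where "\<V> = {V \<in> S. measure N V = m}"
  have "m \<in> measure N ` S" unfolding m_def using finS \<open>V0 \<in> S\<close> by (intro Max_in) auto
  then have ne: "\<V> \<noteq> {}" by (auto simp: \<V>_def)
  have finV: "finite \<V>" using finS by (simp add: \<V>_def)
  have V: "subspace V" "dim V = r" "measure N V = m" if "V \<in> \<V>" for V
    using that by (auto simp: \<V>_def S_def)
  have m_pos: "m > 0" using m_ge[OF V0(1,2)] V0(3) by simp
  have VI: "V \<in> \<V>" if "subspace V" "dim V = r" "measure N V = m" for V
    using that m_ge[OF V0(1,2)] by (auto simp: \<V>_def S_def)
  have pre: "subspace ((*v) g -` V) \<and> dim ((*v) g -` V) = r" if "invertible g" "V \<in> \<V>" for g :: "real^'n^'n" and V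
  proof -
    obtain g' where g': "g ** g' = mat 1" "g' ** g = mat 1" using \<open>invertible g\<close> by (auto simp: invertible_def)
    have inv: "g *v (g' *v x) = x" "g' *v (g *v x) = x" for x
      by (simp_all add: matrix_vector_mul_assoc g')
    have eq: "(*v) g -` V = (*v) g' ` V"
    proof (intro set_eqI iffI)
      fix x assume "x \<in> (*v) g -` V"
      then have "g' *v (g *v x) \<in> (*v) g' ` V" by (intro imageI) simp
      then show "x \<in> (*v) g' ` V" by (simp only: inv)
    next
      fix x assume "x \<in> (*v) g' ` V"
      then show "x \<in> (*v) g -` V" by (elim imageE) (simp only: inv vimage_eq)
    qed
    have "dim ((*v) g' ` V) = dim V"
      by (rule dim_image_eq) (auto intro: inj_on_inverseI[of _ "(*v) g"] simp: inv)
    then show ?thesis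
      using V[OF that(2)] linear_subspace_vimage[OF matrix_vector_mul_linear, of V g] by (simp add: eq)
  qed
  have part: "part (indicator V) g = measure N ((*v) g -` V)" if "invertible g" "V \<in> \<V>" for g :: "real^'n^'n" and V
  proof -
    have [measurable]: "(*v) g -` V \<in> sets borel" using pre[OF that] by simp
    have "part (indicator V) g = (\<integral>u. indicator ((*v) g -` V) u \<partial>N)"
      unfolding part_def
    proof (rule integral_cong_AE)
      have [measurable]: "V \<in> sets borel" using V that by simp
      show "(\<lambda>u. norm (g *v u) powr s * indicator V (g *v u)) \<in> borel_measurable N" by measurable
      show "AE u in N. norm (g *v u) powr s * indicator V (g *v u) = indicat_real ((*v) g -` V) u"
        using AE_nonzero
      proof eventually_elim
        case (elim u)
        then show ?case using invertible_mult_nonzero[OF \<open>invertible g\<close>, of u] s by (simp add: indicator_def)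
      qed
    qed measurable
    then show ?thesis by simp
  qed
  \<comment> \<open>With s = 0 all weights are 1 at invertible matrices, so the mass is constantly 1
    and its martingale identity yields the eigenvalue.\<close>
  have kappa1: "\<kappa> = 1"
  proof -
    have "mass g = 1" if "invertible g" for g
    proof -
      have "mass g = (\<integral>u. 1 \<partial>N)"
        unfolding mass_def
        by (rule integral_cong_AE, measurable, use AE_nonzero in eventually_elim)
          (use invertible_mult_nonzero[OF that] s in auto)
      then show ?thesis using N.prob_space by simp
    qed
    then have "(\<integral>g. mass (mat 1 ** g) \<partial>\<mu>) = (\<integral>g. 1 \<partial>\<mu>)"
      by (intro integral_cong_AE, measurable, use mu_invertible in eventually_elim) simp
    then show ?thesis using mass_martingale(2)[of "mat 1"] \<mu>.prob_space by (simp add: mass_one)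
  qed
  have "AE g in \<mu>. (*v) g -` V \<in> \<V>" if VV: "V \<in> \<V>" for V
  proof -
    have [measurable]: "V \<in> sets borel" using V that by simp
    have "\<bar>indicat_real V v\<bar> \<le> 1" "c \<noteq> 0 \<Longrightarrow> indicat_real V (c *\<^sub>R v) = indicator V v" for c v
      using V(1)[OF VV] by (auto simp: indicator_def subspace_scale_iff)
    note pm = part_martingale[of "indicator V" 1 "mat 1", OF _ this, simplified]
    have int: "integrable \<mu> (part (indicator V))" and "(\<integral>g. part (indicator V) g \<partial>\<mu>) = part (indicator V) (mat 1)"
      using pm by (simp_all add: kappa1)
    moreover have "part (indicator V) (mat 1) = m"
      using part[OF invertible_mat_1 VV] V(3)[OF VV] by (simp add: vimage_def)
    \<comment> \<open>The mass of the preimage of \<open>V\<close> never exceeds \<open>m\<close>,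
      yet its mean over \<open>g\<close> is \<open>m\<close>; so it equals \<open>m\<close> almost
      surely.\<close>
    ultimately have "(\<integral>g. m - part (indicator V) g \<partial>\<mu>) = 0"
      using \<mu>.prob_space by simp
    moreover have le: "AE g in \<mu>. 0 \<le> m - part (indicator V) g"
      using mu_invertible by eventually_elim (use part m_ge pre VV in auto)
    ultimately have "AE g in \<mu>. m - part (indicator V) g = 0"
      using int by (subst (asm) integral_nonneg_eq_0_iff_AE) auto
    then show ?thesis using mu_invertible
      by eventually_elim (use part pre VV VI in auto)
  qed
  then have "AE g in \<mu>. \<forall>V\<in>\<V>. (*v) g -` V \<in> \<V>" by (intro AE_finite_allI finV)
  then have stable: "AE g in \<mu>. (*v) g ` \<Union>\<V> \<subseteq> \<Union>\<V>" using mu_invertible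
  proof eventually_elim
    case (elim g)
    have "surj ((*v) g)" using \<open>invertible g\<close> by (simp add: invertible_eq_bij bij_def)
    \<comment> \<open>An injective self-map of a finite family is onto, so each member is the
      preimage of another one and is sent into it by \<open>g\<close>.\<close>
    then have "inj_on (\<lambda>V. (*v) g -` V) \<V>" by (auto intro!: inj_onI) (metis surj_image_vimage_eq)+
    then have surj: "(\<lambda>V. (*v) g -` V) ` \<V> = \<V>" using finV elim by (intro endo_inj_surj) auto
    have "(*v) g ` W \<subseteq> \<Union>\<V>" if W: "W \<in> \<V>" for W
    proof -
      obtain V where "V \<in> \<V>" "W = (*v) g -` V" using W surj by blast
      then show ?thesis by blast
    qed
    then show ?case by blast
  qed
  have proper: "subspace V \<and> V \<noteq> UNIV \<and> V \<noteq> {0}" if "V \<in> \<V>" for V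
  proof -
    have "emeasure N {0} = 0"
      using AE_nonzero by (subst (asm) AE_iff_measurable[of "{0}"]) (simp_all add: N_sets)
    then have "measure N {0} = 0" by (simp add: measure_def)
    then have "measure N V \<noteq> measure N {0}" using V(3)[OF that] m_pos by linarith
    moreover have "dim V \<noteq> dim (UNIV :: (real^'n) set)" using V(2)[OF that] r_less by linarith
    ultimately show ?thesis using V(1)[OF that] by metis
  qed
  show False by (rule irreducible_family[OF finV ne proper stable])
qed

section \<open>Continuity at singular limit matrices, and scaling\<close>

lemma zero_case: "s > 0 \<or> (\<forall>A :: real^'n^'n. A \<noteq> 0 \<longrightarrow> (AE u in N. A *v u \<noteq> 0))"
proof (cases "s = 0")
  case True
  show ?thesis by (intro disjI2 allI impI kernel_null_zero[OF True]) assumption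
qed (use s_nonneg in simp)

text \<open>The limit \<open>A\<close> may be singular. On its kernel \<open>f\<close> need not be
  continuous, but there either s > 0 and the weights tend to 0, or the kernel is null by
  \<open>zero_case\<close>.\<close>

lemma weight_tendsto:
  fixes f :: "real^'n \<Rightarrow> 'b::{banach, second_countable_topology}" and h :: "nat \<Rightarrow> real^'n^'n"
  assumes [measurable]: "f \<in> borel_measurable borel" and cont: "continuous_on (- {0}) f"
    and B: "\<And>v. norm (f v) \<le> B" and h: "h \<longlonglongrightarrow> A" and A: "A \<noteq> 0"
  shows "(\<lambda>n. \<integral>u. (norm (h n *v u) powr s) *\<^sub>R f (h n *v u) \<partial>N) \<longlonglongrightarrow> (\<integral>u. (norm (A *v u) powr s) *\<^sub>R f (A *v u) \<partial>N)"
proof -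
  have "Bseq h" using h by (intro convergent_imp_Bseq) (auto simp: convergent_def)
  then obtain K where K: "K > 0" "\<And>n. norm (h n) \<le> K" by (auto simp: Bseq_def)
  have Kp: "norm (h n) powr s \<le> K powr s" for n using K s_nonneg by (intro powr_mono2) auto
  show ?thesis
  proof (rule integral_dominated_convergence[where w = "\<lambda>_. K powr s * B"])
    show "AE u in N. norm ((norm (h n *v u) powr s) *\<^sub>R f (h n *v u)) \<le> K powr s * B" for n
      using N_unit
    proof eventually_elim
      case (elim u)
      show ?case
        using mult_mono[OF order_trans[OF weight_le[OF elim, of "h n"] Kp] B[of "h n *v u"]] by simp
    qed
    have "AE u in N. s > 0 \<or> A *v u \<noteq> 0" using zero_case A by auto
    then show "AE u in N. (\<lambda>n. (norm (h n *v u) powr s) *\<^sub>R f (h n *v u)) \<longlonglongrightarrow> (norm (A *v u) powr s) *\<^sub>R f (A *v u)"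
    proof eventually_elim
      case (elim u)
      have hu: "(\<lambda>n. h n *v u) \<longlonglongrightarrow> A *v u" by (intro tendsto_intros h)
      show ?case
      proof (cases "A *v u = 0")
        case False
        then have "isCont f (A *v u)"
          using cont by (subst (asm) continuous_on_eq_continuous_at) auto
        then have "(\<lambda>n. f (h n *v u)) \<longlonglongrightarrow> f (A *v u)" using hu by (rule isCont_tendsto_compose)
        moreover have "(\<lambda>n. norm (h n *v u) powr s) \<longlonglongrightarrow> norm (A *v u) powr s"
          using False by (intro tendsto_powr tendsto_norm hu tendsto_const) auto
        ultimately show ?thesis by (intro tendsto_scaleR)
      next
        case True
        then have sp: "s > 0" using elim by simp
        have "(\<lambda>n. norm (h n *v u)) \<longlonglongrightarrow> 0" using tendsto_norm[OF hu] True by simp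
        then have "(\<lambda>n. norm (h n *v u) powr s) \<longlonglongrightarrow> 0"
          using sp by (intro tendsto_zero_powrI[of _ _ _ s]) auto
        then have "(\<lambda>n. norm (h n *v u) powr s * B) \<longlonglongrightarrow> 0" by (rule tendsto_mult_left_zero)
        then have "(\<lambda>n. (norm (h n *v u) powr s) *\<^sub>R f (h n *v u)) \<longlonglongrightarrow> 0"
          by (rule Lim_null_comparison[rotated]) (intro always_eventually allI, simp add: mult_left_mono B)
        then show ?thesis using True by simp
      qed
    qed
  qed (simp_all, measurable)
qed

lemma mass_tendsto: "h \<longlonglongrightarrow> A \<Longrightarrow> A \<noteq> 0 \<Longrightarrow> (\<lambda>n. mass (h n)) \<longlonglongrightarrow> mass A"
  unfolding mass_def using weight_tendsto[of "\<lambda>_. 1 :: real" 1 h A] by simp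

lemma moment_tendsto: "h \<longlonglongrightarrow> A \<Longrightarrow> A \<noteq> 0 \<Longrightarrow> (\<lambda>n. moment (h n)) \<longlonglongrightarrow> moment A"
  unfolding moment_def
  using weight_tendsto[of "outer :: real^'n \<Rightarrow> _" 1 h A] by (simp add: norm_outer_le continuous_on_outer)

lemma energy_tendsto: "h \<longlonglongrightarrow> A \<Longrightarrow> A \<noteq> 0 \<Longrightarrow> (\<lambda>n. energy (h n)) \<longlonglongrightarrow> energy A"
  unfolding energy_def using mass_pos[of A]
  by (intro tendsto_divide tendsto_power tendsto_norm mass_tendsto moment_tendsto) auto

lemma barycenter_tendsto: "h \<longlonglongrightarrow> A \<Longrightarrow> A \<noteq> 0 \<Longrightarrow> (\<lambda>n. barycenter (h n)) \<longlonglongrightarrow> barycenter A"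
  unfolding barycenter_def using mass_pos[of A]
  by (intro tendsto_divide tendsto_scaleR tendsto_const mass_tendsto moment_tendsto) auto

lemma mass_scale: "mass (c *\<^sub>R h) = \<bar>c\<bar> powr s * mass h"
  unfolding mass_def by (simp add: scaleR_matrix_vector_assoc[symmetric] powr_mult)

lemma moment_scale: "c \<noteq> 0 \<Longrightarrow> moment (c *\<^sub>R h) = \<bar>c\<bar> powr s *\<^sub>R moment h"
proof -
  assume c: "c \<noteq> 0"
  have "norm ((c *\<^sub>R h) *v u) powr s *\<^sub>R outer ((c *\<^sub>R h) *v u)
      = \<bar>c\<bar> powr s *\<^sub>R (norm (h *v u) powr s *\<^sub>R outer (h *v u))" for u
    using c by (simp add: scaleR_matrix_vector_assoc[symmetric] powr_mult)
  then show ?thesis unfolding moment_def by (simp only: integral_scaleR_right)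
qed

lemma barycenter_scale: "c \<noteq> 0 \<Longrightarrow> barycenter (c *\<^sub>R h) = barycenter h"
  by (simp add: barycenter_def mass_scale moment_scale)

lemma energy_scale: "c \<noteq> 0 \<Longrightarrow> energy (c *\<^sub>R h) = \<bar>c\<bar> powr s * energy h"
  by (simp add: energy_def mass_scale moment_scale power_mult_distrib power2_eq_square)

subsection \<open>The energy of the normalized images\<close>

text \<open>The transition operator before normalization: it fixes \<open>mass\<close>. Conjugated
  by \<open>mass\<close> it is the Doob transform, that is, the walk h \<mapsto> h g reweighted by
  the total masses.\<close>

definition avg :: "(real^'n^'n \<Rightarrow> ennreal) \<Rightarrow> real^'n^'n \<Rightarrow> ennreal" where
  "avg F h = ennreal (1 / \<kappa>) * (\<integral>\<^sup>+g. F (h ** g) \<partial>\<mu>)"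

lemma borel_measurable_avg [measurable]:
  assumes [measurable]: "F \<in> borel_measurable borel"
  shows "avg F \<in> borel_measurable borel"
proof -
  have "(\<lambda>h. \<integral>\<^sup>+g. F (h ** g) \<partial>\<mu>) \<in> borel_measurable borel"
    by (rule \<mu>.borel_measurable_nn_integral) measurable
  then show ?thesis unfolding avg_def[abs_def] by measurable
qed

lemma borel_measurable_avg_iter [measurable]:
  "F \<in> borel_measurable borel \<Longrightarrow> (avg ^^ n) F \<in> borel_measurable borel"
  by (induction n) (auto intro: borel_measurable_avg)

lemma avg_add:
  assumes [measurable]: "F \<in> borel_measurable borel" "G \<in> borel_measurable borel"
  shows "avg (\<lambda>h. F h + G h) = (\<lambda>h. avg F h + avg G h)"
  by (simp add: avg_def fun_eq_iff nn_integral_add distrib_left)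

lemma avg_cmult:
  assumes [measurable]: "F \<in> borel_measurable borel"
  shows "avg (\<lambda>h. c * F h) = (\<lambda>h. c * avg F h)"
  by (simp add: avg_def fun_eq_iff nn_integral_cmult mult.left_commute)

lemma avg_iter_add:
  assumes "F \<in> borel_measurable borel" "G \<in> borel_measurable borel"
  shows "(avg ^^ n) (\<lambda>h. F h + G h) = (\<lambda>h. (avg ^^ n) F h + (avg ^^ n) G h)"
  by (induction n) (simp_all add: avg_add assms borel_measurable_avg_iter)

lemma avg_iter_cmult:
  assumes "F \<in> borel_measurable borel"
  shows "(avg ^^ n) (\<lambda>h. c * F h) = (\<lambda>h. c * (avg ^^ n) F h)"
  by (induction n) (simp_all add: avg_cmult assms borel_measurable_avg_iter)

text \<open>Started at an invertible matrix, the walk stays among invertible ones almost surely, so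
  the comparison is required only there.\<close>

lemma avg_iter_mono:
  assumes "\<And>h. invertible h \<Longrightarrow> F h \<le> G h" "invertible h"
  shows "(avg ^^ n) F h \<le> (avg ^^ n) G h"
  using assms(2)
proof (induction n arbitrary: h)
  case (Suc n)
  have "(\<integral>\<^sup>+g. (avg ^^ n) F (h ** g) \<partial>\<mu>) \<le> (\<integral>\<^sup>+g. (avg ^^ n) G (h ** g) \<partial>\<mu>)"
    by (rule nn_integral_mono_AE, use mu_invertible in eventually_elim)
      (intro Suc.IH invertible_mult Suc.prems)
  then have "avg ((avg ^^ n) F) h \<le> avg ((avg ^^ n) G) h"
    unfolding avg_def[of "(avg ^^ n) F"] avg_def[of "(avg ^^ n) G"] by (rule mult_left_mono) simp
  then show ?case by simp
qed (use assms in simp)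

lemma avg_part:
  assumes "f \<in> borel_measurable borel" "\<And>v. 0 \<le> f v" "\<And>v. f v \<le> B" "\<And>c v. c \<noteq> 0 \<Longrightarrow> f (c *\<^sub>R v) = f v"
  shows "avg (\<lambda>h. ennreal (part f h)) = (\<lambda>h. ennreal (part f h))"
proof
  fix h
  have "0 \<le> part f h" unfolding part_def using assms(2) by simp
  then show "avg (\<lambda>h. ennreal (part f h)) h = ennreal (part f h)"
    using part_martingale_nn[OF assms, of h] kappa_pos
    by (simp add: avg_def ennreal_mult[symmetric])
qed

lemma avg_iter_part:
  assumes "f \<in> borel_measurable borel" "\<And>v. 0 \<le> f v" "\<And>v. f v \<le> B" "\<And>c v. c \<noteq> 0 \<Longrightarrow> f (c *\<^sub>R v) = f v"
  shows "(avg ^^ n) (\<lambda>h. ennreal (part f h)) = (\<lambda>h. ennreal (part f h))"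
  by (induction n) (simp_all add: avg_part[OF assms])

lemma avg_iter_mass: "(avg ^^ n) (\<lambda>h. ennreal (mass h)) = (\<lambda>h. ennreal (mass h))"
  using avg_iter_part[of "\<lambda>_. 1" 1 n] by (simp add: part_1)

definition energy_iter :: "nat \<Rightarrow> real^'n^'n \<Rightarrow> ennreal" where
  "energy_iter n = (avg ^^ n) (\<lambda>h. ennreal (energy h))"

text \<open>The least harmonic majorant of the energy. At the identity it is the limit of the mean
  energies of the walk.\<close>

definition energy_sup :: "real^'n^'n \<Rightarrow> ennreal" where
  "energy_sup h = (SUP n. energy_iter n h)"

lemma borel_measurable_energy_iter [measurable]: "energy_iter n \<in> borel_measurable borel"
  unfolding energy_iter_def by measurable

lemma borel_measurable_energy_sup [measurable]: "energy_sup \<in> borel_measurable borel"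
  unfolding energy_sup_def[abs_def] by measurable

lemma energy_iter_Suc: "energy_iter (Suc n) = avg (energy_iter n)"
  by (simp add: energy_iter_def)

lemma energy_iter_0: "energy_iter 0 h = ennreal (energy h)"
  by (simp add: energy_iter_def)

lemma avg_energy: "avg (\<lambda>h. ennreal (energy h)) h = ennreal (1 / \<kappa> * (\<integral>g. energy (h ** g) \<partial>\<mu>))"
  using kappa_pos
  by (simp add: avg_def nn_integral_eq_integral[OF integrable_energy] energy_nonneg integral_nonneg_AE flip: ennreal_mult)

lemma energy_le_avg: "ennreal (energy h) \<le> avg (\<lambda>h. ennreal (energy h)) h"
proof -
  have "0 \<le> (\<integral>g. mass (h ** g) * (norm (barycenter (h ** g) - barycenter h))\<^sup>2 \<partial>\<mu>)"
    by (simp add: mass_nonneg)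
  then have "\<kappa> * energy h \<le> (\<integral>g. energy (h ** g) \<partial>\<mu>)" by (simp add: energy_defect)
  then show ?thesis
    unfolding avg_energy using kappa_pos by (intro ennreal_leI) (simp add: field_simps)
qed

lemma avg_mono: "(\<And>h. F h \<le> G h) \<Longrightarrow> avg F h \<le> avg G h"
  unfolding avg_def by (intro mult_left_mono nn_integral_mono) auto

lemma incseq_energy_iter: "incseq (\<lambda>n. energy_iter n h)"
proof (rule incseq_SucI)
  fix n show "energy_iter n h \<le> energy_iter (Suc n) h"
  proof (induction n arbitrary: h)
    case 0 then show ?case using energy_le_avg by (simp add: energy_iter_def)
  next
    case (Suc n) then show ?case unfolding energy_iter_Suc[of "Suc n"] energy_iter_Suc[of n]
      by (intro avg_mono) (simp add: energy_iter_Suc)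
  qed
qed

lemma energy_iter_le_mass: "energy_iter n h \<le> ennreal (mass h)"
proof -
  have "energy_iter n h \<le> (avg ^^ n) (\<lambda>h. ennreal (mass h)) h"
    unfolding energy_iter_def
    by (induction n arbitrary: h) (auto intro!: avg_mono ennreal_leI energy_le_mass)
  then show ?thesis by (simp add: avg_iter_mass)
qed

lemma energy_sup_le_mass: "energy_sup h \<le> ennreal (mass h)"
  unfolding energy_sup_def by (intro SUP_least energy_iter_le_mass)

lemma energy_le_sup: "ennreal (energy h) \<le> energy_sup h"
  unfolding energy_sup_def energy_iter_0[symmetric] by (intro SUP_upper) simp

lemma avg_energy_sup: "avg energy_sup = energy_sup"
proof
  fix h :: "real^'n^'n"
  have inc: "incseq (\<lambda>n g. energy_iter n (h ** g))"
    using incseq_energy_iter by (auto simp: incseq_def le_fun_def)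
  have "avg energy_sup h = ennreal (1 / \<kappa>) * (SUP n. \<integral>\<^sup>+g. energy_iter n (h ** g) \<partial>\<mu>)"
    unfolding avg_def energy_sup_def
    by (subst nn_integral_monotone_convergence_SUP[OF inc]) auto
  also have "\<dots> = (SUP n. energy_iter (Suc n) h)"
    by (simp add: energy_iter_Suc avg_def SUP_mult_left_ennreal)
  also have "\<dots> = energy_sup h"
    unfolding energy_sup_def
  proof (rule antisym)
    show "(SUP n. energy_iter (Suc n) h) \<le> (SUP n. energy_iter n h)"
      by (intro SUP_least SUP_upper) simp
    show "(SUP n. energy_iter n h) \<le> (SUP n. energy_iter (Suc n) h)"
      using incseq_energy_iter[of h] by (intro SUP_mono) (auto simp: incseq_Suc_iff)
  qed
  finally show "avg energy_sup h = energy_sup h" .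
qed

lemma avg_iter_energy_sup: "(avg ^^ n) energy_sup = energy_sup"
  by (induction n) (simp_all add: avg_energy_sup)

lemma mult_invertible_nonzero: "B \<noteq> 0 \<Longrightarrow> invertible g \<Longrightarrow> B ** g \<noteq> (0 :: real^'n^'n)"
proof
  assume B: "B \<noteq> 0" and "invertible g" and 0: "B ** g = 0"
  then obtain g' where "g ** g' = mat 1" by (auto simp: invertible_def)
  then have "B = (B ** g) ** g'" by (simp add: matrix_mul_assoc[symmetric])
  then show False using B 0 by simp
qed

text \<open>Fatou passes lower semicontinuity from one iterate to the next. The start is continuous
  at nonzero matrices, and multiplication by an invertible \<open>g\<close> keeps the limit
  nonzero.\<close>

lemma energy_iter_lsc:
  assumes "h \<longlonglongrightarrow> A" "A \<noteq> 0"
  shows "energy_iter n A \<le> liminf (\<lambda>k. energy_iter n (h k))"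
  using assms
proof (induction n arbitrary: h A)
  case 0
  have "(\<lambda>k. ennreal (energy (h k))) \<longlonglongrightarrow> ennreal (energy A)"
    using energy_tendsto[OF 0] by (rule tendsto_ennrealI)
  then show ?case by (simp add: energy_iter_0 lim_imp_Liminf)
next
  case (Suc n)
  have "(\<integral>\<^sup>+g. energy_iter n (A ** g) \<partial>\<mu>) \<le> (\<integral>\<^sup>+g. liminf (\<lambda>k. energy_iter n (h k ** g)) \<partial>\<mu>)"
    by (rule nn_integral_mono_AE, use mu_invertible in eventually_elim)
      (intro Suc.IH tendsto_intros Suc.prems mult_invertible_nonzero)
  also have "\<dots> \<le> liminf (\<lambda>k. \<integral>\<^sup>+g. energy_iter n (h k ** g) \<partial>\<mu>)"
    by (rule nn_integral_liminf) measurable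
  finally have "energy_iter (Suc n) A \<le> ennreal (1 / \<kappa>) * liminf (\<lambda>k. \<integral>\<^sup>+g. energy_iter n (h k ** g) \<partial>\<mu>)"
    by (simp add: energy_iter_Suc avg_def mult_left_mono)
  also have "\<dots> = liminf (\<lambda>k. energy_iter (Suc n) (h k))"
    unfolding energy_iter_Suc avg_def
    by (rule Liminf_compose_continuous_mono[symmetric])
      (intro ennreal_continuous_on_cmult continuous_on_id, simp, simp add: mono_def mult_left_mono, simp)
  finally show ?case .
qed

lemma energy_sup_lsc:
  assumes "h \<longlonglongrightarrow> A" "A \<noteq> 0"
  shows "energy_sup A \<le> liminf (\<lambda>k. energy_sup (h k))"
  unfolding energy_sup_def[of A]
proof (rule SUP_least)
  fix n
  have "energy_iter n A \<le> liminf (\<lambda>k. energy_iter n (h k))" by (rule energy_iter_lsc[OF assms])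
  also have "\<dots> \<le> liminf (\<lambda>k. energy_sup (h k))"
    by (intro Liminf_mono always_eventually allI) (auto simp: energy_sup_def intro: SUP_upper)
  finally show "energy_iter n A \<le> liminf (\<lambda>k. energy_sup (h k))" .
qed

lemma energy_sup_scale:
  assumes "c \<noteq> 0"
  shows "energy_sup (c *\<^sub>R h) = ennreal (\<bar>c\<bar> powr s) * energy_sup h"
proof -
  have "energy_iter n (c *\<^sub>R h) = ennreal (\<bar>c\<bar> powr s) * energy_iter n h" for n
  proof (induction n arbitrary: h)
    case 0
    then show ?case using assms by (simp add: energy_iter_0 energy_scale ennreal_mult energy_nonneg)
  next
    case (Suc n)
    then show ?case
      by (simp add: energy_iter_Suc avg_def nn_integral_cmult mult.left_commute flip: scalar_matrix_assoc)
  qed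
  then show ?thesis by (simp add: energy_sup_def SUP_mult_left_ennreal)
qed

text \<open>Where the energy equals its harmonic majorant, its mean cannot grow in one step, so the
  variance of the barycenters vanishes. Energy and majorant then also have equal finite means over
  \<open>B ** g\<close>, hence agree there almost surely, and the property propagates.\<close>

lemma harmonic_energy_step:
  assumes B: "B \<noteq> 0" "energy_sup B \<le> ennreal (energy B)"
  shows "AE g in \<mu>. B ** g \<noteq> 0 \<and> energy_sup (B ** g) \<le> ennreal (energy (B ** g)) \<and> barycenter (B ** g) = barycenter B"
proof -
  have le: "avg energy_sup B \<le> ennreal (energy B)" using B by (simp add: avg_energy_sup)
  have "avg (\<lambda>h. ennreal (energy h)) B \<le> ennreal (energy B)"
    by (rule order_trans[OF avg_mono[OF energy_le_sup] le])
  then have "(\<integral>g. energy (B ** g) \<partial>\<mu>) \<le> \<kappa> * energy B"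
    using kappa_pos energy_nonneg[of B] by (simp add: avg_energy ennreal_le_iff field_simps)
  then have "(\<integral>g. mass (B ** g) * (norm (barycenter (B ** g) - barycenter B))\<^sup>2 \<partial>\<mu>) = 0"
  proof -
    have "0 \<le> (\<integral>g. mass (B ** g) * (norm (barycenter (B ** g) - barycenter B))\<^sup>2 \<partial>\<mu>)"
      by (simp add: mass_nonneg)
    with \<open>(\<integral>g. energy (B ** g) \<partial>\<mu>) \<le> \<kappa> * energy B\<close> show ?thesis
      using energy_defect(2)[of B] by linarith
  qed
  then have 1: "AE g in \<mu>. mass (B ** g) * (norm (barycenter (B ** g) - barycenter B))\<^sup>2 = 0"
    by (subst (asm) integral_nonneg_eq_0_iff_AE[OF energy_defect(1)]) (auto simp: mass_nonneg)
  have up: "(\<integral>\<^sup>+g. energy_sup (B ** g) \<partial>\<mu>) \<le> (\<integral>\<^sup>+g. ennreal (energy (B ** g)) \<partial>\<mu>)"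
  proof -
    have "avg energy_sup B \<le> avg (\<lambda>h. ennreal (energy h)) B"
      by (rule order_trans[OF le energy_le_avg])
    then show ?thesis using kappa_pos
      unfolding avg_def by (subst (asm) ennreal_mult_le_mult_iff) simp_all
  qed
  have fin: "(\<integral>\<^sup>+g. ennreal (energy (B ** g)) \<partial>\<mu>) < \<infinity>"
    by (simp add: nn_integral_eq_integral[OF integrable_energy] energy_nonneg)
  have "(\<integral>\<^sup>+g. energy_sup (B ** g) - ennreal (energy (B ** g)) \<partial>\<mu>)
      = (\<integral>\<^sup>+g. energy_sup (B ** g) \<partial>\<mu>) - (\<integral>\<^sup>+g. ennreal (energy (B ** g)) \<partial>\<mu>)"
    using fin by (intro nn_integral_diff) (auto simp: energy_le_sup)
  also have "\<dots> = 0"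
    using up le_less_trans[OF up fin] by (intro diff_eq_0_ennreal) simp_all
  finally have "AE g in \<mu>. energy_sup (B ** g) - ennreal (energy (B ** g)) = 0"
    by (subst (asm) nn_integral_0_iff_AE) measurable
  with 1 mu_invertible show ?thesis
  proof eventually_elim
    case (elim g)
    have nz: "B ** g \<noteq> 0" using elim(2) B(1) by (intro mult_invertible_nonzero)
    then have "mass (B ** g) \<noteq> 0" using mass_pos by force
    then have "barycenter (B ** g) = barycenter B" using elim(1) by simp
    moreover have "energy_sup (B ** g) \<le> ennreal (energy (B ** g))"
      using elim(3) by (auto simp: diff_eq_0_iff_ennreal)
    ultimately show ?case using nz by blast
  qed
qed

section \<open>From almost every matrix to the whole semigroup\<close>

lemma Gamma_GL: "Gamma \<mu> \<subseteq> GL"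
proof -
  have "a ** b \<in> GL" if "a \<in> GL" "b \<in> GL" for a b :: "real^'n^'n"
    using that by (simp add: GL_def invertible_mult)
  then show ?thesis unfolding Gamma_def by (intro Inter_lower) (auto simp: supp_GL_def)
qed

lemma Gamma_mult: "a \<in> Gamma \<mu> \<Longrightarrow> b \<in> Gamma \<mu> \<Longrightarrow> a ** b \<in> Gamma \<mu>"
  unfolding Gamma_def by blast

text \<open>The majorant is lower semicontinuous and the energy continuous, so their equality is a
  closed condition at nonzero matrices.\<close>

lemma harmonic_energy_limit:
  assumes B: "\<And>k :: nat. B k \<noteq> 0 \<and> energy_sup (B k) \<le> ennreal (energy (B k)) \<and> barycenter (B k) = t"
    and lim: "B \<longlonglongrightarrow> C" "C \<noteq> 0"
  shows "energy_sup C \<le> ennreal (energy C) \<and> barycenter C = t"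
proof
  have "energy_sup C \<le> liminf (\<lambda>k. energy_sup (B k))" by (rule energy_sup_lsc[OF lim])
  also have "\<dots> \<le> liminf (\<lambda>k. ennreal (energy (B k)))"
    using B by (intro Liminf_mono always_eventually allI) simp
  also have "\<dots> = ennreal (energy C)"
    using tendsto_ennrealI[OF energy_tendsto[OF lim]] by (intro lim_imp_Liminf) simp_all
  finally show "energy_sup C \<le> ennreal (energy C)" .
  have "(\<lambda>k. barycenter (B k)) \<longlonglongrightarrow> barycenter C" by (rule barycenter_tendsto[OF lim])
  then show "barycenter C = t" using B by (simp add: LIMSEQ_const_iff)
qed

text \<open>The invertible matrices that preserve \<open>H\<close> under right multiplication form a
  relatively closed semigroup of full measure, and such a semigroup contains
  \<open>Gamma \<mu>\<close>.\<close>

lemma harmonic_energy_Gamma: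
  assumes A: "A \<noteq> 0" "energy_sup A \<le> ennreal (energy A)" and g: "\<gamma> \<in> Gamma \<mu>"
  shows "barycenter (A ** \<gamma>) = barycenter A"
proof -
  define H where "H = {B. B \<noteq> 0 \<and> energy_sup B \<le> ennreal (energy B) \<and> barycenter B = barycenter A}"
  define S where "S = {g \<in> GL. \<forall>B\<in>H. B ** g \<in> H}"
  have lim: "C \<in> H" if "\<And>k. B k \<in> H" "B \<longlonglongrightarrow> C" "C \<noteq> 0" for B :: "nat \<Rightarrow> real^'n^'n" and C
    using harmonic_energy_limit[of B "barycenter A" C] that by (simp add: H_def)
  have "Gamma \<mu> \<subseteq> S"
  proof (rule Gamma_subsetI)
    show "S \<subseteq> GL" by (simp add: S_def)
    show "a ** b \<in> S" if "a \<in> S" "b \<in> S" for a b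
      using that by (simp add: S_def GL_def invertible_mult matrix_mul_assoc)
    have "S = GL \<inter> closure S"
    proof (intro equalityI subsetI IntI)
      fix g assume "g \<in> GL \<inter> closure S"
      then have gGL: "g \<in> GL" and "g \<in> closure S" by blast+
      from this(2) obtain x where x: "\<And>n. x n \<in> S" "x \<longlonglongrightarrow> g"
        unfolding closure_sequential by blast
      have "B ** g \<in> H" if "B \<in> H" for B
      proof (rule lim)
        show "B ** x n \<in> H" for n using x(1)[of n] that by (simp add: S_def)
        show "(\<lambda>n. B ** x n) \<longlonglongrightarrow> B ** g" by (intro tendsto_intros x)
        show "B ** g \<noteq> 0" using that gGL by (intro mult_invertible_nonzero) (simp_all add: H_def GL_def)
      qed
      then show "g \<in> S" using gGL by (simp add: S_def)
    next
      fix g assume g: "g \<in> S"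
      then show "g \<in> GL" by (simp add: S_def)
      show "g \<in> closure S" using g closure_subset by blast
    qed
    then show "closedin (top_of_set GL) S"
      unfolding closedin_closed by (intro exI[of _ "closure S"] conjI closed_closure)
    \<comment> \<open>The exceptional null set of \<open>harmonic_energy_step\<close> depends on
      \<open>B\<close>. A countable dense subset provides a common one, and the rest of
      \<open>H\<close> is reached by limits.\<close>
    obtain D where D: "countable D" "D \<subseteq> H" "H \<subseteq> closure D" by (rule separable)
    have "AE g in \<mu>. \<forall>B\<in>D. B ** g \<in> H"
    proof (subst AE_ball_countable[OF D(1)], intro ballI)
      fix B assume "B \<in> D"
      then have "B \<in> H" using D by blast
      then have "B \<noteq> 0" "energy_sup B \<le> ennreal (energy B)" "barycenter B = barycenter A" by (simp_all add: H_def)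
      from harmonic_energy_step[OF this(1,2)] show "AE g in \<mu>. B ** g \<in> H"
        by eventually_elim (simp add: H_def \<open>barycenter B = barycenter A\<close>)
    qed
    then show "AE g in \<mu>. g \<in> S" using mu_invertible
    proof eventually_elim
      case (elim g)
      have "B ** g \<in> H" if "B \<in> H" for B
      proof -
        have "B \<in> closure D" using that D by blast
        then obtain x where x: "\<And>n. x n \<in> D" "x \<longlonglongrightarrow> B" unfolding closure_sequential by blast
        show ?thesis
        proof (rule lim)
          show "x n ** g \<in> H" for n using x(1) elim by blast
          show "(\<lambda>n. x n ** g) \<longlonglongrightarrow> B ** g" by (intro tendsto_intros x)
          show "B ** g \<noteq> 0" using that elim by (intro mult_invertible_nonzero) (simp_all add: H_def)
        qed
      qed
      then show "g \<in> S" using elim by (simp add: S_def GL_def)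
    qed
  qed
  moreover have "A \<in> H" using A by (simp add: H_def)
  ultimately have "A ** \<gamma> \<in> H" using g by (auto simp: S_def)
  then show ?thesis by (simp add: H_def)
qed

text \<open>The orbit of \<open>b\<close> spans an invariant subspace, which by (A1) is everything,
  and a nonzero matrix cannot vanish on it.\<close>

lemma Gamma_orbit_spans:
  assumes b: "b \<noteq> 0" and A: "A \<noteq> (0 :: real^'n^'n)" and ne: "Gamma \<mu> \<noteq> {}"
  shows "\<exists>\<gamma>\<in>Gamma \<mu>. A *v (\<gamma> *v b) \<noteq> 0"
proof (rule ccontr)
  assume no: "\<not> ?thesis"
  define X where "X = (\<lambda>\<gamma>. \<gamma> *v b) ` Gamma \<mu>"
  define W where "W = span X"
  have inv: "(*v) g ` W \<subseteq> W" if "g \<in> Gamma \<mu>" for g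
  proof -
    have "(*v) g ` X \<subseteq> X" using Gamma_mult[OF that] by (auto simp: X_def matrix_vector_mul_assoc)
    then have "span ((*v) g ` X) \<subseteq> span X" by (rule span_mono)
    then show ?thesis unfolding W_def by (simp add: linear_span_image)
  qed
  obtain g0 where g0: "g0 \<in> Gamma \<mu>" using ne by blast
  then have "g0 *v b \<noteq> 0" using Gamma_GL b by (intro invertible_mult_nonzero) (auto simp: GL_def)
  moreover have "g0 *v b \<in> W" using g0 by (auto simp: W_def X_def intro: span_base)
  ultimately have W0: "W \<noteq> {0}" by blast
  have "W = UNIV"
  proof (rule ccontr)
    assume "W \<noteq> UNIV"
    moreover have "subspace W" by (simp add: W_def)
    ultimately have "finite {W} \<and> {W} \<noteq> {} \<and> (\<forall>V\<in>{W}. subspace V \<and> V \<noteq> UNIV \<and> V \<noteq> {0}) \<and>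
      (\<forall>g\<in>Gamma \<mu>. (\<lambda>v. g *v v) ` (\<Union>{W}) \<subseteq> \<Union>{W})"
      using inv W0 by simp
    then have "\<exists>\<V>. finite \<V> \<and> \<V> \<noteq> {} \<and> (\<forall>V\<in>\<V>. subspace V \<and> V \<noteq> UNIV \<and> V \<noteq> {0}) \<and>
      (\<forall>g\<in>Gamma \<mu>. (\<lambda>v. g *v v) ` (\<Union>\<V>) \<subseteq> \<Union>\<V>)" by (rule exI)
    with A1 show False unfolding cond_A1_def by (rule notE)
  qed
  have "A *v x = 0" for x
  proof -
    have "x \<in> span X" using \<open>W = UNIV\<close> by (simp add: W_def)
    then show ?thesis
    proof (induction rule: span_induct_alt)
      case (step c x y)
      from step(1) obtain \<gamma> where "\<gamma> \<in> Gamma \<mu>" "x = \<gamma> *v b" unfolding X_def by (elim imageE)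
      then have "A *v x = 0" using no by simp
      then show ?case using step by (simp add: matrix_vector_right_distrib matrix_vector_mult_scaleR)
    qed simp
  qed
  then have "\<forall>x. A *v x = 0 *v x" by simp
  with A show False using matrix_eq[of A 0] by blast
qed

lemma harmonic_energy_eq_mass:
  assumes A2: "cond_A2 (Gamma \<mu>)" and A: "A \<noteq> 0" "energy_sup A \<le> ennreal (energy A)"
  shows "energy A = mass A"
proof -
  obtain g where g: "g \<in> Gamma \<mu>" "proximal g" using A2 by (auto simp: cond_A2_def)
  then have inv: "invertible g" using Gamma_GL by (auto simp: GL_def)
  from proximal_powers_tendsto[OF g(2) inv] obtain l b B where
    B: "l \<noteq> 0" "b \<noteq> 0" "B *v b = b" "\<And>v. \<exists>c. B *v v = c *\<^sub>R b"
    "(\<lambda>n. (1 / l) ^ n *\<^sub>R (((**) g) ^^ n) (mat 1)) \<longlonglongrightarrow> B" by blast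
  \<comment> \<open>This choice keeps the rank-one limit \<open>C\<close> away from 0, where the
    barycenter would not be continuous.\<close>
  obtain \<gamma> where \<gamma>: "\<gamma> \<in> Gamma \<mu>" "A *v (\<gamma> *v b) \<noteq> 0"
    using Gamma_orbit_spans[OF B(2) A(1)] g by blast
  define a where "a = A *v (\<gamma> *v b)"
  define P where "P n = (((**) g) ^^ n) (mat 1)" for n
  have PG: "\<gamma> ** P n \<in> Gamma \<mu>" for n
  proof (induction n)
    case (Suc n)
    have comm: "g ** P n = P n ** g" by (induction n) (simp_all add: P_def matrix_mul_assoc)
    have "\<gamma> ** P (Suc n) = (\<gamma> ** P n) ** g"
      using comm by (simp add: P_def matrix_mul_assoc[symmetric])
    then show ?case using Suc g Gamma_mult by simp
  qed (simp add: P_def \<gamma>)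
  have "barycenter (A ** (\<gamma> ** ((1 / l) ^ n *\<^sub>R P n))) = barycenter A" for n
  proof -
    have "A ** (\<gamma> ** ((1 / l) ^ n *\<^sub>R P n)) = (1 / l) ^ n *\<^sub>R (A ** (\<gamma> ** P n))"
      by (simp only: matrix_scalar_ac scalar_matrix_assoc[symmetric])
    then show ?thesis
      using B(1) harmonic_energy_Gamma[OF A PG[of n]] by (simp add: barycenter_scale)
  qed
  moreover define C where "C = A ** (\<gamma> ** B)"
  have Cb: "C *v b = a" by (simp add: C_def a_def matrix_vector_mul_assoc[symmetric] B)
  then have C0: "C \<noteq> 0" using \<gamma> by (auto simp: a_def)
  have "(\<lambda>n. A ** (\<gamma> ** ((1 / l) ^ n *\<^sub>R P n))) \<longlonglongrightarrow> C"
    unfolding C_def P_def by (intro tendsto_matrix_matrix tendsto_const B(5))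
  from barycenter_tendsto[OF this C0] have "barycenter C = barycenter A"
    using calculation by (simp add: LIMSEQ_const_iff)
  moreover have "barycenter C = outer a"
  proof -
    have "norm (C *v u) powr s *\<^sub>R outer (C *v u) = norm (C *v u) powr s *\<^sub>R outer a" for u
    proof -
      obtain c where "B *v u = c *\<^sub>R b" using B(4) by blast
      then have "C *v u = c *\<^sub>R a"
        by (simp add: C_def a_def matrix_vector_mul_assoc[symmetric] matrix_vector_mult_scaleR)
      then show ?thesis by (cases "c = 0") auto
    qed
    then have "moment C = (\<integral>u. norm (C *v u) powr s *\<^sub>R outer a \<partial>N)"
      unfolding moment_def by presburger
    also have "\<dots> = mass C *\<^sub>R outer a"
      unfolding mass_def by (simp add: integrable_mass)
    finally have "moment C = mass C *\<^sub>R outer a" .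
    then show ?thesis using mass_pos[OF C0] by (simp add: barycenter_def)
  qed
  \<comment> \<open>Norm one is the extreme value for a mean of projections of norm one; it says
    that moment and mass have the same size.\<close>
  ultimately have "norm (barycenter A) = 1" using \<gamma> norm_outer[of a] by (simp add: a_def)
  then have "norm (moment A) = mass A"
    using mass_pos[OF A(1)] by (simp add: barycenter_def field_simps)
  then show ?thesis using mass_pos[OF A(1)] by (simp add: energy_def power2_eq_square)
qed

section \<open>Mean energies at the identity\<close>

lemma mass_0 [simp]: "mass 0 = 0"
  by (simp add: mass_def)

lemma energy_0 [simp]: "energy 0 = 0"
  by (simp add: energy_def)

lemma energy_iter_one_tendsto:
  assumes "energy_sup (mat 1) = ennreal e" "0 \<le> e"
  shows "\<exists>a. (\<forall>n. energy_iter n (mat 1) = ennreal (a n) \<and> 0 \<le> a n) \<and> a \<longlonglongrightarrow> e"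
proof -
  define a where "a n = enn2real (energy_iter n (mat 1))" for n
  have "energy_iter n (mat 1) \<le> 1" for n
    using energy_iter_le_mass[of n "mat 1"] by (simp add: mass_one)
  then have a: "energy_iter n (mat 1) = ennreal (a n)" for n
    unfolding a_def using le_less_trans[OF _ ennreal_one_less_top] by (subst ennreal_enn2real) blast+
  have "(\<lambda>n. energy_iter n (mat 1)) \<longlonglongrightarrow> energy_sup (mat 1)"
    unfolding energy_sup_def using incseq_energy_iter by (rule LIMSEQ_SUP)
  then have "(\<lambda>n. ennreal (a n)) \<longlonglongrightarrow> ennreal e" by (simp add: a assms)
  moreover have "0 \<le> a n" for n by (simp add: a_def)
  ultimately have "a \<longlonglongrightarrow> e" using assms(2) by (subst (asm) tendsto_ennreal_iff) auto
  then show ?thesis using a \<open>\<And>n. 0 \<le> a n\<close> by blast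
qed

text \<open>A Markov inequality. Otherwise every \<open>h\<close> has nearly full energy or a large
  gap to the majorant. The gaps have mean tending to 0, so most of the mass would have energy close
  to full, although the mean energy never exceeds \<open>e\<close>.\<close>

lemma approximately_harmonic:
  assumes e: "energy_sup (mat 1) = ennreal e" "0 \<le> e" "e < 1" and \<eta>: "\<eta> > 0"
  shows "\<exists>h. h \<noteq> 0 \<and> energy h \<le> (1 - (1 - e) / 2) * mass h \<and> energy_sup h \<le> ennreal (energy h + \<eta> * mass h)"
proof (rule ccontr)
  assume no: "\<not> ?thesis"
  \<comment> \<open>Half of the room between \<open>e\<close> and 1, so that the final inequality 1
    \<le> \<delta> + e fails. The factor \<open>c\<close> turns a gap of \<eta> times the mass into
    the whole mass.\<close>
  define \<delta> where "\<delta> = (1 - e) / 2"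
  define c where "c = 1 / \<eta>"
  have c: "c > 0" "c * \<eta> = 1" and \<delta>: "\<delta> > 0" using \<eta> e by (auto simp: c_def \<delta>_def)
  \<comment> \<open>This reads mass \<le> (\<delta> mass + energy) + c (majorant - energy), with the
    subtracted term moved to the left. Each alternative alone is covered by one of the two
    summands.\<close>
  have pt: "ennreal (mass h) + ennreal c * ennreal (energy h)
      \<le> ennreal \<delta> * ennreal (mass h) + (ennreal (energy h) + ennreal c * energy_sup h)" for h
  proof (cases "h = 0")
    case False
    note nn = mass_nonneg[of h] energy_nonneg[of h]
    from no False consider "energy h > (1 - \<delta>) * mass h" | "energy_sup h > ennreal (energy h + \<eta> * mass h)"
      unfolding \<delta>_def by fastforce
    then show ?thesis
    proof cases
      case 1
      then have "mass h \<le> \<delta> * mass h + energy h" by (simp add: algebra_simps)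
      then have "ennreal (mass h) \<le> ennreal (\<delta> * mass h + energy h)" by (rule ennreal_leI)
      also have "\<dots> = ennreal \<delta> * ennreal (mass h) + ennreal (energy h)"
        using nn \<delta> by (simp add: ennreal_mult)
      finally have "ennreal (mass h) \<le> ennreal \<delta> * ennreal (mass h) + ennreal (energy h)" .
      then have "ennreal (mass h) + ennreal c * ennreal (energy h)
          \<le> (ennreal \<delta> * ennreal (mass h) + ennreal (energy h)) + ennreal c * energy_sup h"
        by (intro add_mono mult_left_mono energy_le_sup) auto
      then show ?thesis by (simp add: add.assoc)
    next
      case 2
      have "ennreal c * ennreal (energy h + \<eta> * mass h) = ennreal (c * (energy h + \<eta> * mass h))"
        using nn c(1) \<eta> by (intro ennreal_mult[symmetric]) simp_all
      also have "c * (energy h + \<eta> * mass h) = mass h + c * energy h"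
        using c(2) by (simp add: distrib_left mult.assoc[symmetric])
      also have "ennreal (mass h + c * energy h) = ennreal (mass h) + ennreal (c * energy h)"
        using nn c(1) by (intro ennreal_plus) simp_all
      also have "ennreal (c * energy h) = ennreal c * ennreal (energy h)"
        using nn c(1) by (intro ennreal_mult) simp_all
      finally have "ennreal (mass h) + ennreal c * ennreal (energy h) = ennreal c * ennreal (energy h + \<eta> * mass h)" ..
      also have "\<dots> \<le> ennreal c * energy_sup h" by (rule mult_left_mono[OF less_imp_le[OF 2]]) simp
      finally have "ennreal (mass h) + ennreal c * ennreal (energy h) \<le> ennreal c * energy_sup h" .
      then show ?thesis by (meson add_increasing zero_le)
    qed
  qed simp
  have fin: "1 + c * a \<le> \<delta> + a + c * e" if "energy_iter n (mat 1) = ennreal a" "0 \<le> a" for n a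
  proof -
    have "(avg ^^ n) (\<lambda>h. ennreal (mass h) + ennreal c * ennreal (energy h)) (mat 1)
      \<le> (avg ^^ n) (\<lambda>h. ennreal \<delta> * ennreal (mass h) + (ennreal (energy h) + ennreal c * energy_sup h)) (mat 1)"
      by (intro avg_iter_mono pt) simp
    moreover have "(avg ^^ n) (\<lambda>h. ennreal (mass h) + ennreal c * ennreal (energy h))
        = (\<lambda>h. (avg ^^ n) (\<lambda>h. ennreal (mass h)) h + (avg ^^ n) (\<lambda>h. ennreal c * ennreal (energy h)) h)"
      by (rule avg_iter_add) measurable
    moreover have "(avg ^^ n) (\<lambda>h. ennreal \<delta> * ennreal (mass h) + (ennreal (energy h) + ennreal c * energy_sup h))
        = (\<lambda>h. (avg ^^ n) (\<lambda>h. ennreal \<delta> * ennreal (mass h)) h + (avg ^^ n) (\<lambda>h. ennreal (energy h) + ennreal c * energy_sup h) h)"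
      by (rule avg_iter_add) measurable
    moreover have "(avg ^^ n) (\<lambda>h. ennreal (energy h) + ennreal c * energy_sup h)
        = (\<lambda>h. (avg ^^ n) (\<lambda>h. ennreal (energy h)) h + (avg ^^ n) (\<lambda>h. ennreal c * energy_sup h) h)"
      by (rule avg_iter_add) measurable
    moreover have "(avg ^^ n) (\<lambda>h. ennreal c * ennreal (energy h)) = (\<lambda>h. ennreal c * energy_iter n h)"
      unfolding energy_iter_def by (rule avg_iter_cmult) measurable
    moreover have "(avg ^^ n) (\<lambda>h. ennreal c * energy_sup h) = (\<lambda>h. ennreal c * (avg ^^ n) energy_sup h)"
      by (rule avg_iter_cmult) measurable
    moreover have "(avg ^^ n) (\<lambda>h. ennreal \<delta> * ennreal (mass h)) = (\<lambda>h. ennreal \<delta> * (avg ^^ n) (\<lambda>h. ennreal (mass h)) h)"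
      by (rule avg_iter_cmult) measurable
    ultimately have "ennreal 1 + ennreal c * ennreal a \<le> ennreal \<delta> * ennreal 1 + (ennreal a + ennreal c * ennreal e)"
      by (simp only: avg_iter_mass avg_iter_energy_sup mass_one e(1) energy_iter_def[symmetric] that(1))
    moreover have "ennreal 1 + ennreal c * ennreal a = ennreal (1 + c * a)"
    proof -
      have "ennreal (1 + c * a) = ennreal 1 + ennreal (c * a)" using c(1) that(2) by (intro ennreal_plus) simp_all
      also have "ennreal (c * a) = ennreal c * ennreal a" using c(1) that(2) by (intro ennreal_mult) simp_all
      finally show ?thesis ..
    qed
    moreover have "ennreal \<delta> * ennreal 1 + (ennreal a + ennreal c * ennreal e) = ennreal (\<delta> + a + c * e)"
    proof -
      have "ennreal (\<delta> + a + c * e) = ennreal (\<delta> + a) + ennreal (c * e)"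
        using c(1) that(2) e(2) \<delta> by (intro ennreal_plus) simp_all
      also have "ennreal (c * e) = ennreal c * ennreal e" using c(1) e(2) by (intro ennreal_mult) simp_all
      also have "ennreal (\<delta> + a) = ennreal \<delta> + ennreal a" using that(2) \<delta> by (intro ennreal_plus) simp_all
      finally show ?thesis by (simp only: add.assoc ennreal_1 mult_1_right)
    qed
    ultimately have "ennreal (1 + c * a) \<le> ennreal (\<delta> + a + c * e)" by simp
    then show ?thesis using c \<delta> e that(2) by (subst (asm) ennreal_le_iff) auto
  qed
  obtain a where a: "\<And>n. energy_iter n (mat 1) = ennreal (a n) \<and> 0 \<le> a n" "a \<longlonglongrightarrow> e"
    using energy_iter_one_tendsto[OF e(1,2)] by blast
  \<comment> \<open>In the limit the terms with \<open>c\<close> cancel, because mean energy and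
    majorant reach the same value \<open>e\<close>.\<close>
  have "1 + c * e \<le> \<delta> + e + c * e"
  proof (rule LIMSEQ_le)
    show "(\<lambda>n. 1 + c * a n) \<longlonglongrightarrow> 1 + c * e" "(\<lambda>n. \<delta> + a n + c * e) \<longlonglongrightarrow> \<delta> + e + c * e"
      by (intro tendsto_intros a)+
    show "\<exists>N. \<forall>n\<ge>N. 1 + c * a n \<le> \<delta> + a n + c * e" using fin a by blast
  qed
  then show False using e(3) unfolding \<delta>_def by argo
qed

lemma normalized_subsequence:
  fixes h :: "nat \<Rightarrow> 'b::euclidean_space"
  assumes "\<And>k. h k \<noteq> 0"
  shows "\<exists>r A. strict_mono (r :: nat \<Rightarrow> nat) \<and> norm A = 1 \<and> (\<lambda>k. (1 / norm (h (r k))) *\<^sub>R h (r k)) \<longlonglongrightarrow> A"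
proof -
  have "\<forall>k. (1 / norm (h k)) *\<^sub>R h k \<in> sphere 0 1" using assms by simp
  with compact_imp_seq_compact[OF compact_sphere] obtain A r where
    "A \<in> sphere (0 :: 'b) 1" "strict_mono r" "((\<lambda>k. (1 / norm (h k)) *\<^sub>R h k) \<circ> r) \<longlonglongrightarrow> A"
    by (rule seq_compactE)
  then show ?thesis by (intro exI[of _ r] exI[of _ A]) (simp add: o_def)
qed

text \<open>Energy equal to mass means a Dirac mass: the normalized images concentrate at points.\<close>
lemma energy_sup_one:
  assumes A2: "cond_A2 (Gamma \<mu>)"
  shows "energy_sup (mat 1) = 1"
proof (rule ccontr)
  assume ne: "energy_sup (mat 1) \<noteq> 1"
  have le1: "energy_sup (mat 1) \<le> 1" using energy_sup_le_mass[of "mat 1"] by (simp add: mass_one)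
  define e where "e = enn2real (energy_sup (mat 1))"
  have "energy_sup (mat 1) < top" by (rule le_less_trans[OF le1 ennreal_one_less_top])
  then have e: "energy_sup (mat 1) = ennreal e" by (simp add: e_def)
  have e0: "0 \<le> e" by (simp add: e_def)
  have "e \<le> 1" using le1 unfolding e by simp
  moreover have "e \<noteq> 1" using ne unfolding e by auto
  ultimately have e1: "e < 1" by simp
  define q where "q = 1 - (1 - e) / 2"
  have q: "q < 1" using e1 by (simp add: q_def)
  define \<epsilon> where "\<epsilon> k = inverse (real (Suc k))" for k
  have \<epsilon>: "\<epsilon> k > 0" for k by (simp add: \<epsilon>_def)
  have \<epsilon>0: "\<epsilon> \<longlonglongrightarrow> 0" unfolding \<epsilon>_def[abs_def] by (rule LIMSEQ_inverse_real_of_nat)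
  have "\<forall>k. \<exists>h. h \<noteq> 0 \<and> energy h \<le> q * mass h \<and> energy_sup h \<le> ennreal (energy h + \<epsilon> k * mass h)"
    unfolding q_def by (intro allI approximately_harmonic[OF e e0 e1] \<epsilon>)
  from choice[OF this] obtain h where hh:
    "\<forall>k. h k \<noteq> 0 \<and> energy (h k) \<le> q * mass (h k) \<and> energy_sup (h k) \<le> ennreal (energy (h k) + \<epsilon> k * mass (h k))"
    by (rule exE)
  note h = hh[THEN spec, THEN conjunct1] hh[THEN spec, THEN conjunct2, THEN conjunct1]
    hh[THEN spec, THEN conjunct2, THEN conjunct2]
  from normalized_subsequence[of h, OF h(1)] obtain r A where
    r: "strict_mono r" "norm A = 1" "(\<lambda>k. (1 / norm (h (r k))) *\<^sub>R h (r k)) \<longlonglongrightarrow> A"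
    by (elim exE conjE)
  define x where "x k = (1 / norm (h (r k))) *\<^sub>R h (r k)" for k
  have x: "x \<longlonglongrightarrow> A" using r(3) by (simp add: x_def[abs_def])
  have A0: "A \<noteq> 0" using r(2) by auto
  \<comment> \<open>\<open>mass\<close>, \<open>energy\<close> and \<open>energy_sup\<close> have
    the same degree of homogeneity, so both bounds survive the normalization.\<close>
  define p where "p k = \<bar>1 / norm (h (r k))\<bar> powr s" for k
  have p0: "0 \<le> p k" for k by (simp add: p_def)
  have sc: "mass (x k) = p k * mass (h (r k))" "energy (x k) = p k * energy (h (r k))"
    "energy_sup (x k) = ennreal (p k) * energy_sup (h (r k))" for k
    using h(1)[of "r k"] by (simp_all add: x_def p_def mass_scale energy_scale energy_sup_scale del: abs_divide)
  have x1: "energy (x k) \<le> q * mass (x k)" for k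
    using mult_left_mono[OF h(2)[of "r k"] p0[of k]] by (simp add: sc mult_ac)
  have x2: "energy_sup (x k) \<le> ennreal (energy (x k) + \<epsilon> (r k) * mass (x k))" for k
  proof -
    have "energy_sup (x k) \<le> ennreal (p k) * ennreal (energy (h (r k)) + \<epsilon> (r k) * mass (h (r k)))"
      unfolding sc by (intro mult_left_mono h) simp
    also have "\<dots> = ennreal (p k * (energy (h (r k)) + \<epsilon> (r k) * mass (h (r k))))"
      using p0[of k] \<epsilon>[of "r k"] energy_nonneg[of "h (r k)"] mass_nonneg[of "h (r k)"]
      by (intro ennreal_mult[symmetric]) simp_all
    also have "p k * (energy (h (r k)) + \<epsilon> (r k) * mass (h (r k))) = energy (x k) + \<epsilon> (r k) * mass (x k)"
      by (simp add: sc distrib_left mult.left_commute)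
    finally show ?thesis .
  qed
  have lim0: "(\<lambda>k. energy (x k) + \<epsilon> (r k) * mass (x k)) \<longlonglongrightarrow> energy A + 0 * mass A"
    using LIMSEQ_subseq_LIMSEQ[OF \<epsilon>0 r(1)]
    by (intro tendsto_add tendsto_mult energy_tendsto mass_tendsto x A0) (simp add: o_def)
  \<comment> \<open>At the limit the majorant no longer exceeds the energy, which forces energy and
    mass to agree, while the bound by \<open>q < 1\<close> persists.\<close>
  have "energy_sup A \<le> liminf (\<lambda>k. energy_sup (x k))" by (rule energy_sup_lsc[OF x A0])
  also have "\<dots> \<le> liminf (\<lambda>k. ennreal (energy (x k) + \<epsilon> (r k) * mass (x k)))"
    by (intro Liminf_mono always_eventually allI x2)
  also have "\<dots> = ennreal (energy A + 0 * mass A)"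
    by (intro lim_imp_Liminf tendsto_ennrealI lim0) simp
  finally have "energy A = mass A"
    by (intro harmonic_energy_eq_mass[OF A2 A0]) simp
  moreover have "energy A \<le> q * mass A"
    by (rule LIMSEQ_le[OF energy_tendsto[OF x A0] tendsto_mult_left[OF mass_tendsto[OF x A0]]]) (use x1 in blast)
  ultimately have "1 * mass A \<le> q * mass A" by simp
  then show False using q mass_pos[OF A0] by (simp add: mult_le_cancel_right)
qed

subsection \<open>Concentration on charged cones\<close>

definition cone_set :: "(real^'n) set \<Rightarrow> bool" where
  "cone_set Y \<longleftrightarrow> Y \<in> sets borel \<and> (\<forall>c v. c \<noteq> 0 \<longrightarrow> (c *\<^sub>R v \<in> Y \<longleftrightarrow> v \<in> Y))"

lemma invertible_nonzero: "invertible h \<Longrightarrow> h \<noteq> 0" for h :: "real^'n^'n"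
proof
  assume "invertible h" "h = 0"
  then obtain h' :: "real^'n^'n" where "0 ** h' = mat 1" unfolding invertible_def by auto
  then have "(mat 1 :: real^'n^'n) = 0" by simp
  then show False using mass_one by simp
qed

lemma avg_iter_lincomb:
  assumes [measurable]: "F \<in> borel_measurable borel" "G \<in> borel_measurable borel"
  shows "(avg ^^ n) (\<lambda>h. a * F h + b * G h) h = a * (avg ^^ n) F h + b * (avg ^^ n) G h"
  by (subst avg_iter_add, measurable) (simp add: avg_iter_cmult assms)

lemma ennreal_lincomb:
  assumes "0 \<le> a" "0 \<le> b" "0 \<le> x" "0 \<le> y"
  shows "ennreal a * ennreal x + ennreal b * ennreal y = ennreal (a * x + b * y)"
  using assms by (simp add: ennreal_mult)

lemma part_one: "part f (mat 1) = (\<integral>u. f u \<partial>N)" if [measurable]: "f \<in> borel_measurable borel"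
  unfolding part_def by (rule integral_cong_AE, measurable, use N_unit in eventually_elim) simp

lemma part_nonneg: "(\<And>v. 0 \<le> f v) \<Longrightarrow> 0 \<le> part f h"
  unfolding part_def by simp

text \<open>Expand the square; \<open>outer\<close> has norm one wherever the weight is nonzero. So
  mass minus energy measures the distance of the image from a point mass.\<close>

lemma variance_identity:
  "(\<integral>u. norm (h *v u) powr s * (norm (outer (h *v u) - barycenter h))\<^sup>2 \<partial>N) = mass h - energy h"
proof -
  let ?t = "barycenter h"
  have "norm (h *v u) powr s * (norm (outer (h *v u) - ?t))\<^sup>2
      = norm (h *v u) powr s - 2 * (((norm (h *v u) powr s) *\<^sub>R outer (h *v u)) \<bullet> ?t) + (norm ?t)\<^sup>2 * norm (h *v u) powr s" for u
  proof (cases "h *v u = 0")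
    case False
    then have "outer (h *v u) \<bullet> outer (h *v u) = 1" by (simp add: norm_outer flip: power2_norm_eq_inner)
    then have sq: "(norm (outer (h *v u) - ?t))\<^sup>2 = 1 - 2 * (outer (h *v u) \<bullet> ?t) + (norm ?t)\<^sup>2"
      by (simp add: power2_norm_eq_inner inner_diff_left inner_diff_right inner_commute)
    show ?thesis unfolding sq by (simp add: algebra_simps)
  qed simp
  then have "(\<integral>u. norm (h *v u) powr s * (norm (outer (h *v u) - ?t))\<^sup>2 \<partial>N)
      = (\<integral>u. norm (h *v u) powr s - 2 * (((norm (h *v u) powr s) *\<^sub>R outer (h *v u)) \<bullet> ?t) + (norm ?t)\<^sup>2 * norm (h *v u) powr s \<partial>N)"
    by presburger
  also have "\<dots> = mass h - 2 * (\<integral>u. ((norm (h *v u) powr s) *\<^sub>R outer (h *v u)) \<bullet> ?t \<partial>N) + (norm ?t)\<^sup>2 * mass h"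
    unfolding mass_def
    by (simp only: Bochner_Integration.integral_add Bochner_Integration.integral_diff integrable_mult_right
        Bochner_Integration.integrable_diff integral_mult_right_zero integrable_mass integrable_inner_left[OF integrable_moment])
  also have "(\<integral>u. ((norm (h *v u) powr s) *\<^sub>R outer (h *v u)) \<bullet> ?t \<partial>N) = moment h \<bullet> ?t"
    unfolding moment_def by (rule integral_inner_left[OF integrable_moment])
  finally have "(\<integral>u. norm (h *v u) powr s * (norm (outer (h *v u) - ?t))\<^sup>2 \<partial>N)
      = mass h - 2 * (moment h \<bullet> ?t) + (norm ?t)\<^sup>2 * mass h" .
  also have "\<dots> = mass h - energy h"
    using energy_defect_pointwise[of h ?t] by simp
  finally show ?thesis .
qed

text \<open>If the complement of \<open>Y\<close> keeps a share \<eta> of the mass, the indicator of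
  \<open>Y\<close> has variance at least \<eta> times the part in \<open>Y\<close>. But this
  indicator is close to a Lipschitz function of the projection, whose variance is controlled by that
  of the projection itself.\<close>

lemma concentration_estimate:
  assumes Y: "cone_set Y" and \<psi>: "continuous_on UNIV \<psi>" "\<And>x. 0 \<le> \<psi> x \<and> \<psi> x \<le> 1" "\<And>x y. \<bar>\<psi> x - \<psi> y\<bar> \<le> k * dist x y"
    and k: "0 \<le> k" and h: "\<eta> * mass h \<le> part (indicator (- Y)) h" "h \<noteq> 0"
  shows "\<eta> * part (indicator Y) h \<le> 2 * part (\<lambda>v. \<bar>indicator Y v - \<psi> (outer v)\<bar>) h + 2 * k\<^sup>2 * (mass h - energy h)"
proof -
  have [measurable]: "Y \<in> sets borel" using Y by (simp add: cone_set_def)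
  have [measurable]: "\<psi> \<in> borel_measurable borel" by (rule borel_measurable_continuous_onI[OF \<psi>(1)])
  let ?t = "barycenter h"
  let ?w = "\<lambda>u. norm (h *v u) powr s"
  define c where "c = \<psi> ?t"
  define y where "y = part (indicator Y) h"
  define z where "z = part (indicator (- Y)) h"
  define f where "f v = \<bar>indicator Y v - \<psi> (outer v)\<bar>" for v
  have [measurable]: "f \<in> borel_measurable borel" unfolding f_def by measurable
  have f1: "\<bar>f v\<bar> \<le> 1" for v using \<psi>(2)[of "outer v"] by (auto simp: f_def indicator_def)
  have m: "mass h > 0" using mass_pos h by simp
  have intY: "integrable N (\<lambda>u. ?w u * indicator Y (h *v u))" "integrable N (\<lambda>u. ?w u * indicator (- Y) (h *v u))"
    by (rule integrable_part[of _ 1]; simp add: indicator_def)+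
  have yz: "y + z = mass h"
  proof -
    have "y + z = (\<integral>u. ?w u * indicator Y (h *v u) + ?w u * indicator (- Y) (h *v u) \<partial>N)"
      unfolding y_def z_def part_def using intY by (rule Bochner_Integration.integral_add[symmetric])
    also have "\<dots> = mass h" unfolding mass_def
      by (intro Bochner_Integration.integral_cong refl) (auto simp: indicator_def)
    finally show ?thesis .
  qed
  have y0: "0 \<le> y" unfolding y_def by (rule part_nonneg) simp
  have "\<eta> * y * mass h \<le> y * z"
    using mult_left_mono[OF h(1) y0] by (simp add: z_def mult_ac)
  \<comment> \<open>The mean square deviation of the indicator from a constant is least at its mean,
    where it is y z / mass; \<open>c\<close> is merely another constant.\<close>
  also have "y * z \<le> mass h * (y * (1 - c)\<^sup>2 + z * c\<^sup>2)"
  proof -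
    have "mass h * (y * (1 - c)\<^sup>2 + z * c\<^sup>2) - y * z = (y - c * mass h)\<^sup>2"
      unfolding yz[symmetric] by (simp add: power2_eq_square algebra_simps)
    then show ?thesis using zero_le_power2[of "y - c * mass h"] by linarith
  qed
  finally have "\<eta> * y * mass h \<le> (y * (1 - c)\<^sup>2 + z * c\<^sup>2) * mass h" by (simp add: mult.commute)
  then have 1: "\<eta> * y \<le> y * (1 - c)\<^sup>2 + z * c\<^sup>2" using m by (simp add: mult_le_cancel_right)
  have "y * (1 - c)\<^sup>2 + z * c\<^sup>2 = (\<integral>u. (1 - c)\<^sup>2 * (?w u * indicator Y (h *v u)) + c\<^sup>2 * (?w u * indicator (- Y) (h *v u)) \<partial>N)"
    unfolding y_def z_def part_def using intY by (simp add: mult.commute)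
  also have "\<dots> \<le> (\<integral>u. 2 * (?w u * f (h *v u)) + 2 * k\<^sup>2 * (?w u * (norm (outer (h *v u) - ?t))\<^sup>2) \<partial>N)"
  proof (rule integral_mono)
    show "integrable N (\<lambda>u. (1 - c)\<^sup>2 * (?w u * indicator Y (h *v u)) + c\<^sup>2 * (?w u * indicator (- Y) (h *v u)))"
      using intY by (intro Bochner_Integration.integrable_add integrable_mult_right)
    have n2: "norm (outer v - ?t) \<le> 1 + norm ?t" for v :: "real^'n"
      using norm_triangle_ineq4[of "outer v" ?t] norm_outer_le[of v] by linarith
    have "\<bar>(norm (outer v - ?t))\<^sup>2\<bar> \<le> (1 + norm ?t)\<^sup>2" for v :: "real^'n"
      using power_mono[OF n2[of v] norm_ge_zero, of 2] by simp
    then have "integrable N (\<lambda>u. ?w u * (norm (outer (h *v u) - ?t))\<^sup>2)"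
      by (intro integrable_part[where f = "\<lambda>v. (norm (outer v - ?t))\<^sup>2"]) measurable
    then show "integrable N (\<lambda>u. 2 * (?w u * f (h *v u)) + 2 * k\<^sup>2 * (?w u * (norm (outer (h *v u) - ?t))\<^sup>2))"
      using integrable_part[of f 1 h] f1 by (intro Bochner_Integration.integrable_add integrable_mult_right) simp_all
    fix u
    let ?v = "h *v u"
    define i where "i = indicat_real Y ?v"
    define p where "p = \<psi> (outer ?v)"
    have fi: "f ?v = \<bar>i - p\<bar>" by (simp add: f_def i_def p_def)
    have ip: "\<bar>i - p\<bar> \<le> 1" using f1[of ?v] by (simp add: fi)
    have "\<bar>p - c\<bar> \<le> k * norm (outer ?v - ?t)" using \<psi>(3)[of "outer ?v" ?t] by (simp add: p_def c_def dist_norm)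
    then have pc: "(p - c)\<^sup>2 \<le> k\<^sup>2 * (norm (outer ?v - ?t))\<^sup>2"
      using power_mono[OF _ abs_ge_zero, of "p - c" _ 2] by (fastforce simp: power_mult_distrib)
    have sq: "(i - p)\<^sup>2 \<le> \<bar>i - p\<bar>"
      using mult_left_mono[OF ip, of "\<bar>i - p\<bar>"] by (simp add: power2_eq_square)
    have "(i - c)\<^sup>2 \<le> 2 * (i - p)\<^sup>2 + 2 * (p - c)\<^sup>2"
      using zero_le_power2[of "(i - p) - (p - c)"] by (simp add: power2_eq_square algebra_simps)
    also have "\<dots> \<le> 2 * f ?v + 2 * (k\<^sup>2 * (norm (outer ?v - ?t))\<^sup>2)" using sq pc fi by linarith
    finally have "?w u * (i - c)\<^sup>2 \<le> ?w u * (2 * f ?v + 2 * (k\<^sup>2 * (norm (outer ?v - ?t))\<^sup>2))"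
      by (rule mult_left_mono) simp
    moreover have "(1 - c)\<^sup>2 * (?w u * indicator Y ?v) + c\<^sup>2 * (?w u * indicator (- Y) ?v) = ?w u * (i - c)\<^sup>2"
      by (cases "?v \<in> Y") (simp_all add: i_def mult.commute)
    ultimately show "(1 - c)\<^sup>2 * (?w u * indicator Y ?v) + c\<^sup>2 * (?w u * indicator (- Y) ?v)
        \<le> 2 * (?w u * f ?v) + 2 * k\<^sup>2 * (?w u * (norm (outer ?v - ?t))\<^sup>2)"
      by (simp add: distrib_left mult_ac)
  qed
  also have "\<dots> = 2 * part f h + 2 * k\<^sup>2 * (mass h - energy h)"
  proof -
    have n2: "norm (outer v - ?t) \<le> 1 + norm ?t" for v :: "real^'n"
      using norm_triangle_ineq4[of "outer v" ?t] norm_outer_le[of v] by linarith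
    have "\<bar>(norm (outer v - ?t))\<^sup>2\<bar> \<le> (1 + norm ?t)\<^sup>2" for v :: "real^'n"
      using power_mono[OF n2[of v] norm_ge_zero, of 2] by simp
    then have i1: "integrable N (\<lambda>u. ?w u * (norm (outer (h *v u) - ?t))\<^sup>2)"
      by (intro integrable_part[where f = "\<lambda>v. (norm (outer v - ?t))\<^sup>2"]) measurable
    have i2: "integrable N (\<lambda>u. ?w u * f (h *v u))" by (rule integrable_part[of f 1 h]) (use f1 in simp_all)
    show ?thesis unfolding variance_identity[symmetric] part_def
      using i1 i2 by (simp only: Bochner_Integration.integral_add integrable_mult_right integral_mult_right_zero)
  qed
  finally show ?thesis using 1 unfolding y_def f_def[abs_def] by linarith
qed

text \<open>If the normalized images of the measure are nearly Dirac masses, a charged set cannot keep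
  a bounded fraction of all of them: some image lives almost entirely on it.\<close>
lemma exists_concentrating:
  assumes A2: "cond_A2 (Gamma \<mu>)" and Y: "cone_set Y" and pos: "measure N Y > 0" and \<eta>: "\<eta> > 0"
  shows "\<exists>h. invertible h \<and> part (indicator (- Y)) h < \<eta> * mass h"
proof (rule ccontr)
  assume "\<not> ?thesis"
  then have no: "\<eta> * mass h \<le> part (indicator (- Y)) h" if "invertible h" for h using that not_less by blast
  have [measurable]: "Y \<in> sets borel" using Y by (simp add: cone_set_def)
  have Yc: "c \<noteq> 0 \<Longrightarrow> c *\<^sub>R v \<in> Y \<longleftrightarrow> v \<in> Y" for c v using Y by (simp add: cone_set_def)
  define M where "M = distr N borel outer"
  interpret M: prob_space M unfolding M_def by (rule N.prob_space_distr) measurable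
  \<comment> \<open>The approximation is carried out among matrices, because Lipschitz functions of
    the projection are what the variance controls; \<open>B\<close> is \<open>Y\<close> seen through
    \<open>unit_section\<close>.\<close>
  define B where "B = unit_section -` Y"
  have B [measurable]: "B \<in> sets borel"
    using measurable_sets[OF borel_measurable_unit_section \<open>Y \<in> sets borel\<close>] by (simp add: B_def)
  have B_iff: "outer v \<in> B \<longleftrightarrow> v \<in> Y" if v: "v \<noteq> 0" for v
  proof -
    obtain c where "c \<noteq> 0" "unit_section (outer v) = c *\<^sub>R v" using unit_section_outer(1)[OF v] by (elim exE conjE)
    then show ?thesis using Yc by (simp add: B_def)
  qed
  have "measure M B = measure N Y"
  proof -
    have "measure M B = measure N (outer -` B)" unfolding M_def by (subst measure_distr) simp_all
    also have "\<dots> = measure N Y"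
    proof (rule measure_eq_AE)
      show "AE u in N. u \<in> outer -` B \<longleftrightarrow> u \<in> Y" using AE_nonzero by eventually_elim (simp add: B_iff)
      show "outer -` B \<in> sets N" using measurable_sets[OF borel_measurable_outer B] by (simp add: N_sets)
    qed (simp add: N_sets)
    finally show ?thesis .
  qed
  \<comment> \<open>With this choice 2 \<epsilon> is half of \<eta> times the mass of
    \<open>Y\<close>, which the limiting inequality does not allow.\<close>
  define \<epsilon> where "\<epsilon> = \<eta> * measure N Y / 4"
  have \<epsilon>: "\<epsilon> > 0" using \<eta> pos by (simp add: \<epsilon>_def)
  have "measure M B > 0" using pos \<open>measure M B = measure N Y\<close> by simp
  with lipschitz_approximation[OF _ M.finite_measure_axioms B _ \<epsilon>] obtain k \<psi> where
    k: "0 \<le> k" and \<psi>: "continuous_on UNIV \<psi>" "\<And>x. 0 \<le> \<psi> x \<and> \<psi> x \<le> 1" "\<And>x y. \<bar>\<psi> x - \<psi> y\<bar> \<le> k * dist x y"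
    and close: "(\<integral>x. \<bar>indicator B x - \<psi> x\<bar> \<partial>M) \<le> \<epsilon>"
    by (auto simp: M_def)
  have [measurable]: "\<psi> \<in> borel_measurable borel" by (rule borel_measurable_continuous_onI[OF \<psi>(1)])
  define f where "f v = \<bar>indicator Y v - \<psi> (outer v)\<bar>" for v
  have fm [measurable]: "f \<in> borel_measurable borel" unfolding f_def by measurable
  have f0: "0 \<le> f v" and f1: "f v \<le> 1" for v using \<psi>(2)[of "outer v"] by (auto simp: f_def indicator_def)
  have fc: "f (c *\<^sub>R v) = f v" if "c \<noteq> 0" for c v using that by (simp add: f_def indicator_def Yc)
  have f_le: "part f (mat 1) \<le> \<epsilon>"
  proof -
    have "part f (mat 1) = (\<integral>u. \<bar>indicator B (outer u) - \<psi> (outer u)\<bar> \<partial>N)"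
      unfolding part_one[OF fm]
      by (rule integral_cong_AE, measurable, use AE_nonzero in eventually_elim) (simp add: f_def indicator_def B_iff)
    also have "\<dots> = (\<integral>x. \<bar>indicator B x - \<psi> x\<bar> \<partial>M)" unfolding M_def by (simp add: integral_distr)
    finally show ?thesis using close by simp
  qed
  let ?Y = "indicat_real Y"
  have Ym: "?Y \<in> borel_measurable borel" by measurable
  have pY: "part ?Y (mat 1) = measure N Y" unfolding part_one[OF Ym] by simp
  define C where "C = 2 * k\<^sup>2"
  have C: "0 \<le> C" by (simp add: C_def)
  have pt: "ennreal \<eta> * ennreal (part ?Y h) + ennreal C * ennreal (energy h)
      \<le> ennreal 2 * ennreal (part f h) + ennreal C * ennreal (mass h)" if inv: "invertible h" for h
  proof -
    note h0 = invertible_nonzero[OF inv]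
    have "\<eta> * part ?Y h \<le> 2 * part f h + C * (mass h - energy h)"
      unfolding f_def[abs_def] C_def by (rule concentration_estimate[OF Y \<psi> k no[OF inv] h0])
    then have "\<eta> * part ?Y h + C * energy h \<le> 2 * part f h + C * mass h" by (simp add: right_diff_distrib)
    then have "ennreal (\<eta> * part ?Y h + C * energy h) \<le> ennreal (2 * part f h + C * mass h)" by (rule ennreal_leI)
    then show ?thesis
      using \<eta> C energy_nonneg[of h] mass_nonneg[of h] part_nonneg[of ?Y h] part_nonneg[of f h] f0
      by (subst (1 2) ennreal_lincomb) simp_all
  qed
  \<comment> \<open>Averaging leaves masses and parts unchanged and only raises the energy.
    \<open>C\<close> may be huge, but it is fixed before \<open>n\<close> tends to infinity, and its
    terms cancel as the mean energy tends to 1.\<close>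
  have fin: "\<eta> * measure N Y + C * a \<le> 2 * \<epsilon> + C" if a: "energy_iter n (mat 1) = ennreal a" "0 \<le> a" for n a
  proof -
    have "(avg ^^ n) (\<lambda>h. ennreal \<eta> * ennreal (part ?Y h) + ennreal C * ennreal (energy h)) (mat 1)
      \<le> (avg ^^ n) (\<lambda>h. ennreal 2 * ennreal (part f h) + ennreal C * ennreal (mass h)) (mat 1)"
      by (rule avg_iter_mono[OF pt invertible_mat_1])
    moreover have "(avg ^^ n) (\<lambda>h. ennreal \<eta> * ennreal (part ?Y h) + ennreal C * ennreal (energy h)) (mat 1)
        = ennreal \<eta> * (avg ^^ n) (\<lambda>h. ennreal (part ?Y h)) (mat 1) + ennreal C * energy_iter n (mat 1)"
      unfolding energy_iter_def by (rule avg_iter_lincomb) measurable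
    moreover have "(avg ^^ n) (\<lambda>h. ennreal 2 * ennreal (part f h) + ennreal C * ennreal (mass h)) (mat 1)
        = ennreal 2 * (avg ^^ n) (\<lambda>h. ennreal (part f h)) (mat 1) + ennreal C * (avg ^^ n) (\<lambda>h. ennreal (mass h)) (mat 1)"
      by (rule avg_iter_lincomb) measurable
    moreover have "(avg ^^ n) (\<lambda>h. ennreal (part ?Y h)) = (\<lambda>h. ennreal (part ?Y h))"
      by (rule avg_iter_part[of _ 1]) (simp_all add: indicator_def Yc)
    moreover have "(avg ^^ n) (\<lambda>h. ennreal (part f h)) = (\<lambda>h. ennreal (part f h))"
      by (rule avg_iter_part[OF fm f0 f1 fc])
    ultimately have "ennreal \<eta> * ennreal (measure N Y) + ennreal C * ennreal a
        \<le> ennreal 2 * ennreal (part f (mat 1)) + ennreal C * ennreal 1"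
      by (simp only: avg_iter_mass mass_one a(1) pY)
    then have "ennreal (\<eta> * measure N Y + C * a) \<le> ennreal (2 * part f (mat 1) + C * 1)"
      using \<eta> C a part_nonneg[of f "mat 1"] f0 by (subst (asm) (1 2) ennreal_lincomb) simp_all
    moreover have "0 \<le> 2 * part f (mat 1) + C * 1" using C part_nonneg[of f "mat 1"] f0 by simp
    ultimately have "\<eta> * measure N Y + C * a \<le> 2 * part f (mat 1) + C * 1" by (subst (asm) ennreal_le_iff)
    then show ?thesis using f_le by linarith
  qed
  have "energy_sup (mat 1) = ennreal 1" using energy_sup_one[OF A2] by simp
  from energy_iter_one_tendsto[OF this] obtain a where
    a: "\<And>n. energy_iter n (mat 1) = ennreal (a n) \<and> 0 \<le> a n" "a \<longlonglongrightarrow> 1" by auto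
  have "\<eta> * measure N Y + C * 1 \<le> 2 * \<epsilon> + C"
  proof (rule LIMSEQ_le_const2)
    show "(\<lambda>n. \<eta> * measure N Y + C * a n) \<longlonglongrightarrow> \<eta> * measure N Y + C * 1"
      by (intro tendsto_intros a(2))
    show "\<exists>N0. \<forall>n\<ge>N0. \<eta> * measure N Y + C * a n \<le> 2 * \<epsilon> + C"
      using fin[OF conjunct1[OF a(1)] conjunct2[OF a(1)]] by (intro exI[of _ 0] allI impI)
  qed
  then show False using \<eta> pos mult_pos_pos[OF \<eta> pos] by (simp add: \<epsilon>_def)
qed

section \<open>Limits of concentrating sequences and the dichotomy\<close>

lemma cone_setD:
  assumes "cone_set Y"
  shows "Y \<in> sets borel" "c \<noteq> 0 \<Longrightarrow> c *\<^sub>R v \<in> Y \<longleftrightarrow> v \<in> Y"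
  using assms by (simp_all add: cone_set_def)

lemma part_scale:
  assumes "cone_set Y" "c \<noteq> 0"
  shows "part (indicator (- Y)) (c *\<^sub>R h) = \<bar>c\<bar> powr s * part (indicator (- Y)) h"
proof -
  have "norm ((c *\<^sub>R h) *v u) powr s * indicator (- Y) ((c *\<^sub>R h) *v u)
      = \<bar>c\<bar> powr s * (norm (h *v u) powr s * indicator (- Y) (h *v u))" for u
    using cone_setD(2)[OF assms]
    by (simp add: scaleR_matrix_vector_assoc[symmetric] powr_mult indicator_def)
  then show ?thesis unfolding part_def by (simp only: integral_mult_right_zero)
qed

lemma concentrating_sequence:
  assumes A2: "cond_A2 (Gamma \<mu>)" and Y: "cone_set Y" and pos: "measure N Y > 0"
  shows "\<exists>h A. (\<forall>n :: nat. invertible (h n)) \<and> h \<longlonglongrightarrow> A \<and> A \<noteq> 0 \<and> (\<lambda>n. part (indicator (- Y)) (h n)) \<longlonglongrightarrow> 0"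
proof -
  define \<epsilon> where "\<epsilon> k = inverse (real (Suc k))" for k
  have \<epsilon>: "\<epsilon> k > 0" for k by (simp add: \<epsilon>_def)
  have \<epsilon>0: "\<epsilon> \<longlonglongrightarrow> 0" unfolding \<epsilon>_def[abs_def] by (rule LIMSEQ_inverse_real_of_nat)
  let ?p = "part (indicator (- Y))"
  have "\<forall>k. \<exists>h. invertible h \<and> ?p h < \<epsilon> k * mass h"
    by (intro allI exists_concentrating[OF A2 Y pos \<epsilon>])
  from choice[OF this] obtain h where hh: "\<forall>k. invertible (h k) \<and> ?p (h k) < \<epsilon> k * mass (h k)"
    by (rule exE)
  note h = hh[THEN spec, THEN conjunct1] hh[THEN spec, THEN conjunct2]
  note h0 = invertible_nonzero[OF h(1)]
  from normalized_subsequence[of h, OF h0] obtain r A where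
    r: "strict_mono r" "norm A = 1" "(\<lambda>k. (1 / norm (h (r k))) *\<^sub>R h (r k)) \<longlonglongrightarrow> A"
    by (elim exE conjE)
  define c where "c k = 1 / norm (h (r k))" for k
  define x where "x k = c k *\<^sub>R h (r k)" for k
  have c0: "c k \<noteq> 0" for k using h0 by (simp add: c_def)
  have x: "x \<longlonglongrightarrow> A" using r(3) by (simp add: x_def[abs_def] c_def)
  have A0: "A \<noteq> 0" using r(2) by auto
  have inv: "invertible (x k)" for k unfolding x_def using c0[of k] h(1)[of "r k"] by (rule scalar_invertible)
  have le: "?p (x k) \<le> \<epsilon> (r k) * mass (x k)" for k
  proof -
    have "?p (x k) = \<bar>c k\<bar> powr s * ?p (h (r k))" unfolding x_def by (rule part_scale[OF Y c0])
    also have "\<dots> \<le> \<bar>c k\<bar> powr s * (\<epsilon> (r k) * mass (h (r k)))"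
      by (rule mult_left_mono[OF less_imp_le[OF h(2)]]) simp
    also have "\<dots> = \<epsilon> (r k) * mass (x k)" unfolding x_def mass_scale by (simp only: mult.left_commute)
    finally show ?thesis .
  qed
  \<comment> \<open>After normalization the masses converge, so the relative bound becomes an
    absolute one.\<close>
  have "(\<lambda>k. \<epsilon> (r k) * mass (x k)) \<longlonglongrightarrow> 0 * mass A"
    using LIMSEQ_subseq_LIMSEQ[OF \<epsilon>0 r(1)]
    by (intro tendsto_mult mass_tendsto x A0) (simp add: o_def)
  then have up: "(\<lambda>k. \<epsilon> (r k) * mass (x k)) \<longlonglongrightarrow> 0" by simp
  have "(\<lambda>k. ?p (x k)) \<longlonglongrightarrow> 0"
  proof (rule tendsto_sandwich[OF _ _ tendsto_const up])
    show "\<forall>\<^sub>F k in sequentially. 0 \<le> ?p (x k)" by (intro always_eventually allI part_nonneg) simp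
    show "\<forall>\<^sub>F k in sequentially. ?p (x k) \<le> \<epsilon> (r k) * mass (x k)" by (intro always_eventually allI le)
  qed
  with inv x A0 show ?thesis by (intro exI[of _ x] exI[of _ A] conjI allI)
qed

text \<open>By Fatou the lower limit of the weighted indicators is 0 almost everywhere. If
  \<open>h n *v u\<close> eventually avoided \<open>Y\<close>, that lower limit would be the weight
  at \<open>A *v u\<close>, which is positive outside the kernel.\<close>

lemma concentrating_limit:
  fixes h :: "nat \<Rightarrow> real^'n^'n"
  assumes Y: "cone_set Y" and h: "h \<longlonglongrightarrow> A" and p: "(\<lambda>n. part (indicator (- Y)) (h n)) \<longlonglongrightarrow> 0"
  shows "AE u in N. A *v u = 0 \<or> (\<exists>\<^sub>F n in sequentially. h n *v u \<in> Y)"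
proof -
  note [measurable] = cone_setD(1)[OF Y]
  define t where "t n u = ennreal (norm (h n *v u) powr s * indicator (- Y) (h n *v u))" for n u
  have [measurable]: "t n \<in> borel_measurable borel" for n unfolding t_def by measurable
  have "(\<integral>\<^sup>+u. t n u \<partial>N) = ennreal (part (indicator (- Y)) (h n))" for n
    unfolding t_def part_def
    by (intro nn_integral_eq_integral integrable_part[of _ 1]) (simp_all add: indicator_def)
  then have lim: "(\<lambda>n. \<integral>\<^sup>+u. t n u \<partial>N) \<longlonglongrightarrow> 0" using tendsto_ennrealI[OF p] by simp
  have "(\<integral>\<^sup>+u. liminf (\<lambda>n. t n u) \<partial>N) \<le> liminf (\<lambda>n. \<integral>\<^sup>+u. t n u \<partial>N)"
    by (rule nn_integral_liminf) measurable
  also have "\<dots> = 0" by (rule lim_imp_Liminf[OF _ lim]) simp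
  finally have "(\<integral>\<^sup>+u. liminf (\<lambda>n. t n u) \<partial>N) = 0" by simp
  then have "AE u in N. liminf (\<lambda>n. t n u) = 0"
    by (subst (asm) nn_integral_0_iff_AE) measurable
  then show ?thesis
  proof eventually_elim
    case (elim u)
    show ?case
    proof (rule disjCI)
      assume "\<not> (\<exists>\<^sub>F n in sequentially. h n *v u \<in> Y)"
      then have ev: "\<forall>\<^sub>F n in sequentially. h n *v u \<notin> Y" by (simp add: not_frequently)
      show "A *v u = 0"
      proof (rule ccontr)
        assume nz: "A *v u \<noteq> 0"
        have "(\<lambda>n. norm (h n *v u) powr s) \<longlonglongrightarrow> norm (A *v u) powr s"
          using nz by (intro tendsto_powr tendsto_norm tendsto_matrix_vector h tendsto_const) simp
        then have l: "(\<lambda>n. ennreal (norm (h n *v u) powr s)) \<longlonglongrightarrow> ennreal (norm (A *v u) powr s)"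
          by (rule tendsto_ennrealI)
        have "\<forall>\<^sub>F n in sequentially. ennreal (norm (h n *v u) powr s) = t n u"
          using ev by eventually_elim (simp add: t_def)
        from Lim_transform_eventually[OF l this] have "liminf (\<lambda>n. t n u) = ennreal (norm (A *v u) powr s)"
          by (intro lim_imp_Liminf) simp_all
        with elim nz show False by simp
      qed
    qed
  qed
qed

lemma hyperplane_null:
  assumes A2: "cond_A2 (Gamma \<mu>)" and l: "l \<noteq> 0"
  shows "AE u in N. l \<bullet> u \<noteq> 0"
proof -
  define Y where "Y = {u. l \<bullet> u = 0}"
  have clY: "closed Y" unfolding Y_def by (rule closed_hyperplane)
  have Y: "cone_set Y" using borel_closed[OF clY] by (simp add: cone_set_def Y_def)
  have "measure N Y = 0"
  proof (rule ccontr)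
    assume "measure N Y \<noteq> 0"
    then have "measure N Y > 0" using measure_nonneg[of N Y] by linarith
    from concentrating_sequence[OF A2 Y this] obtain h A where
      h: "\<forall>n :: nat. invertible (h n)" "h \<longlonglongrightarrow> A" "A \<noteq> 0" "(\<lambda>n. part (indicator (- Y)) (h n)) \<longlonglongrightarrow> 0"
      by (elim exE conjE)
    \<comment> \<open>Normals of the hyperplanes h_n^{-1} Y. They are nonzero, so they converge
      after normalization along a subsequence, and a vector lying in infinitely many of these
      hyperplanes lies in the limiting one.\<close>
    define m where "m n = transpose (h n) *v l" for n
    have ml: "m n \<bullet> u = l \<bullet> (h n *v u)" for n u
      unfolding m_def by (simp add: dot_lmul_matrix)
    have m0: "m n \<noteq> 0" for n
    proof
      assume "m n = 0"
      then have z: "l \<bullet> (h n *v u) = 0" for u using ml[of n u] by simp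
      obtain g where "h n ** g = mat 1" using h(1) unfolding invertible_def by blast
      then have "h n *v (g *v l) = l" by (simp add: matrix_vector_mul_assoc)
      with z[of "g *v l"] l show False by simp
    qed
    from normalized_subsequence[of m, OF m0] obtain r w where
      r: "strict_mono r" "norm w = 1" "(\<lambda>k. (1 / norm (m (r k))) *\<^sub>R m (r k)) \<longlonglongrightarrow> w"
      by (elim exE conjE)
    have "(h \<circ> r) \<longlonglongrightarrow> A" "(\<lambda>n. part (indicator (- Y)) ((h \<circ> r) n)) \<longlonglongrightarrow> 0"
      using LIMSEQ_subseq_LIMSEQ[OF h(2) r(1)] LIMSEQ_subseq_LIMSEQ[OF h(4) r(1)] by (simp_all add: o_def)
    from concentrating_limit[OF Y this] have "AE u in N. u \<in> \<Union>{{u. A *v u = 0}, {u. w \<bullet> u = 0}}"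
    proof eventually_elim
      case (elim u)
      have "w \<bullet> u = 0" if fr: "\<exists>\<^sub>F n in sequentially. (h \<circ> r) n *v u \<in> Y"
      proof (rule ccontr)
        assume "w \<bullet> u \<noteq> 0"
        moreover have "(\<lambda>k. ((1 / norm (m (r k))) *\<^sub>R m (r k)) \<bullet> u) \<longlonglongrightarrow> w \<bullet> u"
          by (intro tendsto_inner r(3) tendsto_const)
        ultimately have "\<forall>\<^sub>F k in sequentially. ((1 / norm (m (r k))) *\<^sub>R m (r k)) \<bullet> u \<noteq> 0"
          by (rule tendsto_imp_eventually_ne[rotated])
        then have "\<forall>\<^sub>F k in sequentially. (h \<circ> r) k *v u \<notin> Y"
          by eventually_elim (simp add: Y_def ml)
        with fr show False by (simp add: frequently_def)
      qed
      with elim show ?case by auto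
    qed
    moreover have "subspace {u. A *v u = 0}" by (simp add: subspace_def matrix_vector_right_distrib matrix_vector_mult_scaleR)
    moreover have "{u. A *v u = 0} \<noteq> UNIV"
      using kernel_not_full[OF h(3)] by (auto simp: set_eq_iff)
    moreover have "subspace {u. w \<bullet> u = 0}" by (rule subspace_hyperplane)
    moreover have "{u. w \<bullet> u = 0} \<noteq> UNIV"
    proof
      assume "{u. w \<bullet> u = 0} = UNIV"
      then have "w \<bullet> w = 0" by blast
      with r(2) show False by simp
    qed
    ultimately show False using no_finite_cover[of "{{u. A *v u = 0}, {u. w \<bullet> u = 0}}"] by blast
  qed
  then have "Y \<in> null_sets N"
    using cone_setD(1)[OF Y] by (intro null_setsI) (simp_all add: N.emeasure_eq_measure N_sets)
  from AE_not_in[OF this] show ?thesis by (simp add: Y_def)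
qed

text \<open>The kernel lies in the hyperplane orthogonal to a nonzero row.\<close>

lemma kernel_null:
  assumes A2: "cond_A2 (Gamma \<mu>)" and A: "A \<noteq> (0 :: real^'n^'n)"
  shows "AE u in N. A *v u \<noteq> 0"
proof -
  obtain i where "A $ i \<noteq> 0" using A by (auto simp: vec_eq_iff)
  from hyperplane_null[OF A2 this] show ?thesis
  proof eventually_elim
    case (elim u)
    then have "(A *v u) $ i \<noteq> 0" by (simp add: matrix_vector_mul_component)
    then show ?case by auto
  qed
qed

text \<open>A single polynomial per matrix suffices for the limit. \<open>E\<close> and one further
  polynomial, composed with \<open>h n\<close>, span a space too large to miss a fixed complement of
  \<open>E\<close>. A normalized common element vanishes on h_n^{-1} Y; its limit stays nonzero in
  the complement, yet vanishes almost everywhere and so lies in \<open>E\<close>.\<close>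

lemma algebraic_zero_one:
  assumes A2: "cond_A2 (Gamma \<mu>)" and P: "finite P" "P \<subseteq> polys k"
    and Z: "Z = {v. \<forall>p\<in>P. p v = 0}" and cone: "\<And>c v. v \<in> Z \<Longrightarrow> c *\<^sub>R v \<in> Z"
  shows "measure N Z = 0 \<or> measure N Z = 1"
proof (rule ccontr)
  assume "\<not> ?thesis"
  then have N0: "measure N Z \<noteq> 0" and N1: "measure N Z \<noteq> 1" by simp_all
  have pos: "measure N Z > 0" using N0 measure_nonneg[of N Z] by linarith
  have cl: "closed {v. p v = 0}" if "p \<in> polys k" for p :: "real^'n \<Rightarrow> real"
    using closed_Collect_eq[OF continuous_on_polys[OF that] continuous_on_const] by simp
  have clZ: "closed Z"
  proof -
    have "Z = (\<Inter>p\<in>P. {v. p v = 0})" using Z by auto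
    then show ?thesis using cl P(2) by (auto intro!: closed_INT)
  qed
  have Zc: "c *\<^sub>R v \<in> Z \<longleftrightarrow> v \<in> Z" if c: "c \<noteq> 0" for c v
  proof
    assume "c *\<^sub>R v \<in> Z"
    from cone[OF this, of "1 / c"] show "v \<in> Z" using c by simp
  qed (rule cone)
  (* The polynomials need not be homogeneous, so vanishing is required along the whole line. *)
  define E where "E = {p \<in> polys k. AE u in N. \<forall>c. c \<noteq> 0 \<longrightarrow> p (c *\<^sub>R u) = 0}"
  have subE: "fs.subspace E"
  proof (rule fs.subspaceI)
    show "0 \<in> E" using polys_0[of k] by (simp add: E_def zero_fun_def)
    show "p + q \<in> E" if "p \<in> E" "q \<in> E" for p q
    proof -
      have "AE u in N. \<forall>c. c \<noteq> 0 \<longrightarrow> p (c *\<^sub>R u) = 0" "AE u in N. \<forall>c. c \<noteq> 0 \<longrightarrow> q (c *\<^sub>R u) = 0"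
        using that by (simp_all add: E_def)
      then have "AE u in N. \<forall>c. c \<noteq> 0 \<longrightarrow> (p + q) (c *\<^sub>R u) = 0" by eventually_elim simp
      moreover have "p + q \<in> polys k" using that polys_add[of p k q] by (simp add: E_def plus_fun_def)
      ultimately show ?thesis by (simp add: E_def)
    qed
    show "(\<lambda>x. c * p x) \<in> E" if "p \<in> E" for c p
    proof -
      have "AE u in N. \<forall>c. c \<noteq> 0 \<longrightarrow> p (c *\<^sub>R u) = 0" using that by (simp add: E_def)
      then have "AE u in N. \<forall>d. d \<noteq> 0 \<longrightarrow> c * p (d *\<^sub>R u) = 0" by eventually_elim simp
      then show ?thesis using that polys_scale[of p k c] by (simp add: E_def)
    qed
  qed
  \<comment> \<open>Since \<open>Z\<close> does not have full measure, some defining polynomial lies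
    outside \<open>E\<close>; it supplies the extra dimension.\<close>
  have "\<exists>p\<in>P. \<not> (AE u in N. p u = 0)"
  proof (rule ccontr)
    assume "\<not> ?thesis"
    then have "AE u in N. \<forall>p\<in>P. p u = 0" by (intro AE_finite_allI P(1)) blast
    then have "AE u in N. u \<in> Z" by (simp add: Z)
    then have "measure N Z = 1" using borel_closed[OF clZ] by (subst N.prob_eq_1) (simp_all add: N_sets)
    with N1 show False by simp
  qed
  then obtain p0 where p0: "p0 \<in> P" "\<not> (AE u in N. p0 u = 0)" by (elim bexE)
  have p0E: "p0 \<notin> E"
  proof
    assume "p0 \<in> E"
    then have "AE u in N. \<forall>c. c \<noteq> 0 \<longrightarrow> p0 (c *\<^sub>R u) = 0" by (simp add: E_def)
    then have "AE u in N. p0 u = 0" by eventually_elim (metis scaleR_one zero_neq_one)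
    with p0 show False by (elim notE)
  qed
  let ?m = "monomial ` {\<alpha> :: 'n \<Rightarrow> nat. sum \<alpha> UNIV \<le> k}"
  have finm: "finite ?m" using finite_exponents by (rule finite_imageI)
  have finI: "finite S" if "fs.independent S" "S \<subseteq> polys k" for S :: "(real^'n \<Rightarrow> real) set"
    using fs.independent_span_bound[OF finm that(1)] that(2) by (simp add: polys_def)
  obtain C where C: "C \<subseteq> E" "fs.independent C" "E \<subseteq> fs.span C" by (rule fs.maximal_independent_subset)
  have CW: "C \<subseteq> polys k" using C(1) by (auto simp: E_def)
  obtain F where F: "C \<subseteq> F" "F \<subseteq> polys k" "fs.independent F" "polys k \<subseteq> fs.span F"
    by (rule fs.maximal_independent_subset_extend[OF CW C(2)])
  \<comment> \<open>A basis of a complement of \<open>E\<close> that does not depend on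
    \<open>n\<close>, so that limits of coefficients make sense.\<close>
  define B where "B = F - C"
  have finF: "finite F" by (rule finI[OF F(3,2)])
  have finC: "finite C" and finB: "finite B" using finF F(1) by (auto simp: B_def intro: finite_subset)
  have spanC: "fs.span C = E" using C by (intro antisym fs.span_minimal subE)
  define D where "D = insert p0 C"
  have p0C: "p0 \<notin> fs.span C" using p0E spanC by simp
  have indD: "fs.independent D" unfolding D_def using C(2) p0C by (simp add: fs.independent_insert)
  have cardD: "card D = Suc (card C)"
  proof -
    have "p0 \<notin> C" using p0C fs.span_base by blast
    then show ?thesis using finC by (simp add: D_def)
  qed
  have finD: "finite D" using finC by (simp add: D_def)
  have DW: "D \<subseteq> polys k" using CW p0(1) P(2) by (auto simp: D_def)
  have cardF: "card F = card C + card B"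
    using card_Un_disjoint[OF finC finB] F(1) by (simp add: B_def Un_absorb1)
  \<comment> \<open>The common zeros of the basis along whole lines. The basis is finite, so
    \<open>T\<close> has full measure; intersecting with it changes \<open>Z\<close> by a null set
    and makes all of \<open>D\<close> vanish.\<close>
  define T where "T = {v. \<forall>p\<in>C. \<forall>c. c \<noteq> 0 \<longrightarrow> p (c *\<^sub>R v) = 0}"
  have clT: "closed T"
  proof -
    have "T = (\<Inter>p\<in>C. \<Inter>c\<in>{c. c \<noteq> 0}. (\<lambda>v. c *\<^sub>R v) -` {v. p v = 0})" by (auto simp: T_def)
    moreover have "closed ((\<lambda>v. c *\<^sub>R v) -` {v. p v = 0})" if "p \<in> C" for c :: real and p
      using CW that by (intro closed_vimage cl continuous_intros) blast
    ultimately show ?thesis by (auto intro!: closed_INT)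
  qed
  have aeT: "AE u in N. u \<in> T"
  proof -
    have "AE u in N. \<forall>p\<in>C. \<forall>c. c \<noteq> 0 \<longrightarrow> p (c *\<^sub>R u) = 0"
      using C(1) by (intro AE_finite_allI finC) (auto simp: E_def)
    then show ?thesis by (simp add: T_def)
  qed
  define Y where "Y = Z \<inter> T"
  have Y: "cone_set Y"
    unfolding cone_set_def
  proof (intro conjI allI impI)
    show "Y \<in> sets borel" unfolding Y_def by (intro borel_closed closed_Int clZ clT)
    fix c :: real and v :: "real^'n" assume c: "c \<noteq> 0"
    have T_scale: "c *\<^sub>R v \<in> T" if c: "c \<noteq> 0" and v: "v \<in> T" for c v
      unfolding T_def
    proof (intro CollectI ballI allI impI)
      fix p d assume "p \<in> C" "d \<noteq> (0 :: real)"
      then have "p ((d * c) *\<^sub>R v) = 0" using v c unfolding T_def by simp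
      then show "p (d *\<^sub>R c *\<^sub>R v) = 0" by simp
    qed
    have "c *\<^sub>R v \<in> T \<longleftrightarrow> v \<in> T"
      using T_scale[OF c, of v] T_scale[of "1 / c" "c *\<^sub>R v"] c by auto
    then show "c *\<^sub>R v \<in> Y \<longleftrightarrow> v \<in> Y" using Zc[OF c] by (simp add: Y_def)
  qed
  have DY: "p v = 0" if "p \<in> D" "v \<in> Y" for p v
  proof (cases "p = p0")
    case True
    have "v \<in> Z" using that(2) by (simp add: Y_def)
    then show ?thesis using True p0(1) unfolding Z by blast
  next
    case False
    then have "p \<in> C" using that(1) by (simp add: D_def)
    moreover have "v \<in> T" using that(2) by (simp add: Y_def)
    ultimately have "\<forall>c. c \<noteq> 0 \<longrightarrow> p (c *\<^sub>R v) = 0" unfolding T_def by blast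
    from spec[OF this, of 1] show ?thesis by simp
  qed
  have "measure N Y = measure N Z"
  proof (rule measure_eq_AE)
    show "AE u in N. u \<in> Y \<longleftrightarrow> u \<in> Z" using aeT by eventually_elim (simp add: Y_def)
  qed (use cone_setD(1)[OF Y] borel_closed[OF clZ] in \<open>simp_all add: N_sets\<close>)
  then have "measure N Y > 0" using pos by simp
  from concentrating_sequence[OF A2 Y this] obtain h A where
    h: "\<forall>n :: nat. invertible (h n)" "h \<longlonglongrightarrow> A" "A \<noteq> 0" "(\<lambda>n. part (indicator (- Y)) (h n)) \<longlonglongrightarrow> 0"
    by (elim exE conjE)
  have "\<exists>a. (\<Sum>b\<in>B. \<bar>a b\<bar>) = 1 \<and> (\<forall>v. h n *v v \<in> Y \<longrightarrow> (\<Sum>b\<in>B. a b * b v) = 0)" for n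
  proof -
    define f where "f i = (case i of Inl p \<Rightarrow> (\<lambda>v. p (h n *v v)) | Inr b \<Rightarrow> b)" for i :: "(real^'n \<Rightarrow> real) + (real^'n \<Rightarrow> real)"
    have "f i \<in> fs.span F" if "i \<in> D <+> B" for i
      using that
    proof (rule PlusE)
      fix p assume p: "p \<in> D" "i = Inl p"
      then have "p \<in> polys k" using DW by blast
      then have "f i \<in> polys k" using polys_compose[of p k "h n"] p(2) by (simp add: f_def)
      then show ?thesis using F(4) by blast
    next
      fix b assume "b \<in> B" "i = Inr b"
      then show ?thesis using fs.span_base[of b F] by (simp add: f_def B_def)
    qed
    \<comment> \<open>\<open>D <+> B\<close> has one element more than the basis \<open>F\<close>,
      hence a relation.\<close>
    moreover have "card F < card (D <+> B)"
      using finD finB by (simp add: card_Plus cardD cardF)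
    ultimately obtain x where x: "\<exists>i\<in>D <+> B. x i \<noteq> 0" "\<forall>v. (\<Sum>i\<in>D <+> B. x i * f i v) = 0"
      using dependent_family[of "D <+> B" F f] finD finB finF by auto
    have sum: "(\<Sum>p\<in>D. x (Inl p) * p (h n *v v)) + (\<Sum>b\<in>B. x (Inr b) * b v) = 0" for v
      using x(2) finD finB by (simp add: sum.Plus f_def)
    \<comment> \<open>Otherwise the relation would hold among the members of \<open>D\<close>
      composed with \<open>h n\<close>, and these are independent because \<open>h n\<close> is
      onto.\<close>
    have "\<exists>b\<in>B. x (Inr b) \<noteq> 0"
    proof (rule ccontr)
      assume "\<not> ?thesis"
      then have xB: "x (Inr b) = 0" if "b \<in> B" for b using that by blast
      obtain g where g: "h n ** g = mat 1" using h(1) unfolding invertible_def by blast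
      have "(\<Sum>p\<in>D. x (Inl p) * p w) = 0" for w
      proof -
        have "h n *v (g *v w) = w" by (simp add: matrix_vector_mul_assoc g)
        then show ?thesis using sum[of "g *v w"] xB by simp
      qed
      then have "(\<Sum>p\<in>D. (\<lambda>w. x (Inl p) * p w)) = 0" by (simp add: fun_eq_iff fun_sum_apply)
      then have "x (Inl p) = 0" if "p \<in> D" for p
        using fs.independentD[OF indD finD subset_refl, of "\<lambda>p. x (Inl p)" p] that by simp
      with xB x(1) show False by (elim bexE PlusE) auto
    qed
    then obtain b0 where b0: "b0 \<in> B" "x (Inr b0) \<noteq> 0" by (elim bexE)
    define S where "S = (\<Sum>b\<in>B. \<bar>x (Inr b)\<bar>)"
    have "\<bar>x (Inr b0)\<bar> \<le> S" unfolding S_def using b0(1) finB by (intro member_le_sum) auto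
    then have S: "S > 0" using b0(2) by linarith
    define a where "a b = x (Inr b) / S" for b
    have "(\<Sum>b\<in>B. \<bar>a b\<bar>) = (\<Sum>b\<in>B. \<bar>x (Inr b)\<bar>) / S"
      using S by (simp add: a_def sum_divide_distrib)
    then have "(\<Sum>b\<in>B. \<bar>a b\<bar>) = 1" using S by (simp add: S_def)
    moreover have "(\<Sum>b\<in>B. a b * b v) = 0" if "h n *v v \<in> Y" for v
    proof -
      have "(\<Sum>p\<in>D. x (Inl p) * p (h n *v v)) = 0" using DY[OF _ that] by (intro sum.neutral) simp
      then have "(\<Sum>b\<in>B. x (Inr b) * b v) = 0" using sum[of v] by simp
      then have "(\<Sum>b\<in>B. x (Inr b) * b v) / S = 0" by simp
      then show ?thesis by (simp add: a_def sum_divide_distrib)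
    qed
    ultimately show ?thesis by (intro exI[of _ a] conjI allI impI)
  qed
  then have "\<forall>n. \<exists>a. (\<Sum>b\<in>B. \<bar>a b\<bar>) = 1 \<and> (\<forall>v. h n *v v \<in> Y \<longrightarrow> (\<Sum>b\<in>B. a b * b v) = 0)" by (rule allI)
  from choice[OF this] obtain a where
    aa: "\<forall>n. (\<Sum>b\<in>B. \<bar>a n b\<bar>) = 1 \<and> (\<forall>v. h n *v v \<in> Y \<longrightarrow> (\<Sum>b\<in>B. a n b * b v) = 0)" by (rule exE)
  note a = aa[THEN spec, THEN conjunct1] aa[THEN spec, THEN conjunct2, THEN spec, THEN mp]
  have a1: "\<bar>a n b\<bar> \<le> 1" if "b \<in> B" for n b
    using member_le_sum[of b B "\<lambda>b. \<bar>a n b\<bar>"] that finB a(1)[of n] by simp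
  have "\<exists>r l. strict_mono (r :: nat \<Rightarrow> nat) \<and> (\<forall>b\<in>B. (\<lambda>n. a (r n) b) \<longlonglongrightarrow> l b)"
    by (rule bounded_family_subsequence[OF finB a1])
  then obtain r l where
    r: "strict_mono (r :: nat \<Rightarrow> nat)" and l: "\<forall>b\<in>B. (\<lambda>n. a (r n) b) \<longlonglongrightarrow> l b" by (elim exE conjE)
  have "(\<lambda>n. \<Sum>b\<in>B. \<bar>a (r n) b\<bar>) \<longlonglongrightarrow> (\<Sum>b\<in>B. \<bar>l b\<bar>)"
    using l by (intro tendsto_sum tendsto_rabs) blast
  \<comment> \<open>The normalization survives the limit, so not all coefficients of the limiting
    polynomial are 0.\<close>
  then have l1: "(\<Sum>b\<in>B. \<bar>l b\<bar>) = 1" by (simp add: a(1) LIMSEQ_const_iff)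
  define q where "q v = (\<Sum>b\<in>B. l b * b v)" for v
  have qlim: "(\<lambda>n. \<Sum>b\<in>B. a (r n) b * b v) \<longlonglongrightarrow> q v" for v
    unfolding q_def using l by (intro tendsto_sum tendsto_mult tendsto_const) blast
  have qW: "q \<in> polys k" unfolding q_def
    using F(2) by (intro polys_sum polys_scale finB) (auto simp: B_def)
  have "(h \<circ> r) \<longlonglongrightarrow> A" "(\<lambda>n. part (indicator (- Y)) ((h \<circ> r) n)) \<longlonglongrightarrow> 0"
    using LIMSEQ_subseq_LIMSEQ[OF h(2) r(1)] LIMSEQ_subseq_LIMSEQ[OF h(4) r(1)] by (simp_all add: o_def)
  \<comment> \<open>A vector sent into \<open>Y\<close> infinitely often is a zero of infinitely
    many of the approximating polynomials, hence of their limit; as \<open>Y\<close> is a cone, so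
    is its whole punctured line.\<close>
  from concentrating_limit[OF Y this] kernel_null[OF A2 h(3)]
  have "AE u in N. \<forall>c. c \<noteq> 0 \<longrightarrow> q (c *\<^sub>R u) = 0"
  proof eventually_elim
    case (elim u)
    then have fr: "\<exists>\<^sub>F n in sequentially. (h \<circ> r) n *v u \<in> Y" by blast
    show ?case
    proof (intro allI impI)
      fix c :: real assume c: "c \<noteq> 0"
      show "q (c *\<^sub>R u) = 0"
      proof (rule ccontr)
        assume "q (c *\<^sub>R u) \<noteq> 0"
        with qlim[of "c *\<^sub>R u"] have "\<forall>\<^sub>F n in sequentially. (\<Sum>b\<in>B. a (r n) b * b (c *\<^sub>R u)) \<noteq> 0"
          by (rule tendsto_imp_eventually_ne)
        then have "\<forall>\<^sub>F n in sequentially. (h \<circ> r) n *v u \<notin> Y"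
        proof eventually_elim
          case (elim n)
          then have "h (r n) *v (c *\<^sub>R u) \<notin> Y" using a(2) by blast
          then show ?case using cone_setD(2)[OF Y c] by (simp add: matrix_vector_mult_scaleR)
        qed
        with fr show False by (simp add: frequently_def)
      qed
    qed
  qed
  then have "q \<in> fs.span C" using qW by (simp add: spanC E_def)
  then obtain z where z: "q = (\<Sum>c\<in>C. (\<lambda>v. z c * c v))" using fs.span_finite[OF finC] by auto
  \<comment> \<open>Coefficients of the difference of the two expressions of \<open>q\<close>, one
    in \<open>B\<close> and one in \<open>C\<close>: a relation in the basis
    \<open>F\<close>.\<close>
  define y where "y f = (if f \<in> C then - z f else l f)" for f
  have FCB: "F = C \<union> B" "C \<inter> B = {}" using F(1) by (auto simp: B_def)
  have "(\<Sum>f\<in>F. (\<lambda>v. y f * f v)) = 0"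
  proof
    fix v
    have "(\<Sum>f\<in>F. (\<lambda>v. y f * f v)) v = (\<Sum>f\<in>C. y f * f v) + (\<Sum>f\<in>B. y f * f v)"
      unfolding fun_sum_apply FCB(1) by (rule sum.union_disjoint[OF finC finB FCB(2)])
    also have "(\<Sum>f\<in>C. y f * f v) = - q v" by (simp add: z fun_sum_apply y_def sum_negf)
    also have "(\<Sum>f\<in>B. y f * f v) = q v"
      unfolding q_def by (intro sum.cong refl) (simp add: y_def B_def)
    finally show "(\<Sum>f\<in>F. (\<lambda>v. y f * f v)) v = 0 v" by simp
  qed
  then have "y f = 0" if "f \<in> F" for f
    using fs.independentD[OF F(3) finF subset_refl, of y f] that by simp
  then have "l b = 0" if "b \<in> B" for b using that by (force simp: y_def B_def)
  then have "(\<Sum>b\<in>B. \<bar>l b\<bar>) = 0" by simp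
  with l1 show False by simp
qed

end

section \<open>The zero-one law\<close>

theorem theorem2p6:
  fixes \<mu> :: "(real^'n^'n) measure"
    and \<nu> :: "((real^'n) set) measure"
    and s \<kappa> :: real
    and Y :: "((real^'n) set) set"
  assumes d: "CARD('n) \<ge> 2"
    and mu_borel: "sets \<mu> = sets borel"
    and mu_prob: "prob_space \<mu>"
    and mu_GL: "AE g in \<mu>. g \<in> GL"
    and A1: "cond_A1 (Gamma \<mu>)"
    and A2: "cond_A2 (Gamma \<mu>)"
    and s: "s \<in> I_plus \<mu>"
    and nu_sets: "sets \<nu> = sets proj_borel"
    and nu_prob: "prob_space \<nu>"
    and kappa: "\<kappa> > 0"
    and eigen: "\<And>\<phi>. proj_continuous \<phi> \<Longrightarrow>
        (\<integral>x. transfer_op \<mu> s \<phi> x \<partial>\<nu>) = \<kappa> * (\<integral>x. \<phi> x \<partial>\<nu>)"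
    and Y_alg: "proj_algebraic Y"
    and Y_proper: "Y \<noteq> Proj"
  shows "measure \<nu> Y = 0 \<or> measure \<nu> Y = 1"
proof -
  note [measurable_cong] = nu_sets
  interpret \<nu>: prob_space \<nu> by fact
  have sp: "space \<nu> = Proj" using sets_eq_imp_space_eq[OF nu_sets] by (simp add: space_proj_borel)
  define N where "N = distr \<nu> borel section_of"
  interpret eigenmeasure \<mu> N s \<kappa>
  proof (rule eigenmeasure.intro)
    show "AE g in \<mu>. invertible g" using mu_GL by (simp add: GL_def)
    show "prob_space N" unfolding N_def by (rule \<nu>.prob_space_distr) measurable
    show "AE u in N. norm u = 1"
      unfolding N_def by (subst AE_distr_iff) (auto simp: sp section_of_rep(2))
    show "0 \<le> s" using s by (simp add: I_plus_def)
    show "(\<integral>\<^sup>+g. \<integral>\<^sup>+u. ennreal (norm (g *v u) powr s) * F (g *v u) \<partial>N \<partial>\<mu>) = ennreal \<kappa> * (\<integral>\<^sup>+u. F u \<partial>N)"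
      if "F \<in> borel_measurable borel" "\<And>c v. c \<noteq> 0 \<Longrightarrow> F (c *\<^sub>R v) = F v" for F
      unfolding N_def
      by (rule eigenmeasure_on_vectors[OF mu_borel mu_prob mu_GL s nu_sets nu_prob kappa eigen that])
    show "sets N = sets borel" by (simp add: N_def)
  qed (fact mu_borel mu_prob A1 kappa)+
  obtain P Z where P: "finite P" "\<forall>p\<in>P. poly_fun p" and Z: "Z = {v. \<forall>p\<in>P. p v = 0}"
    and cone: "\<forall>c v. v \<in> Z \<longrightarrow> c *\<^sub>R v \<in> Z" and Y: "Y = {pline v | v. v \<in> Z \<and> v \<noteq> 0}"
    using Y_alg unfolding proj_algebraic_def by blast
  obtain k where k: "P \<subseteq> polys k" using finite_poly_funs_in_polys[OF P(1)] P(2) by blast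
  have "closed Z"
  proof -
    have "Z = (\<Inter>p\<in>P. {v. p v = 0})" using Z by auto
    moreover have "closed {v. p v = 0}" if "p \<in> P" for p
      using closed_Collect_eq[OF continuous_on_polys continuous_on_const] that k by blast
    ultimately show ?thesis by (auto intro!: closed_INT)
  qed
  then have [measurable]: "Z \<in> sets borel" by (rule borel_closed)
  \<comment> \<open>As \<open>Z\<close> is a cone, it does not matter which vector of the line the
    section picks. This also exhibits \<open>Y\<close> as a measurable set.\<close>
  have "section_of -` Z \<inter> space \<nu> = Y"
  proof (intro equalityI subsetI)
    fix x assume x: "x \<in> section_of -` Z \<inter> space \<nu>"
    then have xP: "x \<in> Proj" and xZ: "section_of x \<in> Z" by (simp_all add: sp)
    obtain c where c: "\<bar>c\<bar> = 1 / norm (rep x)" "section_of x = c *\<^sub>R rep x"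
      using section_of_rep(1)[OF xP] by (elim exE conjE)
    have "c \<noteq> 0" using c(1) rep_Proj(1)[OF xP] by auto
    then have "rep x = (1 / c) *\<^sub>R section_of x" by (simp add: c(2))
    then have "rep x \<in> Z" using cone xZ by simp
    then show "x \<in> Y" unfolding Y using rep_Proj[OF xP] by blast
  next
    fix x assume "x \<in> Y"
    then obtain v where v: "x = pline v" "v \<in> Z" "v \<noteq> 0" unfolding Y by blast
    obtain c where "c \<noteq> 0" "unit_section (outer v) = c *\<^sub>R v" using unit_section_outer(1)[OF v(3)] by (elim exE conjE)
    then have "section_of x \<in> Z" using cone v(2) by (simp add: v(1) section_of_pline[OF v(3)])
    moreover have "x \<in> Proj" unfolding Proj_def using v by blast
    ultimately show "x \<in> section_of -` Z \<inter> space \<nu>" by (simp add: sp)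
  qed
  then have "measure N Z = measure \<nu> Y" unfolding N_def by (subst measure_distr) simp_all
  moreover have "measure N Z = 0 \<or> measure N Z = 1"
    by (rule algebraic_zero_one[OF A2 P(1) k Z]) (use cone in blast)
  ultimately show ?thesis by simp
qed

end
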